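(* Assume the Generalized Riemann Hypothesis for Dirichlet $L$-functions. Let $p$ be an odd prime and $x\ge 2$. Then $$ N_{\mathcal{S}}(p, x) =\frac{\phi(p-1)}{p-1} \left\{\sum_{\substack{r\leq x^{1/3} \\ r \ \text{prime}}}(\chi_0(r)-\chi_2(r))\, \mathrm{Li}\!\left(\frac{x^{1/2}}{r^{3/2}}\right)+ O\!\left(2^{\omega(p-1)}x^{1/3}\log^2 (px)\right)\right\}, $$ with an absolute implied constant.
   Context: $\mathcal{S}$ is the set of integers of the form $n=q^2r^3$ with $q$ and $r$ primes. $N_{\mathcal{S}}(p,x)$ denotes the number of elements of $\mathcal{S}$ not exceeding $x$ that are primitive roots modulo $p$. $\chi_0$ is the principal character modulo $p$ and $\chi_2$ the quadratic (Legendre symbol) character modulo $p$. $\mathrm{Li}$ is the logarithmic integral, $\phi$ is Euler's totient function and $\omega(n)$ the number of distinct prime divisors of $n$.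
   Formalization: Li(y) is the integral of 1/log t from 2 to y for y ≥ 2 and is taken to be 0 for y < 2, because the usual logarithmic integral diverges at y = 1, a value that the argument takes when x = r^3 (e.g. p = 3, x = 8, r = 2). *)

theory Defs
  imports
    "HOL-Number_Theory.Number_Theory"
    "HOL-Complex_Analysis.Complex_Analysis"
begin

definition dirichlet_character :: "nat \<Rightarrow> (nat \<Rightarrow> complex) \<Rightarrow> bool" where
  "dirichlet_character q chi \<longleftrightarrow>
     q > 0 \<and>
     (\<forall>m n. chi (m * n) = chi m * chi n) \<and>
     (\<forall>n. chi (n + q) = chi n) \<and>
     (\<forall>n. chi n \<noteq> 0 \<longleftrightarrow> coprime n q)"

text \<open>
  The analytic continuation of the Dirichlet series to the punctured half-plane
  \<open>Re s > 0\<close>, \<open>s \<noteq> 1\<close>. It exists for every Dirichlet character, and it is unique because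
  the punctured half-plane is connected, so the choice operator is determined there
  (values elsewhere are irrelevant). This domain contains the open critical strip.
\<close>
definition dirichlet_L :: "(nat \<Rightarrow> complex) \<Rightarrow> complex \<Rightarrow> complex" where
  "dirichlet_L chi =
     (SOME L. L holomorphic_on ({s. Re s > 0} - {1}) \<and>
        (\<forall>s. Re s > 1 \<longrightarrow>
           (\<lambda>n. chi (Suc n) / of_nat (Suc n) powr s) sums L s))"

text \<open>
  All characters of all moduli are included; modulus 1 gives the Riemann zeta function.
  The zeros that imprimitive characters acquire from Euler factors have real part 0, hence
  lie outside the open strip.
\<close>
definition GRH :: bool where
  "GRH \<longleftrightarrow>
     (\<forall>q chi s. dirichlet_character q chi \<longrightarrow> 0 < Re s \<longrightarrow> Re s < 1 \<longrightarrow>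
        dirichlet_L chi s = 0 \<longrightarrow> Re s = 1 / 2)"

text \<open>
  For \<open>y < 2\<close> the interval is empty and the value is 0, not the negatively oriented integral;
  the latter tends to minus infinity as \<open>y\<close> decreases to 1.
\<close>
definition Li :: "real \<Rightarrow> real" where
  "Li y = integral {2..y} (\<lambda>t. 1 / ln t)"

definition set_S :: "nat set" where
  "set_S = {n. \<exists>q r. prime q \<and> prime r \<and> n = q ^ 2 * r ^ 3}"

definition N_S :: "nat \<Rightarrow> real \<Rightarrow> nat" where
  "N_S p x = card {n \<in> set_S. real n \<le> x \<and> residue_primroot p n}"

definition chi0 :: "nat \<Rightarrow> nat \<Rightarrow> real" where
  "chi0 p n = (if coprime n p then 1 else 0)"

definition chi2 :: "nat \<Rightarrow> nat \<Rightarrow> real" where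
  "chi2 p n = real_of_int (Legendre (int n) (int p))"

end

theory Submission
  imports Defs
begin

text \<open>
  Only a saving of exponent \<open>5/8 < 2/3\<close> is needed: if \<open>\<Sum>\<^bsub>q \<le> y\<^esub> \<xi>(q)\<close> and \<open>\<pi>(y) - Li y\<close> are
  \<open>O(log p y\<^bsup>5/8\<^esup>)\<close>, then inserting \<open>y = x\<^bsup>1/2\<^esup> r\<^bsup>-3/2\<^esup>\<close> and summing over \<open>r \<le> x\<^bsup>1/3\<^esup>\<close> gives
  \<open>O(log p x\<^bsup>1/3\<^esup>)\<close>. Such bounds follow from a zero-free half-plane \<open>Re s > 1/2\<close> by
  bounding \<open>L'/L\<close> on a fixed line with Borel--Caratheodory and integrating it against the kernel
  \<open>x\<^bsup>s+1\<^esup> / (s (s + 1))\<close>, without counting zeros.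

  The indicator of primitive roots is
  \<open>\<phi>(p-1)/(p-1) \<Prod>\<^sub>l (1 - (l-1)\<^sup>-\<^sup>1 \<Sum>\<^bsub>0<j<l\<^esub> e(j ind(n)/l))\<close> over the primes \<open>l\<close> dividing \<open>p - 1\<close>.
  Expanding the product over sets of primes \<open>X\<close>, the sets \<open>\<emptyset>\<close> and \<open>{2}\<close> produce \<open>\<chi>\<^sub>0\<close> and \<open>-\<chi>\<^sub>2\<close>.
  If \<open>X\<close> contains an odd prime, the characters \<open>\<chi>\<close> that occur satisfy \<open>\<chi>\<^sup>4 \<noteq> \<chi>\<^sub>0\<close>; hence
  \<open>\<xi> = \<chi>\<^sup>2\<close> is not real, and nonvanishing of \<open>L(s, \<xi>)\<close> on the line \<open>Re s = 1\<close>, which is not part of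
  the hypothesis, follows from the 3-4-1 inequality alone.
\<close>

section \<open>A Tauberian theorem with power saving\<close>

text \<open>Only one variable is summed with cancellation: a character \<open>chi\<close> takes
  \<open>q^2 r^3\<close> to \<open>chi(q)^2 chi(r)^3\<close>, the sum over \<open>q\<close> sees
  \<open>chi^2\<close>, and \<open>r\<close> is estimated trivially. Hence every \<open>chi\<close>
  with principal square must go into the main term. Because the expansion runs over sets of primes,
  all its characters have squarefree order, and only the principal and the quadratic one are of this
  kind. Characters of order 4, whose square is real and whose value at \<open>s = 1\<close> the
  3-4-1 argument cannot reach, do not occur at all.

  The number of characters is harmless: those attached to \<open>X\<close> carry total weight 1,
  since the factors \<open>1/(l-1)\<close> cancel their number. This leaves one error term per set,
  hence the factor \<open>2^omega(p-1)\<close>.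

  The exponent \<open>5/8\<close> is \<open>9/16 + 1/16\<close>: the contour lies on
  \<open>Re s = 9/16\<close>, and differencing with step \<open>h = sqrt x\<close> costs
  \<open>(x/h)^(1/8)\<close>. An exponent below \<open>2/3\<close> makes the power
  \<open>3/2 * 5/8 = 15/16\<close> of \<open>1/r\<close> smaller than 1, so that the sum over
  \<open>r\<close> loses no logarithm.\<close>

abbreviation vint :: "real \<Rightarrow> real \<Rightarrow> (complex \<Rightarrow> complex) \<Rightarrow> complex" where
  "vint c T f \<equiv> contour_integral (linepath (Complex c (-T)) (Complex c T)) f"

section \<open>Vertical segments closed by circular arcs, and the basic Perron integrals\<close>

lemma contour_integrable_part_circlepath_sphere:
  assumes "r \<ge> 0" "continuous_on (sphere z r) f"
  shows "f contour_integrable_on part_circlepath z r a b"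
  using assms path_image_part_circlepath_subset'[of r z a b]
  by (blast intro: contour_integrable_continuous_part_circlepath continuous_on_subset)

text \<open>The segment is a diameter of the circle and \<open>f\<close> is holomorphic near the
  closed right half-disc apart from the arc ends being on the line \<open>Re s = c > c'\<close>, so
  Cauchy's theorem turns the segment into the right semicircle; poles may lie on the left. The right
  semicircle comes as two arcs because \<open>circlepath\<close> starts at angle 0, in its
  middle.\<close>

lemma circle_split_vertical:
  fixes c T c' :: real and f :: "complex \<Rightarrow> complex"
  assumes T: "T > 0" and c': "c' < c" and holo: "f holomorphic_on {s. Re s > c'}"
    and cont: "continuous_on (sphere (of_real c) T) f"
  defines "seg \<equiv> linepath (Complex c (-T)) (Complex c T)"
  shows "contour_integral seg f =
      contour_integral (part_circlepath c T (3*pi/2) (2*pi)) f + contour_integral (part_circlepath c T 0 (pi/2)) f"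
    and "contour_integral (circlepath c T) f =
      contour_integral seg f + contour_integral (part_circlepath c T (pi/2) (3*pi/2)) f"
proof -
  have int: "f contour_integrable_on part_circlepath c T a b" for a b
    using T cont by (intro contour_integrable_part_circlepath_sphere) auto
  define g where "g = (\<lambda>t. f (c + T * cis t) * T * \<i> * cis t)"
  have hi: "(g has_integral contour_integral (part_circlepath c T a b) f) {a..b}" if "a < b" for a b
    using has_contour_integral_part_circlepath_iff[OF that, of f "contour_integral (part_circlepath c T a b) f" "of_real c" T]
      int[of a b] by (simp add: g_def has_contour_integral_integral)
  have comb: "contour_integral (part_circlepath c T a b) f + contour_integral (part_circlepath c T b d) f
      = contour_integral (part_circlepath c T a d) f" if "a < b" "b < d" for a b d
  proof -
    have "(g has_integral (contour_integral (part_circlepath c T a b) f + contour_integral (part_circlepath c T b d) f)) {a..d}"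
      by (rule has_integral_combine[OF _ _ hi[OF that(1)] hi[OF that(2)]]) (use that in auto)
    from has_integral_unique[OF this hi[of a d]] that show ?thesis by linarith
  qed
  have e1: "exp (\<i> * (complex_of_real pi * 3) / 2) = - \<i>"
  proof -
    have "exp (\<i> * (complex_of_real pi * 3) / 2) = cis (pi + pi/2)"
      by (simp add: cis_conv_exp field_simps)
    also have "\<dots> = cis pi * cis (pi/2)" by (simp only: cis_mult)
    also have "\<dots> = - \<i>" by (simp add: complex_eq_iff)
    finally show ?thesis .
  qed
  have e2: "exp (\<i> * complex_of_real pi / 2) = \<i>"
    using cis_conv_exp[of "pi/2"] by (simp add: complex_eq_iff)
  have e3: "exp (\<i> * (complex_of_real pi * 2)) = 1"
    by (metis exp_two_pi_i mult.commute mult.assoc)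
  define P where "P = part_circlepath c T (3*pi/2) (2*pi)"
  define Q where "Q = part_circlepath c T 0 (pi/2)"
  define R where "R = linepath (Complex c T) (Complex c (-T))"
  have ends: "pathfinish P = pathstart Q" "pathfinish Q = pathstart R" "pathfinish R = pathstart P"
    by (simp_all add: P_def Q_def R_def e1 e2 e3 mult_ac Complex_eq)
  have inP: "Re z \<ge> c" if "z \<in> path_image P" for z
  proof -
    obtain x where x: "3*pi/2 \<le> x" "x \<le> 2*pi" "z = c + T * exp (\<i> * of_real x)"
      using \<open>z \<in> path_image P\<close> unfolding P_def by (subst (asm) path_image_part_circlepath) auto
    have "cos x = cos (2*pi - x)" by (simp add: cos_diff)
    also have "\<dots> \<ge> 0" using x by (intro cos_ge_zero) auto
    finally show ?thesis using x T by (simp flip: cis_conv_exp)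
  qed
  have inQ: "Re z \<ge> c" if "z \<in> path_image Q" for z
  proof -
    obtain x where x: "0 \<le> x" "x \<le> pi/2" "z = c + T * exp (\<i> * of_real x)"
      using \<open>z \<in> path_image Q\<close> unfolding Q_def by (subst (asm) path_image_part_circlepath) auto
    have "cos x \<ge> 0" using x by (intro cos_ge_zero) auto
    thus ?thesis using x T by (simp flip: cis_conv_exp)
  qed
  have inR: "Re z = c" if "z \<in> path_image R" for z
    using that by (auto simp: R_def closed_segment_same_Re)
  have cv: "convex {s. Re s > c'}" by (rule convex_halfspace_Re_gt)
  have "(f has_contour_integral 0) (P +++ Q +++ R)"
  proof (rule Cauchy_theorem_convex_simple[OF holo cv])
    show "valid_path (P +++ Q +++ R)"
      using ends by (simp add: valid_path_join P_def Q_def R_def)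
    show "path_image (P +++ Q +++ R) \<subseteq> {s. c' < Re s}"
      using ends inP inQ inR c' by (force simp: path_image_join)
    show "pathfinish (P +++ Q +++ R) = pathstart (P +++ Q +++ R)"
      using ends by simp
  qed
  moreover have intR: "f contour_integrable_on R"
    unfolding R_def
    by (rule contour_integrable_continuous_linepath, rule holomorphic_on_imp_continuous_on,
        rule holomorphic_on_subset[OF holo]) (use c' in \<open>auto simp: closed_segment_same_Re\<close>)
  moreover have vp: "valid_path P" "valid_path Q" "valid_path R" by (simp_all add: P_def Q_def R_def)
  moreover have ints: "f contour_integrable_on P" "f contour_integrable_on Q" by (simp_all add: P_def Q_def int)
  moreover have "f contour_integrable_on Q +++ R" "valid_path (Q +++ R)"
    using ints intR vp ends by (auto intro: contour_integrable_joinI valid_path_join)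
  ultimately have "contour_integral P f + (contour_integral Q f + contour_integral R f) = 0"
    by (metis contour_integral_join contour_integral_unique)
  moreover have "contour_integral R f = - contour_integral seg f"
    unfolding R_def seg_def
    by (rule contour_integral_reverse_linepath, rule holomorphic_on_imp_continuous_on,
        rule holomorphic_on_subset[OF holo]) (use c' in \<open>auto simp: closed_segment_same_Re\<close>)
  ultimately show 1: "contour_integral seg f =
      contour_integral (part_circlepath c T (3*pi/2) (2*pi)) f + contour_integral (part_circlepath c T 0 (pi/2)) f"
    by (simp add: P_def Q_def algebra_simps add_eq_0_iff)
  show "contour_integral (circlepath c T) f =
      contour_integral seg f + contour_integral (part_circlepath c T (pi/2) (3*pi/2)) f"
    unfolding 1 circlepath_def using comb[of 0 "pi/2" "2*pi"] comb[of "pi/2" "3*pi/2" "2*pi"] pi_gt_zero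
    by (simp add: algebra_simps)
qed

text \<open>For integrands that are small to the right: the two quarter arcs have total length
  \<open>pi * T\<close>, and no residue arises.\<close>

lemma vertical_segment_bound_right:
  fixes c T c' :: real and f :: "complex \<Rightarrow> complex"
  assumes T: "T > 0" and c': "c' < c" and holo: "f holomorphic_on {s. Re s > c'}"
    and cont: "continuous_on (sphere (of_real c) T) f"
    and B: "B \<ge> 0" "\<And>s::complex. cmod (s - c) = T \<Longrightarrow> Re s \<ge> c \<Longrightarrow> cmod (f s) \<le> B"
  shows "cmod (vint c T f) \<le> B * T * pi"
proof -
  have int: "f contour_integrable_on part_circlepath c T a b" for a b
    using T cont by (intro contour_integrable_part_circlepath_sphere) auto
  have b: "cmod (contour_integral (part_circlepath c T u v) f) \<le> B * T * \<bar>v - u\<bar>"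
    if uv: "u \<le> v" "\<And>x. u \<le> x \<Longrightarrow> x \<le> v \<Longrightarrow> cos x \<ge> 0" for u v
  proof (rule contour_integral_bound_part_circlepath[OF int B(1)])
    fix z assume "z \<in> path_image (part_circlepath c T u v)"
    then obtain x where x: "u \<le> x" "x \<le> v" "z = c + T * exp (\<i> * of_real x)"
      using uv by (subst (asm) path_image_part_circlepath) auto
    show "cmod (f z) \<le> B" using x T uv(2)[of x]
      by (intro B(2)) (auto simp: norm_mult simp flip: cis_conv_exp)
  qed (use T in auto)
  have 1: "cmod (contour_integral (part_circlepath c T (3*pi/2) (2*pi)) f) \<le> B * T * (pi/2)"
  proof -
    have "cos x \<ge> 0" if "3*pi/2 \<le> x" "x \<le> 2*pi" for x
    proof -
      have "cos x = cos (2*pi - x)" by (simp add: cos_diff)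
      also have "\<dots> \<ge> 0" using that by (intro cos_ge_zero) auto
      finally show ?thesis .
    qed
    then have "cmod (contour_integral (part_circlepath c T (3*pi/2) (2*pi)) f) \<le> B * T * \<bar>2*pi - 3*pi/2\<bar>"
      by (intro b) auto
    thus ?thesis by (simp add: field_simps)
  qed
  have 2: "cmod (contour_integral (part_circlepath c T 0 (pi/2)) f) \<le> B * T * (pi/2)"
    using b[of 0 "pi/2"] cos_ge_zero by force
  have "cmod (vint c T f) \<le> B*T*(pi/2) + B*T*(pi/2)"
    unfolding circle_split_vertical(1)[OF T c' holo cont] using 1 2 by (rule norm_triangle_mono)
  thus ?thesis by (simp add: field_simps)
qed

text \<open>For integrands that are small to the left: the full circle collects the residues, and
  only the left semicircle of length \<open>pi * T\<close> is estimated.\<close>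

lemma vertical_segment_bound_left:
  fixes c T c' :: real and f :: "complex \<Rightarrow> complex"
  assumes T: "T > 0" and c': "c' < c" and holo: "f holomorphic_on {s. Re s > c'}"
    and cont: "continuous_on (sphere (of_real c) T) f"
    and B: "B \<ge> 0" "\<And>s::complex. cmod (s - c) = T \<Longrightarrow> Re s \<le> c \<Longrightarrow> cmod (f s) \<le> B"
  shows "cmod (vint c T f - contour_integral (circlepath c T) f) \<le> B * T * pi"
proof -
  have int: "f contour_integrable_on part_circlepath c T a b" for a b
    using T cont by (intro contour_integrable_part_circlepath_sphere) auto
  have "cmod (contour_integral (part_circlepath c T (pi/2) (3*pi/2)) f) \<le> B * T * \<bar>3*pi/2 - pi/2\<bar>"
  proof (rule contour_integral_bound_part_circlepath[OF int B(1)])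
    fix z assume "z \<in> path_image (part_circlepath c T (pi/2) (3*pi/2))"
    then obtain x where x: "pi/2 \<le> x" "x \<le> 3*pi/2" "z = c + T * exp (\<i> * of_real x)"
      by (subst (asm) path_image_part_circlepath) auto
    have "cos (x - pi) \<ge> 0" using x by (intro cos_ge_zero) auto
    hence "cos x \<le> 0" by (simp add: cos_diff)
    thus "cmod (f z) \<le> B" using x T
      by (intro B(2)) (auto simp: norm_mult mult_le_0_iff simp flip: cis_conv_exp)
  qed (use T in auto)
  thus ?thesis unfolding circle_split_vertical(2)[OF T c' holo cont] by simp
qed

lemma cmod_powr_of_real: "y > 0 \<Longrightarrow> cmod (of_real y powr s) = y powr Re s"
  by (simp add: norm_powr_real_powr)

text \<open>The poles \<open>1\<close>, \<open>0\<close>, \<open>-1\<close> of the kernels lie at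
  distance 2, 3, 4 from the centre 3, and \<open>T >= 8\<close> keeps these distances at most
  \<open>T / 2\<close>.\<close>

lemma sphere_ge:
  fixes s :: complex
  assumes "cmod (s - 3) = T" "T \<ge> 8"
  shows "T / 2 \<le> cmod s" "T / 2 \<le> cmod (s + 1)" "T / 2 \<le> cmod (s - 1)"
proof -
  show "T / 2 \<le> cmod s" using norm_triangle_ineq4[of s 3] assms by simp
  show "T / 2 \<le> cmod (s+1)" using norm_triangle_ineq4[of "s+1" 4] assms by (simp add: algebra_simps)
  show "T / 2 \<le> cmod (s-1)" using norm_triangle_ineq4[of "s-1" 2] assms by (simp add: algebra_simps)
qed

text \<open>The residues at \<open>0\<close> and \<open>-1\<close> are \<open>1\<close> and
  \<open>- 1 / y\<close>. For \<open>y >= 1\<close> the integrand is small on the left arc, for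
  \<open>y < 1\<close> on the right arc; either way a size of order \<open>T^-2\<close> meets an arc
  of length \<open>pi * T\<close>.\<close>

lemma perron_kernel:
  fixes y T :: real
  assumes y: "y > 0" and T: "T \<ge> 8"
  shows "cmod (vint 3 T (\<lambda>s. of_real y powr s / (s * (s + 1)))
           - 2 * pi * \<i> * max 0 (1 - 1 / y)) \<le> 4 * pi * y ^ 3 / T"
proof -
  define f where "f = (\<lambda>s::complex. of_real y powr s / (s * (s + 1)))"
  have nz: "s \<noteq> 0" "s + 1 \<noteq> 0" if "Re s > 0" for s using that by (auto simp: complex_eq_iff)
  have nz': "s \<noteq> 0" "s + 1 \<noteq> 0" if "cmod (s - 3) = T" for s using sphere_ge[OF that T] T by auto
  have holo: "f holomorphic_on {s. Re s > 0}"
    unfolding f_def using nz y by (auto intro!: holomorphic_intros)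
  have cont: "continuous_on (sphere (of_real 3) T) f"
    unfolding f_def using nz' y by (auto intro!: continuous_intros simp: dist_norm norm_minus_commute)
  have bd: "cmod (f s) \<le> 4 * y ^ 3 / T\<^sup>2" if "cmod (s - of_real 3) = T" "y powr Re s \<le> y ^ 3" for s
  proof -
    have "T / 2 * (T / 2) \<le> cmod s * cmod (s + 1)"
      using sphere_ge[of s T] that T by (intro mult_mono) auto
    hence "cmod (f s) \<le> y ^ 3 / (T / 2 * (T / 2))"
      unfolding f_def norm_divide norm_mult using that y T
      by (intro frac_le) (auto simp: cmod_powr_of_real)
    thus ?thesis by (simp add: power2_eq_square field_simps)
  qed
  show ?thesis
  proof (cases "y \<ge> 1")
    case True
    have "((\<lambda>s. of_real y powr s / (s - 0)) has_contour_integral 2 * of_real pi * \<i> * of_real y powr 0) (circlepath 3 T)"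
      by (rule Cauchy_integral_circlepath_simple) (use y T in \<open>auto intro!: holomorphic_intros\<close>)
    moreover have "((\<lambda>s. of_real y powr s / (s - (-1))) has_contour_integral 2 * of_real pi * \<i> * of_real y powr (-1)) (circlepath 3 T)"
      by (rule Cauchy_integral_circlepath_simple) (use y T in \<open>auto intro!: holomorphic_intros\<close>)
    ultimately have "((\<lambda>s. of_real y powr s / (s - 0) - of_real y powr s / (s - (-1))) has_contour_integral 
      2 * of_real pi * \<i> * of_real y powr 0 - 2 * of_real pi * \<i> * of_real y powr (-1)) (circlepath 3 T)"
      by (rule has_contour_integral_diff)
    moreover have "of_real y powr s / (s - 0) - of_real y powr s / (s - (-1)) = f s" if "s \<in> path_image (circlepath 3 T)" for s
      using nz'[of s] that T unfolding f_def by (auto simp: dist_norm norm_minus_commute field_simps)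
    ultimately have "(f has_contour_integral 2 * of_real pi * \<i> * of_real y powr 0 - 2 * of_real pi * \<i> * of_real y powr (-1)) (circlepath 3 T)"
      by (rule has_contour_integral_eq)
    hence I: "contour_integral (circlepath 3 T) f = 2 * pi * \<i> * max 0 (1 - 1 / y)"
      using y True by (simp add: contour_integral_unique powr_minus max_def field_simps)
    have "cmod (vint 3 T f - contour_integral (circlepath (of_real 3) T) f) \<le> (4 * y ^ 3 / T\<^sup>2) * T * pi"
    proof (rule vertical_segment_bound_left[OF _ _ holo cont])
      fix s assume s: "cmod (s - complex_of_real 3) = T" "Re s \<le> 3"
      have "y powr Re s \<le> y powr 3" using s True by (intro powr_mono) auto
      thus "cmod (f s) \<le> 4 * y ^ 3 / T\<^sup>2" using y s by (intro bd) auto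
    qed (use T y in auto)
    thus ?thesis using T I by (simp add: f_def power2_eq_square field_simps)
  next
    case False
    have "cmod (vint 3 T f) \<le> (4 * y ^ 3 / T\<^sup>2) * T * pi"
    proof (rule vertical_segment_bound_right[OF _ _ holo cont])
      fix s assume s: "cmod (s - complex_of_real 3) = T" "Re s \<ge> 3"
      have "y powr Re s \<le> y powr 3" using s False y by (intro powr_mono') auto
      thus "cmod (f s) \<le> 4 * y ^ 3 / T\<^sup>2" using y s by (intro bd) auto
    qed (use T y in auto)
    moreover have "max 0 (1 - 1 / y) = 0" using False y by (auto simp: max_def field_simps)
    ultimately show ?thesis using T by (simp add: f_def power2_eq_square field_simps)
  qed
qed

text \<open>By partial fractions the residues at \<open>1\<close>, \<open>-1\<close>,
  \<open>0\<close> are \<open>y / 2\<close>, \<open>1 / (2 y)\<close> and \<open>-1\<close>, with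
  sum \<open>(y - 1)^2 / (2 y)\<close>. This evaluates the polar part of the Dirichlet series
  separately.\<close>

lemma perron_kernel_pole:
  fixes y T :: real
  assumes y: "y \<ge> 1" and T: "T \<ge> 8"
  shows "cmod (vint 3 T (\<lambda>s. of_real y powr s / ((s - 1) * s * (s + 1)))
           - 2 * pi * \<i> * ((y - 1)\<^sup>2 / (2 * y))) \<le> 4 * pi * y ^ 3 / T"
proof -
  define f where "f = (\<lambda>s::complex. of_real y powr s / ((s - 1) * s * (s + 1)))"
  have nz: "s \<noteq> 0" "s + 1 \<noteq> 0" "s - 1 \<noteq> 0" if "Re s > 1" for s using that by (auto simp: complex_eq_iff)
  have nz': "s \<noteq> 0" "s + 1 \<noteq> 0" "s - 1 \<noteq> 0" if "cmod (s - 3) = T" for s using sphere_ge[OF that T] T by auto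
  have holo: "f holomorphic_on {s. Re s > 1}"
    unfolding f_def using nz y by (auto intro!: holomorphic_intros)
  have cont: "continuous_on (sphere (of_real 3) T) f"
    unfolding f_def using nz' y by (auto intro!: continuous_intros simp: dist_norm norm_minus_commute)
  have c: "((\<lambda>s. of_real y powr s / (s - w)) has_contour_integral 2 * of_real pi * \<i> * of_real y powr w) (circlepath 3 T)"
    if "cmod (w - 3) < 8" for w
      by (rule Cauchy_integral_circlepath_simple) (use y T that in \<open>auto intro!: holomorphic_intros\<close>)
  have "((\<lambda>s. (1/2) * (of_real y powr s / (s - 1)) + ((1/2) * (of_real y powr s / (s - (-1))) - of_real y powr s / (s - 0)))
     has_contour_integral (1/2) * (2 * of_real pi * \<i> * of_real y powr 1) +
       ((1/2) * (2 * of_real pi * \<i> * of_real y powr (-1)) - 2 * of_real pi * \<i> * of_real y powr 0)) (circlepath 3 T)"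
    by (intro has_contour_integral_add has_contour_integral_diff has_contour_integral_lmul c) auto
  moreover have "(1/2) * (of_real y powr s / (s - 1)) + ((1/2) * (of_real y powr s / (s - (-1))) - of_real y powr s / (s - 0)) = f s"
    if "s \<in> path_image (circlepath 3 T)" for s
  proof -
    have "s \<noteq> 0" "s + 1 \<noteq> 0" "s - 1 \<noteq> 0"
      using nz'[of s] that T by (auto simp: dist_norm norm_minus_commute)
    moreover have e: "2 + s * 2 = 2 * (s + 1)" by simp
    ultimately have "2 + s * 2 \<noteq> 0" by (metis e mult_eq_0_iff zero_neq_numeral)
    with \<open>s \<noteq> 0\<close> \<open>s + 1 \<noteq> 0\<close> \<open>s - 1 \<noteq> 0\<close> show ?thesis
      unfolding f_def by (simp add: divide_simps) (simp add: algebra_simps)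
  qed
  ultimately have "(f has_contour_integral (1/2) * (2 * of_real pi * \<i> * of_real y powr 1) +
       ((1/2) * (2 * of_real pi * \<i> * of_real y powr (-1)) - 2 * of_real pi * \<i> * of_real y powr 0)) (circlepath 3 T)"
    by (rule has_contour_integral_eq)
  hence I: "contour_integral (circlepath 3 T) f = 2 * pi * \<i> * ((y - 1)\<^sup>2 / (2 * y))"
    using y by (simp add: contour_integral_unique powr_minus field_simps power2_eq_square)
  have "cmod (vint 3 T f - contour_integral (circlepath (of_real 3) T) f) \<le> (4 * y ^ 3 / T\<^sup>2) * T * pi"
  proof (rule vertical_segment_bound_left[OF _ _ holo cont])
    fix s assume s: "cmod (s - complex_of_real 3) = T" "Re s \<le> 3"
    have "y powr Re s \<le> y powr 3" using s y by (intro powr_mono) auto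
    hence le: "y powr Re s \<le> y ^ 3" using y by simp
    \<comment> \<open>The factor \<open>s - 1\<close> is bounded below by 1 only, so that the error
      has the same shape as in \<open>perron_kernel\<close>.\<close>
    have "1 * (T / 2) * (T / 2) \<le> cmod (s - 1) * cmod s * cmod (s + 1)"
      using sphere_ge[of s T] s T by (intro mult_mono) auto
    hence "cmod (f s) \<le> y ^ 3 / (1 * (T / 2) * (T / 2))"
      unfolding f_def norm_divide norm_mult using le y T
      by (intro frac_le) (auto simp: cmod_powr_of_real)
    thus "cmod (f s) \<le> 4 * y ^ 3 / T\<^sup>2" by (simp add: power2_eq_square field_simps)
  qed (use T y in auto)
  thus ?thesis using T I by (simp add: f_def power2_eq_square field_simps)
qed

text \<open>A primitive exists on the half-plane, so both vertical integrals are differences of its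
  values, and only the two horizontal sides of length \<open>b - a\<close> remain.\<close>

lemma vertical_shift:
  fixes f :: "complex \<Rightarrow> complex"
  assumes holo: "f holomorphic_on {s. Re s > c}" and ab: "c < a" "a \<le> b"
    and M: "\<And>s. a \<le> Re s \<Longrightarrow> Re s \<le> b \<Longrightarrow> \<bar>Im s\<bar> = \<bar>T\<bar> \<Longrightarrow> cmod (f s) \<le> M"
  shows "cmod (vint b T f
     - vint a T f) \<le> 2 * (b - a) * M"
proof -
  have cv: "convex {s. Re s > c}" and op: "open {s. Re s > c}"
    by (rule convex_halfspace_Re_gt open_halfspace_Re_gt)+
  obtain g where g: "\<And>s. Re s > c \<Longrightarrow> (g has_field_derivative f s) (at s)"
    using holomorphic_convex_primitive'[OF cv op holo] op by (auto simp: at_within_open[of _ "{s. Re s > c}"])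
  have I: "(f has_contour_integral (g v - g u)) (linepath u v)" if "Re u > c" "Re v > c" for u v
  proof -
    have sub: "closed_segment u v \<subseteq> {s. Re s > c}"
      by (rule closed_segment_subset[OF _ _ cv]) (use that in auto)
    have "(f has_contour_integral (g (pathfinish (linepath u v)) - g (pathstart (linepath u v)))) (linepath u v)"
      by (rule contour_integral_primitive[where S = "{s. Re s > c}"])
         (use g sub in \<open>auto intro: has_field_derivative_at_within\<close>)
    thus ?thesis by simp
  qed
  have M0: "M \<ge> 0" using M[of "Complex a T"] ab norm_ge_zero by (smt (verit, best) complex.sel)
  have h: "cmod (g (Complex b t) - g (Complex a t)) \<le> M * (b - a)" if "\<bar>t\<bar> = \<bar>T\<bar>" for t
  proof -
    have "cmod (g (Complex b t) - g (Complex a t)) \<le> M * cmod (Complex b t - Complex a t)"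
    proof (rule has_contour_integral_bound_linepath[OF I M0])
      fix s assume "s \<in> closed_segment (Complex a t) (Complex b t)"
      hence "Im s = t" "Re s \<in> closed_segment a b"
        by (auto simp: closed_segment_same_Im)
      thus "cmod (f s) \<le> M" using ab that by (intro M) (auto simp: closed_segment_eq_real_ivl)
    qed (use ab in auto)
    also have "cmod (Complex b t - Complex a t) = b - a"
      using ab by (simp add: cmod_def)
    finally show ?thesis .
  qed
  have "vint b T f
     - vint a T f
     = (g (Complex b T) - g (Complex a T)) - (g (Complex b (-T)) - g (Complex a (-T)))"
    using ab by (simp add: contour_integral_unique[OF I])
  also have "cmod \<dots> \<le> M * (b - a) + M * (b - a)"
    using h[of T] h[of "-T"] by (intro order_trans[OF norm_triangle_ineq4 add_mono]) auto
  finally show ?thesis by (simp add: algebra_simps)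
qed

section \<open>Perron's formula for the integrated sums of \<open>a n * (x - n)\<close>\<close>

abbreviation perron_k :: "real \<Rightarrow> complex \<Rightarrow> complex" where
  "perron_k x s \<equiv> of_real x powr (s + 1) / (s * (s + 1))"

text \<open>On \<open>Re s = 3\<close> the bound \<open>cmod (a n) <= n\<close> makes the series
  converge like that of \<open>1 / n^2\<close>, which allows termwise integration;
  \<open>perron_kernel\<close> then applies with \<open>y = x / n\<close>. The constant
  \<open>C\<close> may depend on \<open>x\<close>, since it only serves the limit of large
  \<open>T\<close>.\<close>

lemma perron_sum:
  fixes a :: "nat \<Rightarrow> complex" and F :: "complex \<Rightarrow> complex"
  assumes a: "\<And>n. n \<ge> 1 \<Longrightarrow> cmod (a n) \<le> real n"
    and ser: "\<And>s. Re s = 3 \<Longrightarrow> (\<lambda>n. a (Suc n) / of_nat (Suc n) powr s) sums F s"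
    and x: "x \<ge> 1"
  obtains C where "\<And>T. T \<ge> 8 \<Longrightarrow> cmod (vint 3 T
       (\<lambda>s. F s * perron_k x s)
        - 2 * pi * \<i> * (\<Sum>n | 1 \<le> n \<and> real n \<le> x. a n * (x - real n))) \<le> C / T"
proof -
  define K where "K = (\<Sum>n. inverse (real (Suc n) ^ 2))"
  have sK: "summable (\<lambda>n. inverse (real (Suc n) ^ 2))"
    by (subst summable_Suc_iff) (rule inverse_power_summable, simp)
  define W where "W = (\<Sum>n | 1 \<le> n \<and> real n \<le> x. a n * (x - real n))"
  have "cmod (vint 3 T
       (\<lambda>s. F s * perron_k x s) - 2 * pi * \<i> * W) \<le> (4 * pi * x ^ 4 * K) / T" if T: "T \<ge> 8" for T
  proof -
    define seg where "seg = closed_segment (Complex 3 (-T)) (Complex 3 T)"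
    have seg: "Re s = 3" if "s \<in> seg" for s using that by (auto simp: seg_def closed_segment_same_Re)
    define f where "f = (\<lambda>n (s::complex). a (Suc n) / of_nat (Suc n) powr s * perron_k x s)"
    define k where "k = (\<lambda>n (s::complex). of_real (x / real (Suc n)) powr s / (s * (s + 1)))"
    have fk: "f n s = a (Suc n) * x * k n s" for n s
    proof -
      have "complex_of_real x powr s = (of_real (x / real (Suc n)) * of_nat (Suc n)) powr s"
        by (simp del: of_nat_Suc)
      also have "\<dots> = of_real (x / real (Suc n)) powr s * of_nat (Suc n) powr s"
        using x by (intro powr_times_real) auto
      finally show ?thesis using x unfolding f_def k_def by (simp add: powr_add del: of_nat_Suc)
    qed
    have knorm: "cmod (k n s) \<le> x ^ 3 / real (Suc n) ^ 3" if "s \<in> seg" for n s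
    proof -
      have R: "Re s = 3" using seg that by auto
      have "1 * 1 \<le> cmod s * cmod (s + 1)" 
        using complex_Re_le_cmod[of s] complex_Re_le_cmod[of "s+1"] R by (intro mult_mono) auto
      hence "cmod (k n s) \<le> (x / real (Suc n)) ^ 3 / (1 * 1)"
        unfolding k_def norm_divide[of "_ powr _"] norm_mult using x R
        by (intro frac_le) (auto simp: cmod_powr_of_real simp del: of_nat_Suc of_real_divide)
      thus ?thesis by (simp add: power_divide)
    qed
    have fnorm: "cmod (f n s) \<le> x ^ 4 * inverse (real (Suc n) ^ 2)" if "s \<in> seg" for n s
    proof -
      have "cmod (f n s) \<le> real (Suc n) * x * (x ^ 3 / real (Suc n) ^ 3)"
        unfolding fk norm_mult using a[of "Suc n"] x knorm[OF that, of n] by (intro mult_mono) auto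
      also have "\<dots> = x ^ 4 * inverse (real (Suc n) ^ 2)" by (simp add: field_simps power_numeral_reduce del: of_nat_Suc)
      finally show ?thesis .
    qed
    have ul: "uniform_limit seg (\<lambda>N w. \<Sum>n<N. f n w) (\<lambda>w. \<Sum>n. f n w) sequentially"
      by (rule Weierstrass_m_test[OF fnorm]) (use sK in \<open>auto intro: summable_mult\<close>)
    have feq: "F s * perron_k x s = (\<Sum>n. f n s)" if "s \<in> seg" for s
      unfolding f_def by (rule sums_unique, rule sums_mult2, rule ser) (use seg that in auto)
    have cf: "continuous_on seg (f n)" for n
    proof -
      have "s \<noteq> 0" "s + 1 \<noteq> 0" if "s \<in> seg" for s using seg[OF that] by (auto simp: complex_eq_iff)
      thus ?thesis unfolding f_def using x by (intro continuous_intros) (auto simp del: of_nat_Suc)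
    qed
    obtain J where J: "((\<lambda>w. \<Sum>n. f n w) has_contour_integral J) (linepath (Complex 3 (-T)) (Complex 3 T))"
       "(\<lambda>n. vint 3 T (f n)) sums J"
      using contour_integral_sums_linepath[OF ul[unfolded seg_def] cf[unfolded seg_def]] by blast
    have J1: "vint 3 T
       (\<lambda>s. F s * perron_k x s) = J"
      using J(1) feq unfolding seg_def by (metis (no_types, lifting) contour_integral_cong contour_integral_unique path_image_linepath)
    \<comment> \<open>The truncation at 0 extends the finite sum to a series over all
      \<open>n\<close>, to be compared term by term with the integrals.\<close>
    define w where "w = (\<lambda>n. a (Suc n) * (max 0 (x - real (Suc n))))"
    have ws: "w sums W"
    proof -
      have "w sums (\<Sum>n<nat \<lceil>x\<rceil>. w n)"
        by (rule sums_finite) (auto simp: w_def max_def, linarith)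
      also have "(\<Sum>n<nat \<lceil>x\<rceil>. w n) = (\<Sum>n\<in>{1..nat \<lceil>x\<rceil>}. a n * max 0 (x - real n))"
        unfolding w_def by (rule sum.reindex_bij_witness[of _ "\<lambda>n. n - 1" Suc]) auto
      also have "\<dots> = W" unfolding W_def
        by (intro sum.mono_neutral_cong_right) (auto simp: max_def, linarith)
      finally show ?thesis .
    qed
    have t: "cmod (vint 3 T (f n) - 2 * pi * \<i> * w n) \<le> 4 * pi * x ^ 4 / T * inverse (real (Suc n) ^ 2)" for n
    proof -
      define y where "y = x / real (Suc n)"
      have y: "y > 0" using x by (simp add: y_def)
      have "k n contour_integrable_on (linepath (Complex 3 (-T)) (Complex 3 T))"
      proof -
        have "s \<noteq> 0" "s + 1 \<noteq> 0" if "s \<in> seg" for s using seg[OF that] by (auto simp: complex_eq_iff)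
        thus ?thesis unfolding k_def seg_def using x
          by (intro contour_integrable_continuous_linepath continuous_intros) (auto simp del: of_nat_Suc)
      qed
      hence "vint 3 T (f n)
         = a (Suc n) * x * vint 3 T (k n)"
        unfolding fk by (rule contour_integral_lmul)
      moreover have "w n = a (Suc n) * x * max 0 (1 - 1 / y)"
        using x by (auto simp: w_def y_def max_def field_simps)
      ultimately have "vint 3 T (f n) - 2 * pi * \<i> * w n = 
          a (Suc n) * x * (vint 3 T (k n) - 2 * pi * \<i> * max 0 (1 - 1 / y))"
        by (simp add: algebra_simps)
      also have "cmod \<dots> \<le> real (Suc n) * x * (4 * pi * y ^ 3 / T)"
        unfolding norm_mult k_def y_def[symmetric] using perron_kernel[OF y T] a[of "Suc n"] x
        by (intro mult_mono) auto
      also have "\<dots> = 4 * pi * x ^ 4 / T * inverse (real (Suc n) ^ 2)"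
        using T by (simp add: y_def field_simps power_numeral_reduce del: of_nat_Suc)
      finally show ?thesis .
    qed
    have "(\<lambda>n. vint 3 T (f n) - 2 * pi * \<i> * w n) sums (J - 2 * pi * \<i> * W)"
      by (intro sums_diff J(2) sums_mult ws)
    moreover have "(\<lambda>n. 4 * pi * x ^ 4 / T * inverse (real (Suc n) ^ 2)) sums (4 * pi * x ^ 4 / T * K)"
      unfolding K_def by (intro sums_mult summable_sums sK)
    ultimately have "cmod (J - 2 * pi * \<i> * W) \<le> 4 * pi * x ^ 4 / T * K"
      using t by (metis (no_types, lifting) sums_iff norm_suminf_le)
    thus ?thesis unfolding J1 by simp
  qed
  thus ?thesis using that unfolding W_def by blast
qed

text \<open>The exponent is \<open>1/16 - 9/8\<close>: the growth allowed for \<open>D\<close> times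
  the decay of the kernel difference. Each half-line contributes at most 16.\<close>

lemma decay_has_integral:
  fixes T :: real
  assumes "T \<ge> 0"
  obtains I where "((\<lambda>t. (1 + \<bar>t\<bar>) powr (- 17 / 16)) has_integral I) {-T..T}" "I \<le> 32"
proof -
  define J where "J = 16 - 16 * (1 + T) powr (- 1 / 16)"
  have "((\<lambda>t. (1 + t) powr (- 17 / 16)) has_integral (- 16 * (1 + T) powr (-1/16)) - (- 16 * (1 + 0) powr (-1/16))) {0..T}"
    by (rule fundamental_theorem_of_calculus)
       (use assms in \<open>auto intro!: derivative_eq_intros simp flip: has_real_derivative_iff_has_vector_derivative\<close>)
  hence "((\<lambda>t. (1 + t) powr (- 17 / 16)) has_integral J) {0..T}" by (simp add: J_def)
  hence 1: "((\<lambda>t. (1 + \<bar>t\<bar>) powr (- 17 / 16)) has_integral J) {0..T}"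
    by (rule has_integral_eq[rotated]) auto
  have "((\<lambda>t. (1 + \<bar>- t\<bar>) powr (- 17 / 16)) has_integral J) {-T..0}"
    using 1 has_integral_reflect_real[of "\<lambda>t. (1 + \<bar>t\<bar>) powr (- 17 / 16)" J T 0] by simp
  hence "((\<lambda>t. (1 + \<bar>t\<bar>) powr (- 17 / 16)) has_integral J + J) {-T..T}"
    using 1 assms by (intro has_integral_combine[of "-T" 0 T]) auto
  moreover have "J + J \<le> 32" by (simp add: J_def)
  ultimately show ?thesis using that by blast
qed

text \<open>
  The exponent \<open>-9/8\<close> interpolates between the mean value bound of order \<open>1/\<bar>s\<bar>\<close> and the trivial bound
  of order \<open>1/\<bar>s\<bar>\<^sup>2\<close>; it makes the integral over the vertical line converge with room for \<open>D\<close> to grow.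
\<close>
lemma perron_kernel_diff_bound:
  fixes x h :: real and s :: complex
  assumes x: "x \<ge> 1" and h: "0 < h" "h \<le> x" and s: "0 < Re s"
  shows "cmod (perron_k (x + h) s - perron_k x s)
    \<le> h * (2 * x) powr Re s * (4 * x / h) powr (1 / 8) * cmod s powr (- 9 / 8)"
proof -
  have s0: "cmod s > 0" using s complex_Re_le_cmod[of s] by linarith
  have s1: "cmod (s + 1) \<ge> cmod s"
    using s by (simp add: cmod_def power2_eq_square algebra_simps)
  have s1': "cmod (s + 1) > 0" "s \<noteq> 0" "s + 1 \<noteq> 0" using s0 s1 by auto
  define d where "d = of_real (x + h) powr (s + 1) - of_real x powr (s + 1)"
  \<comment> \<open>Quotient of the two resulting bounds for the kernel, the one from
    \<open>d2\<close> by the one from \<open>d1\<close>, where \<open>cmod (s + 1)\<close> is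
    replaced by \<open>cmod s\<close> in the former.\<close>
  define u where "u = 4 * x / (h * cmod s)"
  have u: "u > 0" using x h s0 by (simp add: u_def)
  have d1: "cmod d \<le> cmod (s + 1) * h * (2 * x) powr Re s"
  proof -
    have "cmod (of_real (x + h) powr (s + 1) - of_real x powr (s + 1)) \<le> (cmod (s + 1) * (2 * x) powr Re s) * cmod (complex_of_real (x + h) - of_real x)"
    proof (rule field_differentiable_bound[where S = "closed_segment (complex_of_real x) (of_real (x+h))"])
      fix z assume "z \<in> closed_segment (complex_of_real x) (of_real (x+h))"
      then obtain t where t: "z = of_real t" "x \<le> t" "t \<le> x + h"
        using h by (auto simp: closed_segment_of_real closed_segment_eq_real_ivl simp del: of_real_add)
      have tn: "z \<notin> \<real>\<^sub>\<le>\<^sub>0" using t x by (auto simp: complex_nonpos_Reals_iff)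
      show "((\<lambda>z. z powr (s + 1)) has_field_derivative (s + 1) * z powr s) 
        (at z within closed_segment (complex_of_real x) (of_real (x+h)))"
        using has_field_derivative_powr[OF tn, of "s + 1"] by (auto intro: has_field_derivative_at_within)
      show "cmod ((s + 1) * z powr s) \<le> cmod (s + 1) * (2 * x) powr Re s"
        unfolding norm_mult using t x h s by (intro mult_left_mono) (auto simp: cmod_powr_of_real intro!: powr_mono2)
    qed (auto)
    thus ?thesis using h by (simp add: d_def algebra_simps)
  qed
  have d2: "cmod d \<le> 2 * ((2 * x) powr Re s * (2 * x))"
  proof -
    have "cmod d \<le> cmod (of_real (x + h) powr (s + 1)) + cmod (of_real x powr (s + 1))"
      unfolding d_def by (rule norm_triangle_ineq4)
    also have "\<dots> = (x + h) powr (Re s + 1) + x powr (Re s + 1)"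
      using x h by (subst (1 2) cmod_powr_of_real) auto
    also have "\<dots> \<le> (2 * x) powr (Re s + 1) + (2 * x) powr (Re s + 1)"
      using x h s by (intro add_mono powr_mono2) auto
    finally show ?thesis using x by (simp add: powr_add mult.commute)
  qed
  have "cmod (d / (s * (s + 1))) \<le> h * (2 * x) powr Re s / cmod s * min 1 u"
  proof (cases "u \<le> 1")
    case False
    have "cmod d / (cmod s * cmod (s + 1)) \<le> (cmod (s + 1) * h * (2 * x) powr Re s) / (cmod s * cmod (s + 1))"
      by (intro divide_right_mono d1) auto
    thus ?thesis using False s1' by (simp add: norm_divide norm_mult)
  next
    case True
    have "cmod d / (cmod s * cmod (s + 1)) \<le> (2 * ((2 * x) powr Re s * (2 * x))) / (cmod s * cmod s)"
      by (intro frac_le d2 mult_left_mono s1) (use s0 x in auto)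
    also have "\<dots> = h * (2 * x) powr Re s / cmod s * u" using h s0 by (simp add: u_def field_simps)
    finally show ?thesis using True by (simp add: norm_divide norm_mult)
  qed
  also have "\<dots> \<le> h * (2 * x) powr Re s / cmod s * u powr (1/8)"
  proof (rule mult_left_mono)
    show "min 1 u \<le> u powr (1/8)"
    proof (cases "u \<le> 1")
      case True
      have "u powr 1 \<le> u powr (1/8)" using True u by (intro powr_mono') auto
      thus ?thesis using u by simp
    qed (use u in \<open>simp add: ge_one_powr_ge_zero\<close>)
  qed (use h in auto)
  also have "\<dots> = h * (2 * x) powr Re s * (4 * x / h) powr (1 / 8) * cmod s powr (- 9 / 8)"
  proof -
    have "u powr (1/8) = (4 * x / h) powr (1/8) / cmod s powr (1/8)"
      using x h s0 by (simp add: u_def flip: powr_divide)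
    moreover have "cmod s powr (- 9 / 8) = 1 / (cmod s * cmod s powr (1/8))"
      using s0 powr_add[of "cmod s" 1 "1/8"] by (simp add: powr_minus field_simps)
    ultimately show ?thesis by simp
  qed
  finally show ?thesis by (simp add: d_def diff_divide_distrib)
qed

lemma norm_triangle_le3:
  fixes u v w :: "'a::real_normed_vector"
  assumes "norm u \<le> A" "norm v \<le> B" "norm w \<le> C"
  shows "norm (u + v - w) \<le> A + B + C" "norm (u - v - w) \<le> A + B + C" "norm (u - v + w) \<le> A + B + C"
  using assms norm_triangle_ineq4[of "u + v" w] norm_triangle_ineq4[of "u - v" w] norm_triangle_ineq[of "u - v" w]
    norm_triangle_ineq[of u v] norm_triangle_ineq4[of u v] by linarith+

section \<open>From integrated sums back to partial sums\<close>

abbreviation psum :: "(nat \<Rightarrow> 'a::comm_monoid_add) \<Rightarrow> real \<Rightarrow> 'a" where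
  "psum c x \<equiv> (\<Sum>n | 1 \<le> n \<and> real n \<le> x. c n)"

text \<open>In the applications \<open>a\<close> is the von Mangoldt function times a character,
  \<open>D\<close> is \<open>- H' / H\<close>, and \<open>m\<close> is 1 for zeta and 0 otherwise.
  The pole is split off so that \<open>D\<close> can be moved past \<open>s = 1\<close> without a
  residue. The final estimate is linear in \<open>B\<close>, which carries the dependence on the
  modulus.\<close>

locale tauberian =
  fixes a :: "nat \<Rightarrow> complex" and D :: "complex \<Rightarrow> complex" and m B :: real
  assumes a: "\<And>n. n \<ge> 1 \<Longrightarrow> cmod (a n) \<le> ln (real n)"
    and D: "D holomorphic_on {s. Re s > 1/2}"
    and ser: "\<And>s::complex. Re s > 1 \<Longrightarrow> (\<lambda>n. a (Suc n) / of_nat (Suc n) powr s) sums (D s + m / (s - 1))"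
    and bound: "\<And>s::complex. 9/16 \<le> Re s \<Longrightarrow> Re s \<le> 3 \<Longrightarrow> cmod (D s) \<le> B * (1 + \<bar>Im s\<bar>) powr (1/16)"
    and m: "0 \<le> m" "m \<le> 1" and B: "B \<ge> 1"
begin

text \<open>\<open>m (x - 1)\<^sup>2 / 2\<close> collects the residues of \<open>m x\<^bsup>s+1\<^esup> / ((s - 1) s (s + 1))\<close> at \<open>1\<close>, \<open>0\<close> and \<open>-1\<close>.\<close>
definition V :: "real \<Rightarrow> complex" where
  "V x = (\<Sum>n | 1 \<le> n \<and> real n \<le> x. a n * (x - real n)) - m * (x - 1)\<^sup>2 / 2"

definition f :: "real \<Rightarrow> complex \<Rightarrow> complex" where
  "f x s = D s * perron_k x s"

abbreviation seg :: "real \<Rightarrow> real \<Rightarrow> real \<Rightarrow> complex" where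
  "seg c T \<equiv> linepath (Complex c (-T)) (Complex c T)"

lemma f_holo: "x > 0 \<Longrightarrow> f x holomorphic_on {s. Re s > 1/2}"
proof -
  assume x: "x > 0"
  have "s \<noteq> 0" "s + 1 \<noteq> 0" if "Re s > 1/2" for s using that by (auto simp: complex_eq_iff)
  thus ?thesis unfolding f_def using x by (intro holomorphic_intros D) auto
qed

lemma f_integrable: "x > 0 \<Longrightarrow> c > 1/2 \<Longrightarrow> f x contour_integrable_on seg c T"
  by (rule contour_integrable_continuous_linepath, rule holomorphic_on_imp_continuous_on,
      rule holomorphic_on_subset[OF f_holo]) (auto simp: closed_segment_same_Re)

text \<open>The polar term stays on the line \<open>Re s = 3\<close>, where
  \<open>perron_kernel_pole\<close> evaluates it; only \<open>D\<close> is shifted to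
  \<open>Re s = 9/16\<close>. The horizontal sides of the shift are part of the error
  \<open>C / T\<close>.\<close>

lemma V_limit:
  assumes x: "x \<ge> 1"
  obtains C where "\<And>T. T \<ge> 8 \<Longrightarrow> cmod (vint (9/16) T (f x) - 2 * pi * \<i> * V x) \<le> C / T"
proof -
  define W where "W = (\<Sum>n | 1 \<le> n \<and> real n \<le> x. a n * (x - real n))"
  define F where "F = (\<lambda>s::complex. D s + m / (s - 1))"
  have an: "cmod (a n) \<le> real n" if "n \<ge> 1" for n
  proof -
    have "ln (real n) < real n" using that by (intro ln_less_self) auto
    thus ?thesis using a[OF that] by simp
  qed
  obtain C where C: "\<And>T. T \<ge> 8 \<Longrightarrow> cmod (vint 3 T
       (\<lambda>s. F s * perron_k x s) - 2 * pi * \<i> * W) \<le> C / T"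
    using perron_sum[OF an _ x, of F] ser unfolding F_def W_def by (metis (no_types, lifting) numeral_One one_less_numeral_iff semiring_norm(77))
  have "cmod (vint (9/16) T (f x) - 2 * pi * \<i> * V x) \<le> (C + 4 * pi * x ^ 4 + 10 * B * x ^ 4) / T"
    if T: "T \<ge> 8" for T
  proof -
    define k where "k = (\<lambda>s::complex. of_real x powr s / ((s - 1) * s * (s + 1)))"
    have s3: "s \<noteq> 0" "s + 1 \<noteq> 0" "s - 1 \<noteq> 0" if "s \<in> closed_segment (Complex 3 (-T)) (Complex 3 T)" for s
    proof -
      have "Re s = 3" using that by (auto simp: closed_segment_same_Re)
      thus "s \<noteq> 0" "s + 1 \<noteq> 0" "s - 1 \<noteq> 0" by (auto simp: complex_eq_iff)
    qed
    have kint: "k contour_integrable_on seg 3 T"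
      unfolding k_def using s3 x by (intro contour_integrable_continuous_linepath continuous_intros) auto
    have "vint 3 T (\<lambda>s. F s * perron_k x s)
      = vint 3 T (\<lambda>s. f x s + m * x * k s)"
    proof (rule contour_integral_cong)
      fix s assume "s \<in> path_image (seg 3 T)"
      thus "F s * perron_k x s = f x s + m * x * k s"
        using s3[of s] x unfolding F_def f_def k_def distrib_right
        by (simp only: powr_add powr_one_gt_zero_iff) (simp add: ac_simps)
    qed auto
    also have "\<dots> = vint 3 T (f x) + m * x * vint 3 T k"
      using x kint f_integrable[of x 3 T]
      by (subst contour_integral_add) (auto simp: contour_integrable_lmul contour_integral_lmul)
    finally have e1: "vint 3 T (\<lambda>s. F s * perron_k x s)
        = vint 3 T (f x) + m * x * vint 3 T k" .
    have k1: "cmod (m * x * (vint 3 T k - 2 * pi * \<i> * ((x - 1)\<^sup>2 / (2 * x)))) \<le> 1 * x * (4 * pi * x ^ 3 / T)"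
    proof -
      have "cmod (complex_of_real (m * x)) \<le> 1 * x"
        unfolding norm_of_real using m x by (simp add: abs_mult mult_left_le_one_le)
      thus ?thesis unfolding norm_mult[of "of_real (m * x)"] k_def using perron_kernel_pole[OF x T] x
        by (intro mult_mono) auto
    qed
    have sh: "cmod (vint 3 T (f x) - vint (9/16) T (f x)) \<le> 2 * (3 - 9/16) * (2 * B * x ^ 4 / T)"
    proof (rule vertical_shift[where c = "1/2"])
      fix s assume s: "9/16 \<le> Re s" "Re s \<le> 3" "\<bar>Im s\<bar> = \<bar>T\<bar>"
      have "T * T \<le> cmod s * cmod (s + 1)"
        using abs_Im_le_cmod[of s] abs_Im_le_cmod[of "s+1"] s T by (intro mult_mono) auto
      moreover have "x powr Re (s + 1) \<le> x powr 4" using s x by (intro powr_mono) auto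
      ultimately have "cmod (perron_k x s) \<le> x ^ 4 / (T * T)"
        unfolding norm_divide norm_mult using x T by (intro frac_le) (auto simp: cmod_powr_of_real)
      moreover have "cmod (D s) \<le> B * (2 * T)"
      proof -
        \<comment> \<open>Even linear growth of \<open>D\<close> is affordable here, because
          \<open>perron_k\<close> decays like \<open>T^-2\<close>.\<close>
        have "(1 + \<bar>Im s\<bar>) powr (1/16) \<le> (1 + \<bar>Im s\<bar>) powr 1" by (intro powr_mono) auto
        also have "\<dots> \<le> 2 * T" using s T by auto
        finally show ?thesis using bound[OF s(1,2)] B by (meson mult_left_mono order_trans zero_le_one)
      qed
      ultimately have "cmod (f x s) \<le> (B * (2 * T)) * (x ^ 4 / (T * T))"
        unfolding f_def norm_mult[of "D s"] using B T by (intro mult_mono) auto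
      thus "cmod (f x s) \<le> 2 * B * x ^ 4 / T" using T by (simp add: field_simps)
    qed (use f_holo x in auto)
    have Veq: "2 * pi * \<i> * V x = 2 * pi * \<i> * W - m * x * (2 * pi * \<i> * ((x - 1)\<^sup>2 / (2 * x)))"
      using x unfolding V_def W_def by (simp add: field_simps)
    have eq: "vint (9/16) T (f x) - 2 * pi * \<i> * V x = 
        (vint 3 T (f x) + m * x * vint 3 T k - 2 * pi * \<i> * W)
        - m * x * (vint 3 T k - 2 * pi * \<i> * ((x - 1)\<^sup>2 / (2 * x)))
        - (vint 3 T (f x) - vint (9/16) T (f x))"
      unfolding Veq by (simp add: ring_distribs)
    have "cmod (vint (9/16) T (f x) - 2 * pi * \<i> * V x) \<le> C / T + 1 * x * (4 * pi * x ^ 3 / T) + 2 * (3 - 9/16) * (2 * B * x ^ 4 / T)"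
      unfolding eq by (intro norm_triangle_le3 k1 sh C[OF T, unfolded e1])
    also have "\<dots> \<le> (C + 4 * pi * x ^ 4 + 10 * B * x ^ 4) / T"
    proof -
      have "0 \<le> B * x ^ 4" using B by simp
      moreover have "x * x ^ 3 = x ^ 4" by (simp add: power_numeral_reduce)
      moreover have "C / T + 1 * x * (4 * pi * x ^ 3 / T) + 2 * (3 - 9/16) * (2 * B * x ^ 4 / T)
          = (C + 4 * pi * (x * x ^ 3) + 39 / 4 * (B * x ^ 4)) / T"
        by (simp add: add_divide_distrib)
      ultimately show ?thesis using T by (simp add: divide_right_mono)
    qed
    finally show ?thesis .
  qed
  thus ?thesis using that by blast
qed

text \<open>For a single \<open>x\<close> absolute values give only \<open>x^(25/16)\<close>. In the
  difference with step \<open>h = sqrt x\<close> the factors \<open>x^(9/16)\<close> and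
  \<open>(x / h)^(1/8) = x^(1/16)\<close> combine to \<open>x^(5/8)\<close>, next to a factor
  \<open>h\<close> that is divided out later. The constant is \<open>16 * 32\<close>, with 32 from
  \<open>decay_has_integral\<close>.\<close>

lemma f_diff_bound:
  assumes x: "x \<ge> 1" and T: "T \<ge> 8"
  shows "cmod (vint (9/16) T (f (x + sqrt x)) - vint (9/16) T (f x)) 
     \<le> 512 * sqrt x * B * x powr (5/8)"
proof -
  define h where "h = sqrt x"
  have h: "0 < h" "h \<le> x" using x real_sqrt_le_mono[of x "x\<^sup>2"] by (auto simp: h_def power2_eq_square)
  define c where "c = 16 * h * B * x powr (5/8)"
  have pt: "cmod (f (x + h) s - f x s) \<le> c * (1 + \<bar>Im s\<bar>) powr (- 17/16)" if s: "Re s = 9/16" for s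
  proof -
    have "1 + \<bar>Im s\<bar> \<le> 4 * cmod s"
      using abs_Im_le_cmod[of s] complex_Re_le_cmod[of s] s by linarith
    hence "cmod s powr (- 9/8) \<le> ((1 + \<bar>Im s\<bar>) / 4) powr (- 9/8)"
      by (intro powr_mono2') auto
    also have "\<dots> = (1 + \<bar>Im s\<bar>) powr (- 9/8) * 4 powr (9/8)"
      by (simp add: powr_divide powr_minus field_simps)
    also have "\<dots> \<le> (1 + \<bar>Im s\<bar>) powr (- 9/8) * 8"
    proof (rule mult_left_mono)
      have "(4::real) powr (9/8) \<le> 4 powr (3/2)" by (intro powr_mono) auto
      also have "\<dots> = 8" using powr_powr[of "2::real" 2 "3/2"] by (simp add: powr_numeral)
      finally show "(4::real) powr (9/8) \<le> 8" .
    qed auto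
    finally have s1: "cmod s powr (- 9/8) \<le> (1 + \<bar>Im s\<bar>) powr (- 9/8) * 8" .
    have "(2 * x) powr (9/16) * (4 * x / h) powr (1/8) = 2 powr (13/16) * x powr (5/8)"
    proof -
      have "4 * x / h = 2 powr 2 * x powr (1/2)" using x real_div_sqrt[of x] by (simp add: h_def powr_half_sqrt powr_numeral flip: times_divide_eq_right)
      hence "(4 * x / h) powr (1/8) = (2 powr 2) powr (1/8) * (x powr (1/2)) powr (1/8)"
        by (simp only: powr_mult)
      hence "(4 * x / h) powr (1/8) = 2 powr (1/4) * x powr (1/16)" by (simp only: powr_powr) simp
      moreover have "(2 * x) powr (9/16) = 2 powr (9/16) * x powr (9/16)" using x by (simp add: powr_mult)
      moreover have "(2::real) powr (9/16) * 2 powr (1/4) = 2 powr (13/16)" "x powr (9/16) * x powr (1/16) = x powr (5/8)"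
        by (simp_all flip: powr_add)
      moreover have "(2 powr (9/16) * x powr (9/16)) * (2 powr (1/4) * x powr (1/16)) =
          (2 powr (9/16) * 2 powr (1/4)) * (x powr (9/16) * x powr (1/16))"
        by (simp only: mult_ac)
      ultimately show ?thesis by (simp only:)
    qed
    also have "\<dots> \<le> 2 * x powr (5/8)"
      using powr_mono[of "13/16" 1 "2::real"] by (intro mult_right_mono) auto
    finally have x1: "(2 * x) powr (9/16) * (4 * x / h) powr (1/8) \<le> 2 * x powr (5/8)" .
    have "cmod (perron_k (x + h) s - perron_k x s)
      \<le> h * ((2 * x) powr (9/16) * (4 * x / h) powr (1 / 8)) * cmod s powr (- 9 / 8)"
      using perron_kernel_diff_bound[OF x h, of s] s by (simp add: mult_ac)
    also have "\<dots> \<le> h * (2 * x powr (5/8)) * ((1 + \<bar>Im s\<bar>) powr (- 9/8) * 8)"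
      using h by (intro mult_mono s1 x1) auto
    finally have k: "cmod (perron_k (x + h) s - perron_k x s)
      \<le> h * (2 * x powr (5/8)) * ((1 + \<bar>Im s\<bar>) powr (- 9/8) * 8)" .
    have "f (x + h) s - f x s = D s * (perron_k (x + h) s - perron_k x s)"
      by (simp add: f_def ring_distribs)
    also have "cmod \<dots> \<le> (B * (1 + \<bar>Im s\<bar>) powr (1/16)) * (h * (2 * x powr (5/8)) * ((1 + \<bar>Im s\<bar>) powr (- 9/8) * 8))"
      unfolding norm_mult[of "D s"] using s B by (intro mult_mono k bound) auto
    also have "\<dots> = c * ((1 + \<bar>Im s\<bar>) powr (1/16) * (1 + \<bar>Im s\<bar>) powr (- 9/8))" by (simp add: c_def)
    also have "(1 + \<bar>Im s\<bar>) powr (1/16) * (1 + \<bar>Im s\<bar>) powr (- 9/8) = (1 + \<bar>Im s\<bar>) powr (- 17/16)"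
      by (simp flip: powr_add)
    finally show ?thesis .
  qed
  obtain I where I: "((\<lambda>t. (1 + \<bar>t\<bar>) powr (- 17 / 16)) has_integral I) {-T..T}" "I \<le> 32"
    using decay_has_integral[of T] T by auto
  have c0: "c \<ge> 0" using h B by (simp add: c_def)
  have int: "f (x + h) contour_integrable_on seg (9/16) T" "f x contour_integrable_on seg (9/16) T"
    using x h by (auto intro!: f_integrable)
  have di: "((\<lambda>s. f (x + h) s - f x s) has_contour_integral (vint (9/16) T (f (x + h)) - vint (9/16) T (f x))) (seg (9/16) T)"
    using int by (intro has_contour_integral_diff has_contour_integral_integral)
  define J where "J = vint (9/16) T (f (x + h)) - vint (9/16) T (f x)"
  have hJ: "((\<lambda>t. f (x + h) (Complex (9/16) t) - f x (Complex (9/16) t)) has_integral (- \<i> * J)) {-T..T}"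
    using di T has_contour_integral_linepath_same_Re_iff[of "Complex (9/16) (-T)" "9/16" "Complex (9/16) T" "-T" T "\<lambda>s. f (x + h) s - f x s" J]
    unfolding J_def by auto
  have "norm (- \<i> * J) \<le> (c * I) \<bullet> 1"
  proof (rule has_integral_norm_bound_integral_component[OF hJ])
    show "((\<lambda>t. c * (1 + \<bar>t\<bar>) powr (- 17 / 16)) has_integral c * I) {-T..T}"
      by (intro has_integral_mult_right I)
    show "cmod (f (x + h) (Complex (9/16) t) - f x (Complex (9/16) t)) \<le> (c * (1 + \<bar>t\<bar>) powr (- 17 / 16)) \<bullet> 1" for t
      using pt[of "Complex (9/16) t"] by simp
  qed
  also have "(c * I) \<bullet> 1 \<le> c * 32" using I(2) c0 by (simp add: mult_left_mono)
  finally show ?thesis by (simp add: J_def c_def h_def norm_mult)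
qed

text \<open>The truncation errors vanish as \<open>T\<close> tends to infinity, and
  \<open>512 / (2 * pi) < 100\<close>.\<close>

lemma V_diff_bound:
  assumes x: "x \<ge> 1"
  shows "cmod (V (x + sqrt x) - V x) \<le> 100 * sqrt x * B * x powr (5/8)"
proof -
  obtain C1 where C1: "\<And>T. T \<ge> 8 \<Longrightarrow> cmod (vint (9/16) T (f x) - 2 * pi * \<i> * V x) \<le> C1 / T"
    using V_limit[OF x] by blast
  have "x + sqrt x \<ge> 1" using x by (simp add: add_increasing2)
  then obtain C2 where C2: "\<And>T. T \<ge> 8 \<Longrightarrow> cmod (vint (9/16) T (f (x + sqrt x)) - 2 * pi * \<i> * V (x + sqrt x)) \<le> C2 / T"
    using V_limit by blast
  define M where "M = 512 * sqrt x * B * x powr (5/8)"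
  have le: "2 * pi * cmod (V (x + sqrt x) - V x) \<le> M + (C1 + C2) / T" if T: "T \<ge> 8" for T
  proof -
    have "2 * pi * cmod (V (x + sqrt x) - V x) = cmod (2 * pi * \<i> * (V (x + sqrt x) - V x))"
      by (simp add: norm_mult)
    also have "2 * pi * \<i> * (V (x + sqrt x) - V x) =
        (vint (9/16) T (f (x + sqrt x)) - vint (9/16) T (f x))
        + (vint (9/16) T (f x) - 2 * pi * \<i> * V x)
        - (vint (9/16) T (f (x + sqrt x)) - 2 * pi * \<i> * V (x + sqrt x))"
      by (simp add: algebra_simps)
    also have "cmod \<dots> \<le> M + C1 / T + C2 / T"
      unfolding M_def by (intro norm_triangle_le3 f_diff_bound[OF x T] C1[OF T] C2[OF T])
    finally show ?thesis by (simp add: add_divide_distrib)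
  qed
  have "((\<lambda>T. M + (C1 + C2) / T) \<longlongrightarrow> M + 0) at_top"
    by (intro tendsto_add tendsto_const tendsto_divide_0[OF tendsto_const] filterlim_at_top_imp_at_infinity filterlim_ident)
  hence "2 * pi * cmod (V (x + sqrt x) - V x) \<le> M + 0"
    by (rule tendsto_lowerbound) (auto intro!: eventually_mono[OF eventually_ge_at_top[of 8]] le)
  moreover have "6 * cmod (V (x + sqrt x) - V x) \<le> 2 * pi * cmod (V (x + sqrt x) - V x)"
    using pi_gt3 by (intro mult_right_mono) auto
  moreover have "0 \<le> sqrt x * B * x powr (5/8)" using x B by simp
  ultimately show ?thesis unfolding M_def by (simp add: mult_ac)
qed

text \<open>Divided by \<open>h\<close>, the increment of \<open>V\<close> over
  \<open>[x, x + h]\<close> is the partial sum minus \<open>m * x\<close>, up to a term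
  \<open>m * (h / 2 - 1)\<close> and the contribution of \<open>x < n <= x + h\<close>. With
  \<open>h = sqrt x\<close> these cost about \<open>sqrt x * ln x\<close>, well below
  \<open>x^(5/8)\<close>.\<close>

theorem partial_sum_bound:
  assumes x: "x \<ge> 1"
  shows "cmod ((psum a x) - m * x) \<le> 120 * B * x powr (5/8)"
proof -
  define h where "h = sqrt x"
  have h3: "h * h = x" and h1: "1 \<le> h" using x by (simp_all add: h_def)
  have h2: "h \<le> x" using mult_left_mono[of 1 h h] h1 h3 by simp
  note h = h1 h2 h3
  define A where "A = (psum a x)"
  define N where "N = {n. 1 \<le> n \<and> real n \<le> x}"
  define N' where "N' = {n. x < real n \<and> real n \<le> x + h}"
  have fin: "finite {n. real n \<le> y}" for y
    by (rule finite_subset[of _ "{..nat \<lfloor>y\<rfloor>}"]) (auto simp: le_nat_floor)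
  have finN: "finite N" "finite N'" unfolding N_def N'_def by (auto intro: finite_subset[OF _ fin])
  have split: "{n. 1 \<le> n \<and> real n \<le> x + h} = N \<union> N'" and dis: "N \<inter> N' = {}"
  proof -
    have "1 \<le> n" if "x < real n" for n using x that by linarith
    thus "{n. 1 \<le> n \<and> real n \<le> x + h} = N \<union> N'" "N \<inter> N' = {}"
      using x h(1) unfolding N_def N'_def by fastforce+
  qed
  define R where "R = (\<Sum>n\<in>N'. a n * (x + h - real n))"
  have "V (x + h) - V x = (\<Sum>n\<in>N. a n * (x + h - real n)) + R - (\<Sum>n\<in>N. a n * (x - real n)) - m * (x + h - 1)\<^sup>2 / 2 + m * (x - 1)\<^sup>2 / 2"
    unfolding V_def split R_def using finN dis by (simp add: sum.union_disjoint N_def)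
  also have "(\<Sum>n\<in>N. a n * (x + h - real n)) = (\<Sum>n\<in>N. a n * (x - real n)) + h * A"
    by (simp add: A_def N_def sum_distrib_left algebra_simps flip: sum.distrib)
  finally have E: "V (x + h) - V x = (\<Sum>n\<in>N. a n * (x - real n)) + h * A + R - (\<Sum>n\<in>N. a n * (x - real n)) - m * (x + h - 1)\<^sup>2 / 2 + m * (x - 1)\<^sup>2 / 2" .
  \<comment> \<open>The quadratic terms of \<open>V\<close> differ by
    \<open>m * h * (x - 1 + h / 2)\<close>; removing \<open>m * h * x\<close> leaves the last
    summand.\<close>
  have "h * (A - m * x) = (V (x + h) - V x) - R + complex_of_real (m * h * (h / 2 - 1))"
    unfolding E by (simp add: field_simps power2_eq_square)
  moreover have "h * cmod (A - m * x) = cmod (h * (A - m * x))" using h by (simp add: norm_mult)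
  ultimately have "h * cmod (A - m * x) = cmod ((V (x + h) - V x) - R + complex_of_real (m * h * (h / 2 - 1)))"
    by simp
  also have "\<dots> \<le> 100 * h * B * x powr (5/8) + (h + 1) * (ln (2 * x) * h) + h * (h / 2 + 1)"
  proof (rule norm_triangle_le3)
    show "cmod (V (x + h) - V x) \<le> 100 * h * B * x powr (5/8)"
      unfolding h_def by (rule V_diff_bound[OF x])
    have "cmod R \<le> of_nat (card N') * (ln (2 * x) * h)" unfolding R_def
    proof (rule sum_norm_bound)
      fix n assume "n \<in> N'"
      hence n: "x < real n" "real n \<le> x + h" by (auto simp: N'_def)
      have "cmod (a n) \<le> ln (2 * x)"
        using a[of n] n x h by (intro order_trans[OF a] ln_mono) auto
      moreover have "cmod (complex_of_real (x + h - real n)) \<le> h"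
        unfolding norm_of_real using n by auto
      ultimately show "cmod (a n * complex_of_real (x + h - real n)) \<le> ln (2 * x) * h"
        unfolding norm_mult using x by (intro mult_mono) auto
    qed
    also have "\<dots> \<le> (h + 1) * (ln (2 * x) * h)"
    proof (rule mult_right_mono)
      have "N' \<subseteq> {nat \<lfloor>x\<rfloor> + 1..nat \<lfloor>x + h\<rfloor>}"
      proof
        fix n assume "n \<in> N'"
        hence "0 \<le> \<lfloor>x\<rfloor>" "\<lfloor>x\<rfloor> < int n" "int n \<le> \<lfloor>x + h\<rfloor>" using x by (auto simp: N'_def floor_less_iff le_floor_iff)
        hence "nat \<lfloor>x\<rfloor> + 1 \<le> n" "n \<le> nat \<lfloor>x + h\<rfloor>" by linarith+
        thus "n \<in> {nat \<lfloor>x\<rfloor> + 1..nat \<lfloor>x + h\<rfloor>}" by simp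
      qed
      hence "card N' \<le> nat \<lfloor>x + h\<rfloor> - nat \<lfloor>x\<rfloor>"
        using card_mono[of "{nat \<lfloor>x\<rfloor> + 1..nat \<lfloor>x + h\<rfloor>}" N'] by simp
      thus "real (card N') \<le> h + 1" using x h by linarith
    qed (use x h in auto)
    finally show "cmod R \<le> (h + 1) * (ln (2 * x) * h)" .
    have "\<bar>m * h * (h / 2 - 1)\<bar> \<le> (1 * h) * (h / 2 + 1)"
      unfolding abs_mult using m h by (intro mult_mono) auto
    thus "cmod (complex_of_real (m * h * (h / 2 - 1))) \<le> h * (h / 2 + 1)"
      unfolding norm_of_real by simp
  qed
  finally have "h * cmod (A - m * x) \<le> h * (100 * B * x powr (5/8) + (h + 1) * ln (2 * x) + (h / 2 + 1))"
    by (simp add: algebra_simps)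
  hence 1: "cmod (A - m * x) \<le> 100 * B * x powr (5/8) + (h + 1) * ln (2 * x) + (h / 2 + 1)"
    using h by simp
  have hp: "h = x powr (1/2)" using x by (simp add: h_def powr_half_sqrt)
  have p: "1 \<le> x powr (1/8)" using x by (simp add: ge_one_powr_ge_zero)
  have xx: "h * x powr (1/8) = x powr (5/8)" unfolding hp by (simp flip: powr_add)
  have "ln (2 * x) \<le> 1 + ln x" using ln_2_less_1 x by (simp add: ln_mult)
  \<comment> \<open>The exponent \<open>1/8\<close> is the gap between \<open>1/2\<close> and
    \<open>5/8\<close>.\<close>
  also have "ln x \<le> 8 * x powr (1/8)" using ln_powr_bound[of x "1/8"] x by simp
  finally have "ln (2 * x) \<le> 9 * x powr (1/8)" using p by linarith
  hence "(h + 1) * ln (2 * x) \<le> (2 * h) * (9 * x powr (1/8))" using h x by (intro mult_mono) auto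
  also have "\<dots> = 18 * x powr (5/8)" using xx by simp
  finally have "(h + 1) * ln (2 * x) + (h / 2 + 1) \<le> 18 * x powr (5/8) + 2 * h" using h by linarith
  also have "h \<le> x powr (5/8)" unfolding hp using x by (intro powr_mono) auto
  finally have "(h + 1) * ln (2 * x) + (h / 2 + 1) \<le> 20 * x powr (5/8)" by simp
  also have "\<dots> \<le> 20 * B * x powr (5/8)" using B by (intro mult_right_mono) auto
  finally show ?thesis using 1 unfolding A_def by linarith
qed

end

section \<open>Logarithmic derivatives of zero-free functions\<close>

text \<open>The map taking \<open>w\<close> to \<open>w / (2 A - w)\<close> sends
  \<open>Re w < A\<close> into the unit disc and fixes 0; Schwarz's lemma applies to its composition
  with \<open>f\<close>, rescaled to the unit disc.\<close>

lemma Borel_Caratheodory: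
  fixes f :: "complex \<Rightarrow> complex"
  assumes holo: "f holomorphic_on ball 0 R" and f0: "f 0 = 0" and A: "A > 0"
    and Re: "\<And>z. cmod z < R \<Longrightarrow> Re (f z) < A" and z: "cmod z < R"
  shows "cmod (f z) \<le> 2 * A * cmod z / (R - cmod z)"
proof -
  have R: "R > 0" using z norm_ge_zero[of z] by linarith
  have lt: "cmod (f w) < cmod (2*A - f w)" if "cmod w < R" for w
  proof -
    have "(Re (f w))\<^sup>2 < (2*A - Re (f w))\<^sup>2"
      using mult_strict_left_mono[of "Re (f w)" "2*A" "4*A"] Re[OF that] A by (simp add: power2_eq_square algebra_simps)
    thus ?thesis by (simp add: cmod_def)
  qed
  define g where "g = (\<lambda>w::complex. f (R * w) / (2*A - f (R*w)))"
  have inR: "cmod (R * w) < R" if "cmod w < 1" for w :: complex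
    using that R by (simp add: norm_mult)
  have "cmod (g (z / R)) \<le> cmod (z / R)"
  proof (rule Schwarz_Lemma(1))
    have h: "(\<lambda>w. f (R * w)) holomorphic_on ball 0 1"
    proof -
      have "f \<circ> (\<lambda>w. R * w) holomorphic_on ball 0 1"
        by (rule holomorphic_on_compose_gen[OF _ holo]) (auto intro!: holomorphic_intros inR)
      thus ?thesis by (simp add: o_def)
    qed
    show "g holomorphic_on ball 0 1" unfolding g_def
      using lt[OF inR] by (intro holomorphic_intros h) (auto, force)
    show "g 0 = 0" by (simp add: g_def f0)
    show "cmod (g w) < 1" if "cmod w < 1" for w
      using lt[OF inR[OF that]] le_less_trans[OF norm_ge_zero lt[OF inR[OF that]]]
      by (auto simp: g_def norm_divide divide_simps)
    show "cmod (z / R) < 1" using z R by (simp add: norm_divide)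
  qed
  hence "cmod (f z) * R \<le> cmod z * cmod (2*A - f z)"
    using R le_less_trans[OF norm_ge_zero lt[OF z]] by (auto simp: g_def norm_divide field_simps)
  also have "\<dots> \<le> cmod z * (2*A + cmod (f z))"
    using A norm_triangle_ineq4[of "of_real (2*A)" "f z"] by (intro mult_left_mono) auto
  finally show ?thesis using z by (simp add: field_simps)
qed

text \<open>Without zeros \<open>H\<close> has a logarithm on the disc, and \<open>A\<close> bounds
  the real part of its increment from the centre. Borel-Caratheodory bounds the increment itself on
  radius \<open>r'\<close>, and Cauchy's inequality on circles of radius \<open>r' - r\<close>
  bounds its derivative \<open>H' / H\<close>.\<close>

lemma log_deriv_bound:
  fixes H :: "complex \<Rightarrow> complex"
  assumes holo: "H holomorphic_on ball c R" and nz: "\<And>s. s \<in> ball c R \<Longrightarrow> H s \<noteq> 0"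
    and A: "A > 0" "\<And>s. s \<in> ball c R \<Longrightarrow> cmod (H s) < exp A * cmod (H c)"
    and r: "0 < r" "r < r'" "r' < R" and s: "dist c s \<le> r"
  shows "cmod (deriv H s / H s) \<le> 2 * A * r' / ((R - r') * (r' - r))"
proof -
  have c: "c \<in> ball c R" using r by simp
  obtain g where g: "g holomorphic_on ball c R" "\<And>s. s \<in> ball c R \<Longrightarrow> exp (g s) = H s"
    using holomorphic_logarithm_exists[OF _ _ holo nz c] by auto
  define f where "f = (\<lambda>z. g (c + z) - g c)"
  have hf: "f holomorphic_on ball 0 R"
  proof -
    have "g \<circ> (\<lambda>z. c + z) holomorphic_on ball 0 R"
      by (rule holomorphic_on_compose_gen[OF _ g(1)]) (auto simp: dist_norm intro!: holomorphic_intros)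
    thus ?thesis unfolding f_def o_def by (intro holomorphic_intros)
  qed
  have bd: "cmod (f z) \<le> 2 * A * r' / (R - r')" if "cmod z \<le> r'" for z
  proof -
    have "cmod (f z) \<le> 2 * A * cmod z / (R - cmod z)"
    proof (rule Borel_Caratheodory[OF hf _ A(1)])
      show "Re (f w) < A" if "cmod w < R" for w
      proof -
        have b: "c + w \<in> ball c R" using that by (simp add: dist_norm)
        have "exp (Re (f w)) * cmod (H c) = cmod (H (c + w))"
          using nz[OF c] by (simp add: f_def exp_diff norm_divide flip: norm_exp_eq_Re add: g(2)[OF b] g(2)[OF c])
        also have "\<dots> < exp A * cmod (H c)" by (rule A(2)[OF b])
        finally show ?thesis using nz[OF c] by simp
      qed
    qed (use that r in \<open>auto simp: f_def\<close>)
    also have "\<dots> \<le> 2 * A * r' / (R - r')"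
      using that r A(1) by (intro frac_le mult_left_mono) auto
    finally show ?thesis .
  qed
  define w where "w = s - c"
  have w: "cmod w \<le> r" using s by (simp add: w_def dist_norm norm_minus_commute)
  have sub: "cball w (r' - r) \<subseteq> ball 0 R" 
  proof
    fix u assume "u \<in> cball w (r' - r)"
    hence "cmod (w - u) \<le> r' - r" by (simp add: dist_norm)
    hence "cmod u \<le> r'" using w norm_triangle_sub[of u w] by (simp add: norm_minus_commute)
    thus "u \<in> ball 0 R" using r by simp
  qed
  have "cmod ((deriv ^^ 1) f w) \<le> fact 1 * (2 * A * r' / (R - r')) / (r' - r) ^ 1"
  proof (rule Cauchy_inequality)
    show "f holomorphic_on ball w (r' - r)" using sub by (meson hf ball_subset_cball holomorphic_on_subset)
    show "continuous_on (cball w (r' - r)) f" using sub hf by (meson holomorphic_on_imp_continuous_on continuous_on_subset)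
    show "cmod (f x) \<le> 2 * A * r' / (R - r')" if "cmod (w - x) = r' - r" for x
      using that w norm_triangle_sub[of x w] by (intro bd) (simp add: norm_minus_commute)
  qed (use r in auto)
  moreover have "deriv f w = deriv H s / H s"
  proof -
    have sb: "s \<in> ball c R" using s r by auto
    have dg: "(g has_field_derivative deriv g s) (at s)" using g(1) sb by (simp add: holomorphic_derivI)
    have "((\<lambda>s. exp (g s)) has_field_derivative exp (g s) * deriv g s) (at s)"
      by (rule derivative_eq_intros dg refl)+
    hence "(H has_field_derivative exp (g s) * deriv g s) (at s)"
      by (rule has_field_derivative_transform_within_open[where S = "ball c R"]) (use sb g(2) in auto)
    hence 1: "deriv H s = H s * deriv g s" using g(2)[OF sb] by (simp add: DERIV_imp_deriv)
    have "(g has_field_derivative deriv g s) (at (c + w))" using dg by (simp add: w_def)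
    hence "(f has_field_derivative deriv g s) (at w)" unfolding f_def
      by (auto intro!: derivative_eq_intros DERIV_chain'[where f = "\<lambda>z. c + z" and g = g])
    hence "deriv f w = deriv g s" by (rule DERIV_imp_deriv)
    with 1 nz[OF sb] show ?thesis by simp
  qed
  ultimately show ?thesis by (simp add: mult_ac)
qed

section \<open>Continuation of Dirichlet series to the right half-plane\<close>

lemma powr_step_bound:
  fixes s :: complex and t :: real
  assumes n: "n \<ge> 1" and t: "real n \<le> t" "t \<le> real n + 1" and s: "Re s > 0"
  shows "cmod (of_real t powr (-s) - of_nat n powr (-s)) \<le> cmod s * real n powr (- Re s - 1)"
proof -
  have "cmod (of_real t powr (-s) - of_real (real n) powr (-s)) \<le> (cmod s * real n powr (- Re s - 1)) * cmod (complex_of_real t - of_real (real n))"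
  proof (rule field_differentiable_bound[where S = "closed_segment (complex_of_real (real n)) (of_real t)"])
    fix z assume "z \<in> closed_segment (complex_of_real (real n)) (of_real t)"
    then obtain u where u: "z = of_real u" "real n \<le> u" "u \<le> t"
      using t by (auto simp: closed_segment_of_real closed_segment_eq_real_ivl simp del: of_real_of_nat_eq)
    have u0: "u > 0" using n u by linarith
    have zn: "z \<notin> \<real>\<^sub>\<le>\<^sub>0" using u u0 by (auto simp: complex_nonpos_Reals_iff)
    show "((\<lambda>z. z powr (-s)) has_field_derivative (-s) * z powr (-s - 1)) 
        (at z within closed_segment (complex_of_real (real n)) (of_real t))"
      using has_field_derivative_powr[OF zn, of "-s"] by (auto intro: has_field_derivative_at_within)
    have "u powr (- Re s - 1) \<le> real n powr (- Re s - 1)"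
      using u s n by (intro powr_mono2') auto
    thus "cmod ((-s) * z powr (-s - 1)) \<le> cmod s * real n powr (- Re s - 1)"
      using u u0 by (simp add: norm_mult norm_powr_real_powr mult_left_mono)
  qed auto
  also have "cmod (complex_of_real t - of_real (real n)) \<le> 1"
    using t unfolding of_real_diff[symmetric] norm_of_real by auto
  finally show ?thesis by (simp add: mult_left_mono mult_left_le)
qed

lemma summable_Suc_powr: "e > 1 \<Longrightarrow> summable (\<lambda>n. real (Suc n) powr (- e))"
  by (subst summable_Suc_iff) (simp add: summable_real_powr_iff)

text \<open>This is zeta(3/2): the terms of the continued series are dominated by
  \<open>n^(- Re s - 1)\<close>, and bounds are wanted for \<open>Re s >= 1/2\<close>.\<close>

definition zeta32 :: real where "zeta32 = (\<Sum>n. real (Suc n) powr (- 3/2))"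

lemma zeta32_ge_1: "zeta32 \<ge> 1"
  unfolding zeta32_def
  using sum_le_suminf[of "\<lambda>n. real (Suc n) powr (- 3/2)" "{0}"] summable_Suc_powr[of "3/2"] by simp

text \<open>Frame for both continuations below. The majorant is better by one power of
  \<open>n\<close> than that of the Dirichlet series, which moves convergence from
  \<open>Re s > 1\<close> to \<open>Re s > 0\<close>; on a ball of radius \<open>Re x / 2\<close>
  about \<open>x\<close> it is uniform, so the sum is holomorphic.\<close>

lemma half_plane_series:
  fixes u :: "nat \<Rightarrow> complex \<Rightarrow> complex" and c :: real
  assumes holo: "\<And>n. u n holomorphic_on {s. Re s > 0}"
    and bd: "\<And>n s. Re s > 0 \<Longrightarrow> cmod (u n s) \<le> c * (cmod s + 1)\<^sup>2 * real (Suc n) powr (- Re s - 1)"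
    and c: "c \<ge> 0"
  obtains g where "g holomorphic_on {s. Re s > 0}"
    "\<And>s. Re s > 0 \<Longrightarrow> (\<lambda>n. u n s) sums g s"
    "\<And>s. Re s \<ge> 1/2 \<Longrightarrow> cmod (g s) \<le> c * zeta32 * (cmod s + 1)\<^sup>2"
proof -
  define S where "S = {s. Re s > 0}"
  have op: "open S" unfolding S_def by (rule open_halfspace_Re_gt)
  have "\<exists>g g'. \<forall>x \<in> S. ((\<lambda>n. u n x) sums g x) \<and> ((\<lambda>n. deriv (u n) x) sums g' x) \<and> (g has_field_derivative g' x) (at x)"
  proof (rule series_and_derivative_comparison_local[OF op])
    show "(u n has_field_derivative deriv (u n) x) (at x)" if "x \<in> S" for n x
      using holo[of n] that op unfolding S_def by (intro holomorphic_derivI) auto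
    fix x assume "x \<in> S"
    hence x: "Re x > 0" by (simp add: S_def)
    define d where "d = Re x / 2"
    define h where "h = (\<lambda>n. c * (cmod x + d + 1)\<^sup>2 * real (Suc n) powr (- (d + 1)))"
    have "summable h" unfolding h_def using x by (intro summable_mult summable_Suc_powr) (auto simp: d_def)
    moreover have "cmod (u n y) \<le> h n" if "y \<in> ball x d \<inter> S" for n y
    proof -
      have y: "cmod (x - y) < d" "Re y > 0" using that by (auto simp: S_def dist_norm)
      have "Re y \<ge> d" using y abs_Re_le_cmod[of "x - y"] by (simp add: d_def abs_le_iff)
      hence 1: "real (Suc n) powr (- Re y - 1) \<le> real (Suc n) powr (- (d + 1))" by (intro powr_mono) auto
      have 2: "cmod y \<le> cmod x + d" using y norm_triangle_ineq2[of y x] by (simp add: norm_minus_commute)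
      have "cmod (u n y) \<le> c * (cmod y + 1)\<^sup>2 * real (Suc n) powr (- Re y - 1)" by (rule bd[OF y(2)])
      also have "\<dots> \<le> h n" unfolding h_def using c 1 2
        by (intro mult_mono power_mono) auto
      finally show ?thesis .
    qed
    ultimately show "\<exists>d h. 0 < d \<and> summable h \<and> (\<forall>\<^sub>F n in sequentially. \<forall>y\<in>ball x d \<inter> S. cmod (u n y) \<le> h n)"
      using x by (intro exI[of _ d] exI[of _ h]) (auto simp: d_def)
  qed
  then obtain g g' where g: "\<And>x. x \<in> S \<Longrightarrow> (\<lambda>n. u n x) sums g x"
      "\<And>x. x \<in> S \<Longrightarrow> (g has_field_derivative g' x) (at x)" by blast
  have "g holomorphic_on S"
    unfolding holomorphic_on_def using g(2) by (meson field_differentiable_at_within field_differentiable_def)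
  moreover have "cmod (g s) \<le> c * zeta32 * (cmod s + 1)\<^sup>2" if s: "Re s \<ge> 1/2" for s
  proof -
    have su: "(\<lambda>n. c * (cmod s + 1)\<^sup>2 * real (Suc n) powr (- 3/2)) sums (c * (cmod s + 1)\<^sup>2 * zeta32)"
      unfolding zeta32_def by (intro sums_mult summable_sums) (use summable_Suc_powr[of "3/2"] in simp)
    have "cmod (u n s) \<le> c * (cmod s + 1)\<^sup>2 * real (Suc n) powr (- 3/2)" for n
    proof -
      have "cmod (u n s) \<le> c * (cmod s + 1)\<^sup>2 * real (Suc n) powr (- Re s - 1)" using s by (intro bd) auto
      also have "\<dots> \<le> c * (cmod s + 1)\<^sup>2 * real (Suc n) powr (- 3/2)"
        using c s by (intro mult_left_mono powr_mono) auto
      finally show ?thesis .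
    qed
    moreover have "(\<lambda>n. u n s) sums g s" using s by (intro g(1)) (auto simp: S_def)
    ultimately have "cmod (g s) \<le> c * (cmod s + 1)\<^sup>2 * zeta32"
      using su by (metis (no_types, lifting) norm_suminf_le sums_iff)
    thus ?thesis by (simp add: mult_ac)
  qed
  ultimately show ?thesis using that g(1) unfolding S_def by blast
qed

text \<open>
  \<open>H s = (s - 1)\<^sup>m L(s, \<chi>)\<close>, with \<open>m = 1\<close> for the zeta function, where the factor removes the pole, and
  \<open>m = 0\<close> for nonprincipal characters.
\<close>
locale L_function =
  fixes q :: nat and chi :: "nat \<Rightarrow> complex" and m :: nat and K :: real and H :: "complex \<Rightarrow> complex"
  assumes char: "dirichlet_character q chi"
    and norm_chi_le: "\<And>n. cmod (chi n) \<le> 1"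
    and m: "m \<le> 1" and K: "K \<ge> 2"
    and H_holo: "H holomorphic_on {s. Re s > 0}"
    and H_eq: "\<And>s. Re s > 1 \<Longrightarrow> (\<lambda>n. chi (Suc n) / of_nat (Suc n) powr s) sums (H s / (s - 1) ^ m)"
    and H_bound: "\<And>s. Re s \<ge> 1/2 \<Longrightarrow> cmod (H s) \<le> K * (cmod s + 1)\<^sup>2"

lemma sums_Suc_powr_tendsto_0:
  assumes "Re s > 0"
  shows "(\<lambda>n. of_nat (Suc n) powr (- s) :: complex) \<longlonglongrightarrow> 0"
proof (rule tendsto_norm_zero_cancel)
  have "(\<lambda>n. real n powr (- Re s)) \<longlonglongrightarrow> 0"
    using assms by (intro tendsto_neg_powr filterlim_real_sequentially) auto
  hence "(\<lambda>n. real (Suc n) powr (- Re s)) \<longlonglongrightarrow> 0" by (rule LIMSEQ_Suc)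
  thus "(\<lambda>n. cmod (of_nat (Suc n) powr (- s))) \<longlonglongrightarrow> 0"
    using norm_powr_real_powr[of "of_nat (Suc n)" "- s" for n] by (simp del: of_nat_Suc)
qed

text \<open>With \<open>N = n + 1\<close>, \<open>u n s\<close> is \<open>s - 1\<close> times the
  difference between \<open>N^(-s)\<close> and the integral of \<open>t^(-s)\<close> over
  \<open>[N, N + 1]\<close>. All these terms vanish at \<open>s = 1\<close>, whence
  \<open>H 1 = 1\<close>, the residue of zeta.\<close>

lemma zeta_L_function:
  obtains K H where "L_function 1 (\<lambda>_. 1) 1 K H" "H 1 = 1"
proof -
  define u where "u = (\<lambda>n s :: complex. (s - 1) * of_nat (Suc n) powr (- s) - of_nat (Suc n) powr (1 - s) + of_nat (Suc (Suc n)) powr (1 - s))"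
    \<comment> \<open>The last two terms telescope to \<open>-1\<close> for \<open>Re s > 1\<close> and make the series converge for \<open>Re s > 0\<close>.\<close>
  have nz: "of_nat (Suc n) \<noteq> (0 :: complex)" for n by (simp del: of_nat_Suc)
  have hol: "u n holomorphic_on {s. Re s > 0}" for n
    unfolding u_def by (intro holomorphic_intros nz)
  have ub: "cmod (u n s) \<le> 1 * (cmod s + 1)\<^sup>2 * real (Suc n) powr (- Re s - 1)" if s: "Re s > 0" for n s
  proof -
    define N where "N = Suc n"
    \<comment> \<open>An antiderivative in \<open>z\<close> of
      \<open>(1 - s) * (z^(-s) - N^(-s))\<close>: its increment over a unit step is
      \<open>u n s\<close>, and \<open>powr_step_bound\<close> controls its derivative.\<close>
    define g where "g = (\<lambda>z. z powr (1 - s) + (s - 1) * z * of_nat N powr (- s))"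
    have "cmod (g (of_real (real N + 1)) - g (of_real (real N)))
      \<le> (cmod (1 - s) * (cmod s * real N powr (- Re s - 1))) * cmod (complex_of_real (real N + 1) - of_real (real N))"
    proof (rule field_differentiable_bound[where S = "closed_segment (complex_of_real (real N)) (of_real (real N + 1))"])
      fix z assume "z \<in> closed_segment (complex_of_real (real N)) (of_real (real N + 1))"
      then obtain t where t: "z = of_real t" "real N \<le> t" "t \<le> real N + 1"
        by (auto simp: closed_segment_of_real closed_segment_eq_real_ivl simp del: of_real_add of_real_of_nat_eq)
      have zn: "z \<notin> \<real>\<^sub>\<le>\<^sub>0" using t by (auto simp: complex_nonpos_Reals_iff N_def)
      show "(g has_field_derivative (1 - s) * (z powr (- s) - of_nat N powr (- s)))
        (at z within closed_segment (complex_of_real (real N)) (of_real (real N + 1)))"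
        unfolding g_def using zn by (auto intro!: derivative_eq_intros simp: algebra_simps)
      show "cmod ((1 - s) * (z powr (- s) - of_nat N powr (- s))) \<le> cmod (1 - s) * (cmod s * real N powr (- Re s - 1))"
        unfolding norm_mult t(1) using t s by (intro mult_left_mono powr_step_bound) (auto simp: N_def)
    qed auto
    moreover have "g (of_real (real N + 1)) - g (of_real (real N)) = u n s"
      by (simp add: g_def u_def N_def algebra_simps)
    ultimately have "cmod (u n s) \<le> cmod (1 - s) * cmod s * real N powr (- Re s - 1)" by simp
    also have "\<dots> \<le> 1 * (cmod s + 1)\<^sup>2 * real N powr (- Re s - 1)"
      using norm_triangle_ineq4[of 1 s] unfolding power2_eq_square mult_1
      by (intro mult_mono mult_nonneg_nonneg) auto
    finally show ?thesis by (simp add: N_def)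
  qed
  obtain g where g: "g holomorphic_on {s. Re s > 0}"
    "\<And>s. Re s > 0 \<Longrightarrow> (\<lambda>n. u n s) sums g s"
    "\<And>s. Re s \<ge> 1/2 \<Longrightarrow> cmod (g s) \<le> 1 * zeta32 * (cmod s + 1)\<^sup>2"
    by (rule half_plane_series[OF hol ub]) auto
  have "L_function 1 (\<lambda>_. 1) 1 (zeta32 + 1) (\<lambda>s. 1 + g s)"
  proof
    show "dirichlet_character 1 (\<lambda>_. 1)" by (simp add: dirichlet_character_def)
    show "(\<lambda>s. 1 + g s) holomorphic_on {s. 0 < Re s}" by (intro holomorphic_intros g)
    show "zeta32 + 1 \<ge> 2" using zeta32_ge_1 by simp
    show "cmod (1 + g s) \<le> (zeta32 + 1) * (cmod s + 1)\<^sup>2" if "1/2 \<le> Re s" for s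
    proof -
      have "1 \<le> (cmod s + 1)\<^sup>2" by (simp add: one_le_power)
      thus ?thesis using g(3)[OF that] norm_triangle_ineq[of 1 "g s"] unfolding distrib_right norm_one by linarith
    qed
    fix s :: complex assume s: "Re s > 1"
    have s1: "s - 1 \<noteq> 0" using s by auto
    define A where "A = (\<lambda>n. of_nat (Suc n) powr (1 - s))"
    have "u n s = (s - 1) * (1 / of_nat (Suc n) powr s) + (A (Suc n) - A n)" for n
      by (simp add: u_def A_def powr_minus divide_inverse)
    hence "(\<Sum>n<N. u n s) = (s - 1) * (\<Sum>n<N. 1 / of_nat (Suc n) powr s) + (A N - A 0)" for N
      by (simp only: sum.distrib sum_distrib_left sum_lessThan_telescope)
    hence part: "(\<Sum>n<N. 1 / of_nat (Suc n) powr s) = ((\<Sum>n<N. u n s) + 1 - of_nat (Suc N) powr (- (s - 1))) / (s - 1)" for N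
      using s1 by (simp add: A_def field_simps)
    have "(\<lambda>N. ((\<Sum>n<N. u n s) + 1 - of_nat (Suc N) powr (- (s - 1))) / (s - 1)) \<longlonglongrightarrow> (g s + 1 - 0) / (s - 1)"
      using s g(2)[of s] s1 by (intro tendsto_intros sums_Suc_powr_tendsto_0) (auto simp: sums_def)
    thus "(\<lambda>n. 1 / of_nat (Suc n) powr s) sums ((1 + g s) / (s - 1) ^ 1)"
      unfolding sums_def part by (simp add: add.commute)
  qed auto
  moreover have "g 1 = 0"
  proof -
    have "u n 1 = 0" for n by (simp add: u_def del: of_nat_Suc)
    thus ?thesis using g(2)[of 1] sums_unique2[OF _ sums_zero] by simp
  qed
  ultimately show ?thesis using that[of "zeta32 + 1" "\<lambda>s. 1 + g s"] by simp
qed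

text \<open>Multiplication by \<open>a\<close> permutes the residues, so the sum \<open>T\<close>
  over a full period satisfies \<open>T = chi a * T\<close> and vanishes; fewer than
  \<open>q\<close> terms remain.\<close>

lemma char_sum_bounded:
  assumes char: "dirichlet_character q chi" and nrm: "\<And>n. cmod (chi n) \<le> 1"
    and a: "coprime a q" "chi a \<noteq> 1"
  shows "cmod (\<Sum>n<N. chi n) \<le> real q"
proof -
  have q: "q > 0" and mult: "\<And>m n. chi (m * n) = chi m * chi n" and per: "\<And>n. chi (n + q) = chi n"
    using char by (auto simp: dirichlet_character_def)
  have permult: "chi (n + k * q) = chi n" for n k
    by (induction k) (simp_all add: per algebra_simps flip: add.assoc, metis add.assoc add.commute per)
  have cmod: "chi (n mod q) = chi n" for n
    using permult[of "n mod q" "n div q"] by (simp add: mult.commute)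
  define T where "T = (\<Sum>n<q. chi n)"
  have bij: "bij_betw (\<lambda>n. a * n mod q) {..<q} {..<q}"
  proof -
    have "inj_on (\<lambda>n. a * n mod q) {..<q}"
    proof (rule inj_onI)
      fix x y assume xy: "x \<in> {..<q}" "y \<in> {..<q}" "a * x mod q = a * y mod q"
      hence "[a * x = a * y] (mod q)" unfolding unique_euclidean_semiring_class.cong_def by blast
      hence "[x = y] (mod q)" using a(1) by (simp add: cong_mult_lcancel_nat)
      thus "x = y" using xy(1,2) by (simp add: unique_euclidean_semiring_class.cong_def)
    qed
    moreover have "(\<lambda>n. a * n mod q) ` {..<q} \<subseteq> {..<q}" using q by auto
    ultimately show ?thesis by (simp add: bij_betw_def endo_inj_surj)
  qed
  have "T = (\<Sum>n<q. chi (a * n mod q))"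
    unfolding T_def using sum.reindex_bij_betw[OF bij, of chi] by simp
  also have "\<dots> = chi a * T" by (simp add: cmod mult T_def sum_distrib_left)
  finally have T0: "T = 0" using a(2) by (simp add: mult_cancel_right1)
  have shift: "(\<Sum>n<N + q. chi n) = (\<Sum>n<N. chi n)" for N
  proof (induction N)
    case 0 show ?case using T0 by (simp add: T_def)
  qed (simp add: per)
  show ?thesis
  proof (induction N rule: less_induct)
    case (less N)
    show ?case
    proof (cases "N < q")
      case True
      have "cmod (\<Sum>n<N. chi n) \<le> of_nat (card {..<N}) * 1" by (intro sum_norm_bound nrm)
      thus ?thesis using True by simp
    next
      case False
      thus ?thesis using less[of "N - q"] shift[of "N - q"] q by simp
    qed
  qed
qed

text \<open>Summation by parts against the bounded sums \<open>S\<close>; \<open>a\<close> witnesses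
  that \<open>chi\<close> is not principal. The factor 2 in the constant secures
  \<open>K >= 2\<close>.\<close>

lemma nonprincipal_L_function:
  assumes char: "dirichlet_character q chi" and nrm: "\<And>n. cmod (chi n) \<le> 1"
    and a: "coprime a q" "chi a \<noteq> 1"
  obtains H where "L_function q chi 0 (2 * zeta32 * real q) H"
proof -
  have q0: "q > 0" using char by (simp add: dirichlet_character_def)
  \<comment> \<open>\<open>S\<close> starts at \<open>n = 0\<close>, whereas the Dirichlet series
    starts at 1. A nonzero \<open>chi 0\<close> is possible only for modulus 1, where
    \<open>chi\<close> would be constantly 1.\<close>
  have chi0: "chi 0 = 0"
  proof -
    have "q \<noteq> 1"
    proof
      assume "q = 1"
      hence 1: "chi (n + 1) = chi n" for n using char by (simp add: dirichlet_character_def)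
      have all: "chi n = chi 0" for n by (induction n) (use 1 in auto)
      have "chi 1 * chi 1 = chi 1" "chi 1 \<noteq> 0" using char unfolding dirichlet_character_def
        by (metis mult_1, metis coprime_1_left)
      hence "chi 1 = 1" by simp
      thus False using all[of 1] all[of a] a by simp
    qed
    thus ?thesis using char unfolding dirichlet_character_def by (metis coprime_0_left_iff nat_dvd_1_iff_1)
  qed
  define S where "S = (\<lambda>N. \<Sum>n<Suc N. chi n)"
  have SB: "cmod (S N) \<le> real q" for N unfolding S_def using char_sum_bounded[OF char nrm a] .
  define u where "u = (\<lambda>n s :: complex. S (Suc n) * (of_nat (Suc n) powr (- s) - of_nat (Suc (Suc n)) powr (- s)))"
  have nz: "of_nat (Suc n) \<noteq> (0 :: complex)" for n by (simp del: of_nat_Suc)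
  have hol: "u n holomorphic_on {s. Re s > 0}" for n
    unfolding u_def by (intro holomorphic_intros nz)
  have ub: "cmod (u n s) \<le> real q * (cmod s + 1)\<^sup>2 * real (Suc n) powr (- Re s - 1)" if s: "Re s > 0" for n s
  proof -
    have "cmod (of_real (real (Suc n) + 1) powr (-s) - of_nat (Suc n) powr (-s)) \<le> cmod s * real (Suc n) powr (- Re s - 1)"
      using s by (intro powr_step_bound) auto
    hence "cmod (of_nat (Suc n) powr (- s) - of_nat (Suc (Suc n)) powr (- s)) \<le> cmod s * real (Suc n) powr (- Re s - 1)"
      by (simp add: norm_minus_commute add_ac)
    hence "cmod (u n s) \<le> real q * (cmod s * real (Suc n) powr (- Re s - 1))"
      unfolding u_def norm_mult by (intro mult_mono SB) auto
    also have "cmod s \<le> (cmod s + 1)\<^sup>2" by (simp add: power2_eq_square algebra_simps)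
    finally show ?thesis by (simp add: mult_left_mono mult_right_mono mult.assoc)
  qed
  obtain g where g: "g holomorphic_on {s. Re s > 0}"
    "\<And>s. Re s > 0 \<Longrightarrow> (\<lambda>n. u n s) sums g s"
    "\<And>s. Re s \<ge> 1/2 \<Longrightarrow> cmod (g s) \<le> real q * zeta32 * (cmod s + 1)\<^sup>2"
    by (rule half_plane_series[OF hol ub]) auto
  have "L_function q chi 0 (2 * zeta32 * real q) g"
  proof
    show "2 \<le> 2 * zeta32 * real q" using zeta32_ge_1 q0 mult_mono[of 1 zeta32 1 "real q"] by simp
    show "cmod (g s) \<le> 2 * zeta32 * real q * (cmod s + 1)\<^sup>2" if "1/2 \<le> Re s" for s
    proof -
      have "0 \<le> real q * zeta32 * (cmod s + 1)\<^sup>2" using zeta32_ge_1 by simp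
      thus ?thesis using g(3)[OF that] by (simp add: mult_ac)
    qed
    fix s :: complex assume s: "Re s > 1"
    have part: "(\<Sum>n<N. chi (Suc n) / of_nat (Suc n) powr s) = (\<Sum>n<N. u n s) + S N * of_nat (Suc N) powr (- s)" for N
      by (induction N) (simp_all add: u_def S_def chi0 powr_minus field_simps del: of_nat_Suc)
    have "(\<lambda>N. S N * of_nat (Suc N) powr (- s)) \<longlonglongrightarrow> 0"
    proof (rule Lim_null_comparison)
      show "(\<lambda>N. real q * cmod (of_nat (Suc N) powr (- s))) \<longlonglongrightarrow> 0"
        using tendsto_mult[OF tendsto_const tendsto_norm[OF sums_Suc_powr_tendsto_0[of s]], of "real q"] s by simp
      show "\<forall>\<^sub>F N in sequentially. cmod (S N * of_nat (Suc N) powr (- s)) \<le> real q * cmod (of_nat (Suc N) powr (- s))"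
        unfolding norm_mult by (intro always_eventually allI mult_right_mono SB) auto
    qed
    hence "(\<lambda>N. (\<Sum>n<N. u n s) + S N * of_nat (Suc N) powr (- s)) \<longlonglongrightarrow> g s + 0"
      using g(2)[of s] s by (intro tendsto_add) (auto simp: sums_def)
    thus "(\<lambda>n. chi (Suc n) / of_nat (Suc n) powr s) sums (g s / (s - 1) ^ 0)"
      unfolding sums_def part by simp
  qed (use char nrm g in auto)
  thus ?thesis using that by blast
qed

section \<open>Dirichlet convolution, and \<open>- L' / L\<close> in the half-plane
  \<open>Re s > 1\<close>\<close>

lemma has_sum_Suc_iff: "((\<lambda>n. f (Suc n)) has_sum S) UNIV \<longleftrightarrow> (f has_sum S) {1..}"
proof (rule has_sum_reindex_bij_betw)
  show "bij_betw Suc UNIV {1..}"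
    by (rule bij_betw_byWitness[of _ "\<lambda>n. n - 1"]) auto
qed

text \<open>The double series converges absolutely over pairs \<open>(d, e)\<close>; reindexing by
  \<open>n = d * e\<close> groups it into the convolution.\<close>

lemma dirichlet_convolution_sums:
  fixes f g :: "nat \<Rightarrow> complex"
  assumes f: "summable (\<lambda>n. cmod (f (Suc n)))" "(\<lambda>n. f (Suc n)) sums A"
    and g: "summable (\<lambda>n. cmod (g (Suc n)))" "(\<lambda>n. g (Suc n)) sums B"
  shows "(\<lambda>n. \<Sum>d | d dvd Suc n. f d * g (Suc n div d)) sums (A * B)"
proof -
  define P where "P = {1::nat..}"
  have fA: "(f has_sum A) P" and gB: "(g has_sum B) P"
    using norm_summable_imp_has_sum[OF f] norm_summable_imp_has_sum[OF g]
    unfolding P_def by (simp_all add: has_sum_Suc_iff)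
  have fa: "(\<lambda>n. cmod (f n)) summable_on P" and ga: "(\<lambda>n. cmod (g n)) summable_on P"
    using norm_summable_imp_has_sum[of "\<lambda>n. cmod (f (Suc n))"] norm_summable_imp_has_sum[of "\<lambda>n. cmod (g (Suc n))"] f(1) g(1)
    unfolding P_def by (auto simp: summable_on_def has_sum_Suc_iff[of "\<lambda>n. cmod (f n)"] has_sum_Suc_iff[of "\<lambda>n. cmod (g n)"] dest!: summable_sums)
  define h where "h = (\<lambda>(d, e). f d * g e)"
  have "(\<lambda>z. norm (h z)) summable_on P \<times> P"
  proof (subst Infinite_Sum.abs_summable_on_Sigma_iff, intro conjI ballI)
    show "(\<lambda>y. norm (h (x, y))) summable_on P" for x
      using ga by (simp add: h_def norm_mult summable_on_cmult_right)
    have "(\<lambda>x. cmod (f x) * (\<Sum>\<^sub>\<infinity>y\<in>P. cmod (g y))) summable_on P"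
      by (intro summable_on_cmult_left fa)
    thus "(\<lambda>x. norm (\<Sum>\<^sub>\<infinity>y\<in>P. cmod (h (x, y)))) summable_on P"
      by (simp add: h_def norm_mult infsum_cmult_right' abs_mult infsum_nonneg)
  qed
  hence "h summable_on P \<times> P" by (rule Infinite_Sum.abs_summable_summable)
  then obtain S where S: "(h has_sum S) (P \<times> P)" by (auto simp: summable_on_def)
  have "((\<lambda>d. f d * B) has_sum S) P"
    by (rule has_sum_SigmaD[OF S]) (auto simp: h_def intro!: has_sum_cmult_right gB)
  moreover have "((\<lambda>d. f d * B) has_sum (A * B)) P" by (intro has_sum_cmult_left fA)
  ultimately have SAB: "S = A * B" by (rule has_sum_unique)
  have "bij_betw (\<lambda>(n, d). (d, n div d)) (Sigma P (\<lambda>n. {d. d dvd n})) (P \<times> P)"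
    by (rule bij_betw_byWitness[of _ "\<lambda>(d, e). (d * e, d)"]) (auto simp: P_def Suc_le_eq elim!: dvdE)
  hence "((\<lambda>x. h (case x of (n, d) \<Rightarrow> (d, n div d))) has_sum S) (Sigma P (\<lambda>n. {d. d dvd n}))"
    using S by (subst has_sum_reindex_bij_betw) auto
  hence "((\<lambda>n. \<Sum>d | d dvd n. f d * g (n div d)) has_sum S) P"
    by (rule has_sum_SigmaD) (auto simp: h_def P_def intro!: has_sum_finite)
  hence "((\<lambda>n. \<Sum>d | d dvd Suc n. f d * g (Suc n div d)) has_sum S) UNIV"
    using has_sum_Suc_iff[of "\<lambda>n. \<Sum>d | d dvd n. f d * g (n div d)" S] unfolding P_def by simp
  thus ?thesis unfolding SAB by (rule has_sum_imp_sums)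
qed

lemma summable_ln_Suc_powr:
  assumes "e > 1"
  shows "summable (\<lambda>n. ln (real (Suc n)) * real (Suc n) powr (- e))"
proof (rule summable_comparison_test')
  define d where "d = (e - 1) / 2"
  have d: "d > 0" using assms by (simp add: d_def)
  show "summable (\<lambda>n. real (Suc n) powr (- (1 + d)) / d)"
    using d by (intro summable_divide summable_Suc_powr) auto
  fix n
  have "ln (real (Suc n)) \<le> real (Suc n) powr d / d"
    using d by (intro ln_powr_bound) auto
  hence "ln (real (Suc n)) * real (Suc n) powr (- e) \<le> real (Suc n) powr d / d * real (Suc n) powr (- e)"
    by (intro mult_right_mono) auto
  also have "\<dots> = real (Suc n) powr (d + - e) / d"
    by (simp only: powr_add times_divide_eq_left)
  also have "d + - e = - (1 + d)" by (simp add: d_def field_simps)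
  finally show "norm (ln (real (Suc n)) * real (Suc n) powr (- e)) \<le> real (Suc n) powr (- (1 + d)) / d"
    by simp
qed

text \<open>\<open>k\<close> is the order of the zero: if \<open>f = g * (w - z)^k\<close> with
  \<open>g z\<close> nonzero, then \<open>f' / f\<close> is \<open>k / (w - z)\<close> plus a
  function holomorphic at \<open>z\<close>. That the limit is a natural number drives both
  nonvanishing proofs below.\<close>

lemma zero_order_limit:
  fixes f :: "complex \<Rightarrow> complex"
  assumes holo: "f holomorphic_on S" "open S" "connected S" "z \<in> S" and nz: "\<exists>w\<in>S. f w \<noteq> 0"
  obtains k :: nat where "k = 0 \<longleftrightarrow> f z \<noteq> 0" "((\<lambda>w. (w - z) * (deriv f w / f w)) \<longlongrightarrow> of_nat k) (at z)"
    "eventually (\<lambda>w. f w \<noteq> 0) (at z)"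
proof -
  define g where "g = zor_poly f z"
  define k where "k = nat (zorder f z)"
  from zorder_exist_zero[OF holo nz] obtain r where k: "if f z = 0 then zorder f z > 0 else zorder f z = 0"
    and r: "r > 0" "cball z r \<subseteq> S" "g holomorphic_on cball z r"
      "\<And>w. w \<in> cball z r \<Longrightarrow> f w = g w * (w - z) ^ k \<and> g w \<noteq> 0"
    unfolding g_def k_def by blast
  have ev: "eventually (\<lambda>w. w \<in> ball z r - {z}) (at z)"
    using r(1) eventually_at_ball' by (auto simp: eventually_at dist_commute intro!: exI[of _ r])
  have gh: "g holomorphic_on ball z r" using r(3) by (rule holomorphic_on_subset) auto
  have eq: "(w - z) * (deriv f w / f w) = (w - z) * (deriv g w / g w) + of_nat k" if w: "w \<in> ball z r - {z}" for w
  proof -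
    have wz: "w - z \<noteq> 0" and gw: "g w \<noteq> 0" using w r(4) by auto
    have dg: "(g has_field_derivative deriv g w) (at w)" using gh w by (intro holomorphic_derivI) auto
    have "((\<lambda>w. g w * (w - z) ^ k) has_field_derivative (deriv g w * (w - z) ^ k + g w * (of_nat k * (w - z) ^ (k - 1)))) (at w)"
      by (rule derivative_eq_intros dg refl)+ (simp add: algebra_simps)
    hence "(f has_field_derivative (deriv g w * (w - z) ^ k + g w * (of_nat k * (w - z) ^ (k - 1)))) (at w)"
      by (rule has_field_derivative_transform_within_open[where S = "ball z r"]) (use w r(4) in auto)
    hence d: "deriv f w = deriv g w * (w - z) ^ k + g w * (of_nat k * (w - z) ^ (k - 1))" by (rule DERIV_imp_deriv)
    have f: "f w = g w * (w - z) ^ k" using r(4) w by auto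
    show ?thesis
    proof (cases k)
      case 0
      thus ?thesis by (simp add: d f)
    next
      case (Suc j)
      define y where "y = w - z"
      define c where "c = (of_nat (Suc j) :: complex)"
      define X where "X = y ^ j"
      have y: "y \<noteq> 0" "X \<noteq> 0" using wz by (simp_all add: y_def X_def)
      have "deriv f w = deriv g w * (y * X) + g w * (c * X)" "f w = g w * (y * X)"
        by (simp_all add: d f Suc y_def X_def c_def del: of_nat_Suc)
      hence "(w - z) * (deriv f w / f w) = y * ((deriv g w * (y * X)) / (g w * (y * X)) + (g w * (c * X)) / (g w * (y * X)))"
        by (simp add: y_def add_divide_distrib)
      also have "\<dots> = y * (deriv g w / g w + c / y)" using y gw by simp
      also have "\<dots> = y * (deriv g w / g w) + c" using y by (simp add: distrib_left)
      finally show ?thesis by (simp add: Suc c_def y_def)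
    qed
  qed
  have cg: "((\<lambda>w. (w - z) * (deriv g w / g w) + of_nat k) \<longlongrightarrow> (z - z) * (deriv g z / g z) + of_nat k) (at z)"
  proof (intro tendsto_intros)
    have "continuous_on (ball z r) (deriv g)" using gh by (intro holomorphic_on_imp_continuous_on holomorphic_deriv) auto
    thus "(deriv g \<longlongrightarrow> deriv g z) (at z)" using r(1)
      by (metis centre_in_ball continuous_on_def open_ball at_within_open)
    have "continuous_on (ball z r) g" using gh by (intro holomorphic_on_imp_continuous_on) auto
    thus "(g \<longlongrightarrow> g z) (at z)" using r(1)
      by (metis centre_in_ball continuous_on_def open_ball at_within_open)
    show "g z \<noteq> 0" using r(1,4) by auto
  qed
  have "((\<lambda>w. (w - z) * (deriv f w / f w)) \<longlongrightarrow> of_nat k) (at z)"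
    by (rule Lim_transform_eventually[OF cg[simplified]], rule eventually_mono[OF ev]) (use eq in auto)
  moreover have "k = 0 \<longleftrightarrow> f z \<noteq> 0" using k unfolding k_def by (auto split: if_splits)
  moreover have "eventually (\<lambda>w. f w \<noteq> 0) (at z)" by (rule eventually_mono[OF ev]) (use r(4) in auto)
  ultimately show ?thesis by (intro that[of k])
qed

lemma cmod_of_nat_powr: "cmod (of_nat (Suc n) powr s) = real (Suc n) powr Re s"
  using norm_powr_real_powr[of "of_nat (Suc n)" s] by (simp del: of_nat_Suc)

context L_function
begin

definition L :: "complex \<Rightarrow> complex" where "L s = H s / (s - 1) ^ m"

text \<open>This is \<open>- L' / L\<close>, but given by its series: the relation
  \<open>L' = - F * L\<close> comes first and is used to show that \<open>L\<close> has no
  zeros.\<close>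

definition F :: "complex \<Rightarrow> complex" where
  "F s = (\<Sum>n. mangoldt (Suc n) * chi (Suc n) / of_nat (Suc n) powr s)"

lemma chi_mult: "chi (a * b) = chi a * chi b"
  using char by (simp add: dirichlet_character_def)

lemma L_sums: "Re s > 1 \<Longrightarrow> (\<lambda>n. chi (Suc n) / of_nat (Suc n) powr s) sums L s"
  using H_eq unfolding L_def .

lemma L_term_bound: "cmod (chi (Suc n) / of_nat (Suc n) powr s) \<le> real (Suc n) powr (- Re s)"
  using norm_chi_le[of "Suc n"] by (simp add: norm_divide cmod_of_nat_powr powr_minus divide_simps del: of_nat_Suc)

lemma F_term_bound: "cmod (mangoldt (Suc n) * chi (Suc n) / of_nat (Suc n) powr s) \<le> mangoldt (Suc n) * real (Suc n) powr (- Re s)"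
  using L_term_bound[of n s] mangoldt_nonneg[of "Suc n"]
  by (simp add: norm_mult norm_divide mult_left_mono flip: times_divide_eq_right del: of_nat_Suc)

lemma summable_mangoldt: "e > 1 \<Longrightarrow> summable (\<lambda>n. mangoldt (Suc n) * real (Suc n) powr (- e))"
  by (rule summable_comparison_test'[OF summable_ln_Suc_powr[of e]])
     (auto simp: mangoldt_nonneg abs_mult simp del: of_nat_Suc intro!: mult_right_mono mangoldt_le)

lemma L_abs_summable: "Re s > 1 \<Longrightarrow> summable (\<lambda>n. cmod (chi (Suc n) / of_nat (Suc n) powr s))"
  by (rule summable_comparison_test'[OF summable_Suc_powr[of "Re s"]]) (use L_term_bound in auto)

lemma F_abs_summable: "Re s > 1 \<Longrightarrow> summable (\<lambda>n. cmod (mangoldt (Suc n) * chi (Suc n) / of_nat (Suc n) powr s))"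
  by (rule summable_comparison_test'[OF summable_mangoldt[of "Re s"]]) (use F_term_bound in auto)

lemma F_sums: "Re s > 1 \<Longrightarrow> (\<lambda>n. mangoldt (Suc n) * chi (Suc n) / of_nat (Suc n) powr s) sums F s"
  unfolding F_def by (rule summable_sums, rule summable_norm_cancel, rule F_abs_summable)

lemma F_bounded: "e > 1 \<Longrightarrow> e \<le> Re s \<Longrightarrow> cmod (F s) \<le> (\<Sum>n. mangoldt (Suc n) * real (Suc n) powr (- e))"
  unfolding F_def
proof (rule norm_suminf_le)
  fix n assume e: "e > 1" "e \<le> Re s"
  have "real (Suc n) powr (- Re s) \<le> real (Suc n) powr (- e)" using e by (intro powr_mono) auto
  thus "cmod (mangoldt (Suc n) * chi (Suc n) / of_nat (Suc n) powr s) \<le> mangoldt (Suc n) * real (Suc n) powr (- e)"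
    using F_term_bound[of n s] mangoldt_nonneg[of "Suc n"] by (meson mult_left_mono order_trans)
qed (use summable_mangoldt in auto)

text \<open>The convolution of the von Mangoldt function with 1 is \<open>ln\<close>, and twisting
  by the completely multiplicative \<open>chi\<close> respects convolution.\<close>

lemma LF_sums:
  assumes s: "Re s > 1"
  shows "(\<lambda>n. of_real (ln (real (Suc n))) * chi (Suc n) / of_nat (Suc n) powr s) sums (F s * L s)"
proof -
  have eq: "(\<Sum>d | d dvd Suc n. (mangoldt d * chi d / of_nat d powr s) * (chi (Suc n div d) / of_nat (Suc n div d) powr s))
     = of_real (ln (real (Suc n))) * chi (Suc n) / of_nat (Suc n) powr s" for n
  proof -
    have "(mangoldt d * chi d / of_nat d powr s) * (chi (Suc n div d) / of_nat (Suc n div d) powr s)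
        = mangoldt d * (chi (Suc n) / of_nat (Suc n) powr s)" if d: "d dvd Suc n" for d
    proof -
      define e where "e = Suc n div d"
      have de: "Suc n = d * e" using d by (simp add: e_def)
      have "complex_of_nat (Suc n) powr s = of_nat d powr s * of_nat e powr s"
        unfolding de of_nat_mult by (intro powr_times_real) auto
      moreover have "chi (Suc n) = chi d * chi e" unfolding de by (rule chi_mult)
      ultimately show ?thesis unfolding e_def[symmetric] by simp
    qed
    hence "(\<Sum>d | d dvd Suc n. (mangoldt d * chi d / of_nat d powr s) * (chi (Suc n div d) / of_nat (Suc n div d) powr s))
        = (\<Sum>d | d dvd Suc n. mangoldt d) * (chi (Suc n) / of_nat (Suc n) powr s)"
      unfolding sum_distrib_right by (intro sum.cong) auto
    also have "(\<Sum>d | d dvd Suc n. mangoldt d :: complex) = of_real (ln (real (Suc n)))" by (rule mangoldt_sum) simp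
    finally show ?thesis by simp
  qed
  show ?thesis
    using dirichlet_convolution_sums[OF F_abs_summable[OF s] F_sums[OF s] L_abs_summable[OF s] L_sums[OF s]]
    unfolding eq .
qed

lemma L_deriv:
  assumes s: "Re s > 1"
  shows "(L has_field_derivative - (F s * L s)) (at s)"
proof -
  define S where "S = {s. Re s > 1}"
  have op: "open S" unfolding S_def by (rule open_halfspace_Re_gt)
  define f' where "f' = (\<lambda>n s. - (of_real (ln (real (Suc n))) * chi (Suc n) / of_nat (Suc n) powr s))"
  have "\<exists>g g'. \<forall>x \<in> S. ((\<lambda>n. chi (Suc n) / of_nat (Suc n) powr x) sums g x) \<and> ((\<lambda>n. f' n x) sums g' x) \<and> (g has_field_derivative g' x) (at x)"
  proof (rule series_and_derivative_comparison_local[OF op])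
    show "((\<lambda>s. chi (Suc n) / of_nat (Suc n) powr s) has_field_derivative f' n x) (at x)" if "x \<in> S" for n x
    proof -
      have nz: "of_nat (Suc n) \<noteq> (0 :: complex)" by (simp del: of_nat_Suc)
      have ln: "ln (of_nat (Suc n) :: complex) = of_real (ln (real (Suc n)))"
        by (metis Ln_of_nat zero_less_Suc)
      have "((\<lambda>s. chi (Suc n) * of_nat (Suc n) powr (- s)) has_field_derivative f' n x) (at x)"
        using nz by (auto intro!: derivative_eq_intros simp: f'_def ln powr_minus divide_inverse simp del: of_nat_Suc)
      thus ?thesis by (simp add: powr_minus divide_inverse)
    qed
    fix x assume "x \<in> S"
    hence x: "Re x > 1" by (simp add: S_def)
    define d where "d = (Re x - 1) / 2"
    define h where "h = (\<lambda>n. real (Suc n) powr (- (d + 1)))"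
    have "summable h" unfolding h_def using x by (intro summable_Suc_powr) (auto simp: d_def)
    moreover have "cmod (chi (Suc n) / of_nat (Suc n) powr y) \<le> h n" if "y \<in> ball x d \<inter> S" for n y
    proof -
      have y: "cmod (x - y) < d" "Re y > 1" using that by (auto simp: S_def dist_norm)
      have "Re y \<ge> d + 1" using y abs_Re_le_cmod[of "x - y"] by (simp add: d_def abs_le_iff field_simps)
      hence "real (Suc n) powr (- Re y) \<le> h n" unfolding h_def by (intro powr_mono) auto
      thus ?thesis using L_term_bound[of n y] by linarith
    qed
    ultimately show "\<exists>d h. 0 < d \<and> summable h \<and> (\<forall>\<^sub>F n in sequentially. \<forall>y\<in>ball x d \<inter> S. cmod (chi (Suc n) / of_nat (Suc n) powr y) \<le> h n)"
      using x by (intro exI[of _ d] exI[of _ h]) (auto simp: d_def)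
  qed
  then obtain g g' where g: "\<And>x. x \<in> S \<Longrightarrow> (\<lambda>n. chi (Suc n) / of_nat (Suc n) powr x) sums g x"
      "\<And>x. x \<in> S \<Longrightarrow> (\<lambda>n. f' n x) sums g' x"
      "\<And>x. x \<in> S \<Longrightarrow> (g has_field_derivative g' x) (at x)" by blast
  have sS: "s \<in> S" using s by (simp add: S_def)
  have "(\<lambda>n. f' n s) sums (- (F s * L s))" unfolding f'_def by (intro sums_minus LF_sums s)
  with g(2)[OF sS] have g': "g' s = - (F s * L s)" by (rule sums_unique2)
  have "g x = L x" if "x \<in> S" for x
    using g(1)[OF that] L_sums[of x] that by (auto simp: S_def intro: sums_unique2)
  with g(3)[OF sS] op sS show ?thesis unfolding g'
    by (meson has_field_derivative_transform_within_open)
qed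

lemma L_holo: "L holomorphic_on {s. Re s > 1}"
  using L_deriv by (auto simp: holomorphic_on_def field_differentiable_def intro: has_field_derivative_at_within)

text \<open>The terms with \<open>N >= 2\<close> are at most
  \<open>1 / N^3 <= 1 / (2 (N - 1) N)\<close>, and these telescope to \<open>1/2\<close>. The bound
  is uniform in \<open>chi\<close> and \<open>Im s\<close>, as needed at the centres of the
  Borel-Caratheodory discs.\<close>

lemma L_lower_bound:
  assumes s: "Re s = 3"
  shows "cmod (L s) \<ge> 1/2"
proof -
  have chi1: "chi 1 = 1"
  proof -
    have "chi 1 \<noteq> 0" using char by (simp add: dirichlet_character_def)
    thus ?thesis using chi_mult[of 1 1] by simp
  qed
  have "(\<lambda>n. chi (Suc (Suc n)) / of_nat (Suc (Suc n)) powr s) sums (L s - 1)"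
    using sums_split_initial_segment[OF L_sums[of s], of 1] s chi1 by simp
  moreover have tel: "(\<lambda>n. (1/2) * (1 / real (Suc n) - 1 / real (Suc (Suc n)))) sums ((1/2) * (1 / real (Suc 0) - 0))"
    by (intro sums_mult telescope_sums') (rule LIMSEQ_Suc[OF lim_1_over_n])
  moreover have "cmod (chi (Suc (Suc n)) / of_nat (Suc (Suc n)) powr s) \<le> (1/2) * (1 / real (Suc n) - 1 / real (Suc (Suc n)))" for n
  proof -
    have "cmod (chi (Suc (Suc n)) / of_nat (Suc (Suc n)) powr s) \<le> real (Suc (Suc n)) powr (- 3)"
      using L_term_bound[of "Suc n" s] s by simp
    also have "\<dots> = 1 / real (Suc (Suc n)) ^ 3" by (simp add: powr_minus divide_inverse)
    also have "\<dots> \<le> 1 / (2 * (real (Suc n) * real (Suc (Suc n))))"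
    proof (rule divide_left_mono)
      have "2 * (real (Suc n) * real (Suc (Suc n))) \<le> real (Suc (Suc n)) * (real (Suc (Suc n)) * real (Suc (Suc n)))"
        by (intro mult_mono) auto
      thus "2 * (real (Suc n) * real (Suc (Suc n))) \<le> real (Suc (Suc n)) ^ 3" by (simp only: power3_eq_cube mult.assoc)
    qed (auto simp del: of_nat_Suc)
    also have "\<dots> = (1/2) * (1 / real (Suc n) - 1 / real (Suc (Suc n)))" by (simp add: divide_simps)
    finally show ?thesis .
  qed
  ultimately have "cmod (L s - 1) \<le> (1/2) * (1 / real (Suc 0) - 0)"
    by (metis (no_types, lifting) norm_suminf_le sums_iff)
  thus ?thesis using norm_triangle_ineq2[of 1 "1 - L s"] by (simp add: norm_minus_commute)
qed

text \<open>A substitute for the Euler product: at a zero of order \<open>k\<close> the quantity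
  \<open>(w - s) L' / L\<close> tends to \<open>k\<close>, but \<open>L' / L = - F\<close> stays
  bounded near \<open>s\<close>, so \<open>k = 0\<close>.\<close>

lemma L_nonzero:
  assumes s: "Re s > 1"
  shows "L s \<noteq> 0"
proof
  assume 0: "L s = 0"
  define S where "S = {s. Re s > 1}"
  have "L 3 \<noteq> 0" using L_lower_bound[of 3] by auto
  hence "\<exists>w\<in>S. L w \<noteq> 0" unfolding S_def by (intro bexI[of _ 3]) auto
  hence S: "L holomorphic_on S" "open S" "connected S" "s \<in> S" "\<exists>w\<in>S. L w \<noteq> 0"
    using L_holo open_halfspace_Re_gt convex_connected[OF convex_halfspace_Re_gt] s
    by (auto simp: S_def)
  obtain k :: nat where k: "k = 0 \<longleftrightarrow> L s \<noteq> 0" "((\<lambda>w. (w - s) * (deriv L w / L w)) \<longlongrightarrow> of_nat k) (at s)"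
    "eventually (\<lambda>w. L w \<noteq> 0) (at s)"
    using zero_order_limit[OF S] .
  define e where "e = (1 + Re s) / 2"
  have e: "e > 1" "e < Re s" using s by (auto simp: e_def)
  define M where "M = (\<Sum>n. mangoldt (Suc n) * real (Suc n) powr (- e))"
  have "((\<lambda>w. (w - s) * (deriv L w / L w)) \<longlongrightarrow> 0) (at s)"
  proof (rule Lim_null_comparison)
    have "eventually (\<lambda>w. w \<in> {w. Re w > e}) (at s)"
      using e by (intro eventually_at_in_open' open_halfspace_Re_gt) auto
    thus "eventually (\<lambda>w. cmod ((w - s) * (deriv L w / L w)) \<le> cmod (w - s) * M) (at s)"
      using k(3)
    proof eventually_elim
      case (elim w)
      have "deriv L w / L w = - F w" using DERIV_imp_deriv[OF L_deriv[of w]] elim e by simp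
      thus ?case using F_bounded[of e w] elim e by (auto simp: norm_mult M_def intro!: mult_left_mono)
    qed
    have "((\<lambda>w. cmod (w - s) * M) \<longlongrightarrow> cmod (s - s) * M) (at s)" by (intro tendsto_intros)
    thus "((\<lambda>w. cmod (w - s) * M) \<longlongrightarrow> 0) (at s)" by simp
  qed
  hence "of_nat k = (0 :: complex)" using k(2) LIM_unique by blast
  thus False using k(1) 0 by simp
qed

lemma H_L: "Re s > 1 \<Longrightarrow> H s = L s * (s - 1) ^ m"
  by (auto simp: L_def)

lemma H_nonzero_gt_1: "Re s > 1 \<Longrightarrow> H s \<noteq> 0"
  using L_nonzero[of s] by (auto simp: L_def)

lemma F_eq:
  assumes s: "Re s > 1"
  shows "F s = - deriv H s / H s + of_nat m / (s - 1)"
proof -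
  have s1: "s - 1 \<noteq> 0" using s by auto
  have "((\<lambda>s. L s * (s - 1) ^ m) has_field_derivative - (F s * L s) * (s - 1) ^ m + L s * (of_nat m * (s - 1) ^ (m - 1))) (at s)"
    by (rule derivative_eq_intros L_deriv s refl)+ (simp add: algebra_simps)
  hence "(H has_field_derivative - (F s * L s) * (s - 1) ^ m + L s * (of_nat m * (s - 1) ^ (m - 1))) (at s)"
    by (rule has_field_derivative_transform_within_open[where S = "{s. Re s > 1}"])
       (use s H_L open_halfspace_Re_gt in auto)
  hence d: "deriv H s = - (F s * L s) * (s - 1) ^ m + L s * (of_nat m * (s - 1) ^ (m - 1))" by (rule DERIV_imp_deriv)
  have "m = 0 \<or> m = 1" using m by auto
  thus ?thesis unfolding d H_L[OF s] using L_nonzero[OF s] s1 by (auto simp: field_simps)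
qed

end

section \<open>Zero-free regions\<close>

context L_function
begin

text \<open>\<open>k\<close> is the order of the zero of \<open>H\<close> at \<open>1 + it\<close>;
  the factor \<open>(s - 1)^m\<close> separating \<open>L\<close> from \<open>H\<close> contributes
  at \<open>t = 0\<close> only.\<close>

lemma F_right_limit:
  fixes t :: real
  obtains k :: nat where "k = 0 \<longleftrightarrow> H (Complex 1 t) \<noteq> 0"
    "((\<lambda>x. of_real (x - 1) * F (Complex x t)) \<longlongrightarrow> (if t = 0 then of_nat m else 0) - of_nat k) (at_right 1)"
proof -
  define S where "S = {s. Re s > 0}"
  define z where "z = Complex 1 t"
  have "H 3 \<noteq> 0" using H_nonzero_gt_1[of 3] by auto
  hence "\<exists>w\<in>S. H w \<noteq> 0" unfolding S_def by (intro bexI[of _ 3]) auto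
  hence S: "H holomorphic_on S" "open S" "connected S" "z \<in> S" "\<exists>w\<in>S. H w \<noteq> 0"
    using H_holo open_halfspace_Re_gt convex_connected[OF convex_halfspace_Re_gt] 
    by (auto simp: S_def z_def)
  obtain k :: nat where k: "k = 0 \<longleftrightarrow> H z \<noteq> 0" "((\<lambda>w. (w - z) * (deriv H w / H w)) \<longlongrightarrow> of_nat k) (at z)"
    using zero_order_limit[OF S] by metis
  have ev: "eventually (\<lambda>x::real. x > 1) (at_right 1)" by (simp add: eventually_at_right_less)
  have fl: "filterlim (\<lambda>x. Complex x t) (at z) (at_right 1)"
    unfolding filterlim_at
  proof
    show "\<forall>\<^sub>F x in at_right 1. Complex x t \<in> UNIV \<and> Complex x t \<noteq> z"
      by (rule eventually_mono[OF ev]) (simp add: z_def)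
    show "((\<lambda>x. Complex x t) \<longlongrightarrow> z) (at_right 1)"
      unfolding z_def by (intro tendsto_intros)
  qed
  have l1: "((\<lambda>x. of_real (x - 1) * (deriv H (Complex x t) / H (Complex x t))) \<longlongrightarrow> of_nat k) (at_right 1)"
  proof -
    have "Complex x t - z = of_real (x - 1)" for x by (simp add: z_def complex_eq_iff)
    thus ?thesis using filterlim_compose[OF k(2) fl] by simp
  qed
  have l2: "((\<lambda>x. of_real (x - 1) * (of_nat m / (Complex x t - 1))) \<longlongrightarrow> (if t = 0 then of_nat m else 0)) (at_right 1)"
  proof (cases "t = 0")
    case True
    have "((\<lambda>x. of_nat m :: complex) \<longlongrightarrow> of_nat m) (at_right (1::real))" by simp
    moreover have "eventually (\<lambda>x. of_nat m = of_real (x - 1) * (of_nat m / (Complex x t - 1))) (at_right 1)"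
    proof (rule eventually_mono[OF ev])
      fix x :: real assume "1 < x"
      moreover have "Complex x t - 1 = of_real (x - 1)" using True by (simp add: complex_eq_iff)
      ultimately show "of_nat m = of_real (x - 1) * (of_nat m / (Complex x t - 1))" by (simp del: of_real_diff)
    qed
    ultimately show ?thesis using True Lim_transform_eventually by fastforce
  next
    case False
    have "z - 1 \<noteq> 0" using False by (simp add: z_def complex_eq_iff)
    hence "((\<lambda>x. of_real (x - 1) * (of_nat m / (Complex x t - 1))) \<longlongrightarrow> of_real (1 - 1) * (of_nat m / (z - 1))) (at_right 1)"
      unfolding z_def by (intro tendsto_intros)
    thus ?thesis using False by simp
  qed
  have "((\<lambda>x. of_real (x - 1) * F (Complex x t)) \<longlongrightarrow> (if t = 0 then of_nat m else 0) - of_nat k) (at_right 1)"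
  proof (rule Lim_transform_eventually[OF tendsto_diff[OF l2 l1]], rule eventually_mono[OF ev])
    fix x :: real assume "1 < x"
    thus "complex_of_real (x - 1) * (of_nat m / (Complex x t - 1)) - of_real (x - 1) * (deriv H (Complex x t) / H (Complex x t))
      = of_real (x - 1) * F (Complex x t)"
      by (subst F_eq) (simp_all add: algebra_simps)
  qed
  thus ?thesis using k(1)[unfolded z_def] by (intro that[of k])
qed

end

text \<open>With \<open>k0\<close>, \<open>k1\<close>, \<open>k2\<close> the orders of zero,
  \<open>x - 1\<close> times the combination \<open>G\<close> of the three logarithmic derivatives
  has nonnegative real part and tends to \<open>3 (m0 - k0) - 4 k1 - k2\<close>. Since
  \<open>m0 <= 1\<close>, this is negative as soon as \<open>k1 >= 1\<close>. The condition on
  \<open>t\<close> keeps the last two functions away from poles.\<close>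

lemma three_four_one:
  fixes t :: real
  assumes zeta: "L_function q0 (\<lambda>_. 1) m0 K0 H0"
    and L: "L_function q chi m K H" and L2: "L_function q2 (\<lambda>n. chi n ^ 2) m2 K2 H2"
    and t: "t \<noteq> 0 \<or> (m = 0 \<and> m2 = 0)"
  shows "H (Complex 1 t) \<noteq> 0"
proof
  assume H0: "H (Complex 1 t) = 0"
  interpret Z: L_function q0 "\<lambda>_. 1" m0 K0 H0 by fact
  interpret L1: L_function q chi m K H by fact
  interpret L2: L_function q2 "\<lambda>n. chi n ^ 2" m2 K2 H2 by fact
  obtain k0 where "((\<lambda>x. of_real (x - 1) * Z.F (Complex x 0)) \<longlongrightarrow> (if (0::real) = 0 then of_nat m0 else 0) - of_nat k0) (at_right 1)"
    by (rule Z.F_right_limit[of 0])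
  hence k0: "((\<lambda>x. of_real (x - 1) * Z.F (Complex x 0)) \<longlongrightarrow> of_nat m0 - of_nat k0) (at_right 1)"
    by (simp only: if_True simp_thms)
  obtain k1 where k1': "k1 = 0 \<longleftrightarrow> H (Complex 1 t) \<noteq> 0"
    "((\<lambda>x. of_real (x - 1) * L1.F (Complex x t)) \<longlongrightarrow> (if t = 0 then of_nat m else 0) - of_nat k1) (at_right 1)"
    by (rule L1.F_right_limit[of t])
  have "(if t = 0 then of_nat m else 0) - of_nat k1 = (- of_nat k1 :: complex)" using t by auto
  with k1' H0 have "k1 \<noteq> 0" and k1: "((\<lambda>x. of_real (x - 1) * L1.F (Complex x t)) \<longlongrightarrow> - of_nat k1) (at_right 1)"
    by (simp_all only: not_not simp_thms)
  obtain k2 where k2': "((\<lambda>x. of_real (x - 1) * L2.F (Complex x (2 * t))) \<longlongrightarrow> (if 2 * t = 0 then of_nat m2 else 0) - of_nat k2) (at_right 1)"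
    by (rule L2.F_right_limit[of "2 * t"])
  have "(if 2 * t = 0 then of_nat m2 else 0) - of_nat k2 = (- of_nat k2 :: complex)" using t by auto
  with k2' have k2: "((\<lambda>x. of_real (x - 1) * L2.F (Complex x (2 * t))) \<longlongrightarrow> - of_nat k2) (at_right 1)"
    by (simp only:)
  define G where "G = (\<lambda>x. 3 * Z.F (Complex x 0) + 4 * L1.F (Complex x t) + L2.F (Complex x (2 * t)))"
  have pos: "Re (G x) \<ge> 0" if x: "x > 1" for x
  proof -
    have "(\<lambda>n. Re (3 * (mangoldt (Suc n) * 1 / of_nat (Suc n) powr Complex x 0)
        + 4 * (mangoldt (Suc n) * chi (Suc n) / of_nat (Suc n) powr Complex x t)
        + mangoldt (Suc n) * chi (Suc n) ^ 2 / of_nat (Suc n) powr Complex x (2 * t))) sums Re (G x)"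
      unfolding G_def using x by (intro sums_Re sums_add sums_mult Z.F_sums L1.F_sums L2.F_sums) auto
    moreover have "Re (3 * (mangoldt (Suc n) * 1 / of_nat (Suc n) powr Complex x 0)
        + 4 * (mangoldt (Suc n) * chi (Suc n) / of_nat (Suc n) powr Complex x t)
        + mangoldt (Suc n) * chi (Suc n) ^ 2 / of_nat (Suc n) powr Complex x (2 * t)) \<ge> 0" for n
    proof -
      define N where "N = complex_of_nat (Suc n)"
      have N0: "N \<noteq> 0" by (simp add: N_def del: of_nat_Suc)
      define X where "X = real (Suc n) powr x"
      define r where "r = mangoldt (Suc n) / X"
      define w where "w = chi (Suc n) / N powr Complex 0 t"
      have Nx: "N powr Complex x 0 = of_real X"
      proof -
        have "Complex x 0 = of_real x" "N = of_real (real (Suc n))" by (simp_all add: complex_eq_iff N_def)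
        thus ?thesis unfolding X_def using powr_of_real[of "real (Suc n)" x] by (simp only: of_nat_0_le_iff)
      qed
      have a: "Complex x t = Complex x 0 + Complex 0 t" "Complex x (2 * t) = Complex x 0 + (Complex 0 t + Complex 0 t)"
        by (simp_all add: complex_eq_iff)
      have e: "mangoldt (Suc n) * 1 / N powr Complex x 0 = of_real r"
        "mangoldt (Suc n) * chi (Suc n) / N powr Complex x t = of_real r * w"
        "mangoldt (Suc n) * chi (Suc n) ^ 2 / N powr Complex x (2 * t) = of_real r * w ^ 2"
      proof -
        have gen: "b * 1 / Y = b / Y" "b * c / (Y * E) = b / Y * (c / E)" "b * c ^ 2 / (Y * (E * E)) = b / Y * (c / E) ^ 2"
          for b c Y E :: complex by (simp_all add: power2_eq_square)
        show "mangoldt (Suc n) * 1 / N powr Complex x 0 = of_real r"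
          "mangoldt (Suc n) * chi (Suc n) / N powr Complex x t = of_real r * w"
          "mangoldt (Suc n) * chi (Suc n) ^ 2 / N powr Complex x (2 * t) = of_real r * w ^ 2"
          unfolding a powr_add Nx w_def r_def of_real_divide of_real_mangoldt by (rule gen)+
      qed
      \<comment> \<open>Only an inequality, since \<open>chi\<close> vanishes at arguments not
        coprime to the modulus.\<close>
      have w1: "cmod w \<le> 1"
        using L1.norm_chi_le[of "Suc n"] cmod_of_nat_powr[of n "Complex 0 t"] by (simp add: w_def N_def norm_divide del: of_nat_Suc)
      have "Re (3 + 4 * w + w ^ 2) \<ge> 0" \<comment> \<open>in fact at least \<open>2 (1 + Re w)\<^sup>2\<close>\<close>
      proof -
        have "(Re w)\<^sup>2 + (Im w)\<^sup>2 \<le> 1" using w1 by (simp add: cmod_def real_sqrt_le_iff[of _ 1, simplified])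
        moreover have "0 \<le> 2 * (1 + Re w)\<^sup>2" by simp
        ultimately show ?thesis by (simp add: power2_eq_square algebra_simps)
      qed
      moreover have "r \<ge> 0" by (simp add: r_def X_def mangoldt_nonneg)
      ultimately have "0 \<le> r * Re (3 + 4 * w + w ^ 2)" by simp
      also have "\<dots> = Re (3 * of_real r + 4 * (of_real r * w) + of_real r * w ^ 2)" by (simp add: algebra_simps)
      finally show ?thesis unfolding N_def[symmetric] e .
    qed
    ultimately show ?thesis by (metis (no_types, lifting) sums_le sums_zero)
  qed
  have "((\<lambda>x. 3 * (of_real (x - 1) * Z.F (Complex x 0)) + 4 * (of_real (x - 1) * L1.F (Complex x t)) + of_real (x - 1) * L2.F (Complex x (2 * t)))
     \<longlongrightarrow> 3 * (of_nat m0 - of_nat k0) + 4 * (- of_nat k1) + - of_nat k2) (at_right 1)"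
    by (intro tendsto_intros k0 k1 k2)
  moreover have "3 * (of_real (x - 1) * Z.F (Complex x 0)) + 4 * (of_real (x - 1) * L1.F (Complex x t)) + of_real (x - 1) * L2.F (Complex x (2 * t))
      = of_real (x - 1) * G x" for x by (simp add: G_def algebra_simps)
  ultimately have "((\<lambda>x. Re (of_real (x - 1) * G x)) \<longlongrightarrow> Re (3 * (of_nat m0 - of_nat k0) + 4 * (- of_nat k1) + - of_nat k2)) (at_right 1)"
    by (intro tendsto_Re) simp
  hence "0 \<le> Re (3 * (of_nat m0 - of_nat k0) + 4 * (- of_nat k1) + - of_nat k2)"
  proof (rule tendsto_lowerbound)
    show "\<forall>\<^sub>F x in at_right 1. 0 \<le> Re (of_real (x - 1) * G x)"
      by (rule eventually_mono[OF eventually_at_right_less]) (use pos in \<open>auto simp flip: of_real_diff\<close>)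
  qed simp
  thus False using Z.m \<open>k1 \<noteq> 0\<close> by simp
qed

section \<open>GRH for the continuation \<open>L\<close>, and the resulting bound for sums of
  \<open>mangoldt n * chi n\<close>\<close>

context L_function
begin

text \<open>\<open>GRH\<close> speaks about the function picked by \<open>SOME\<close> in
  \<open>dirichlet_L\<close>. Since \<open>L\<close> satisfies the same specification, the choice
  does too; both agree with the series for \<open>Re s > 1\<close>, and the identity theorem on the
  connected punctured half-plane makes them equal at \<open>s\<close>.\<close>

lemma GRH_imp_H_nonzero:
  assumes "GRH" and s: "1/2 < Re s" "Re s < 1"
  shows "H s \<noteq> 0"
proof
  assume "H s = 0"
  define S where "S = {s. Re s > 0} - {1}"
  define P where "P = (\<lambda>L'. L' holomorphic_on S \<and> (\<forall>s. Re s > 1 \<longrightarrow> (\<lambda>n. chi (Suc n) / of_nat (Suc n) powr s) sums L' s))"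
  have hol: "L holomorphic_on S" unfolding L_def S_def
    using H_holo by (auto intro!: holomorphic_intros intro: holomorphic_on_subset)
  hence "P L" unfolding P_def using L_sums by auto
  hence "P (SOME L. P L)" by (rule someI[of P])
  moreover have "dirichlet_L chi = (SOME L. P L)" unfolding dirichlet_L_def P_def S_def by simp
  ultimately have P: "P (dirichlet_L chi)" by simp
  have "dirichlet_L chi s = L s"
  proof (rule analytic_continuation_open[where s = "{s. Re s > 1}" and s' = S and f = "dirichlet_L chi" and g = L])
    show "open {s. Re s > 1}" by (rule open_halfspace_Re_gt)
    show "open S" unfolding S_def by (intro open_delete open_halfspace_Re_gt)
    have "(2 :: complex) \<in> {s. Re s > 1}" by simp
    thus "{s. Re s > 1} \<noteq> {}" by blast
    show "connected S" unfolding S_def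
      by (intro connected_open_delete open_halfspace_Re_gt convex_connected convex_halfspace_Re_gt) auto
    show "{s. Re s > 1} \<subseteq> S" by (auto simp: S_def)
    show "dirichlet_L chi holomorphic_on S" "L holomorphic_on S" using P hol by (auto simp: P_def)
    show "dirichlet_L chi z = L z" if "z \<in> {s. Re s > 1}" for z
      using P L_sums[of z] that unfolding P_def by (auto intro: sums_unique2)
    show "s \<in> S" using s by (auto simp: S_def)
  qed
  hence "dirichlet_L chi s = 0" using \<open>H s = 0\<close> by (simp add: L_def)
  moreover have "0 < Re s" using s by simp
  ultimately have "Re s = 1/2" using \<open>GRH\<close>[unfolded GRH_def, rule_format, OF char] s(2) by blast
  thus False using s by simp
qed

text \<open>\<open>log_deriv_bound\<close> about \<open>3 + it\<close> gives a bound logarithmic in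
  \<open>t\<close>, relaxed to the power \<open>1/16\<close>. Linearity in \<open>ln K\<close> is
  what becomes \<open>ln q\<close> for characters.\<close>

lemma log_deriv_H_bound:
  assumes nz: "\<And>s. Re s > 1/2 \<Longrightarrow> H s \<noteq> 0" and s: "9/16 \<le> Re s" "Re s \<le> 3"
  shows "cmod (deriv H s / H s) \<le> 3000000 * ln K * (1 + \<bar>Im s\<bar>) powr (1/16)"
proof -
  define t where "t = Im s"
  define c where "c = Complex 3 t"
  \<comment> \<open>On the disc \<open>cmod z + 1 <= \<bar>t\<bar> + 7\<close>, and
    \<open>cmod (H c) >= 1/2\<close>; the factor 4 in place of 2 makes the comparison with
    \<open>exp A\<close> strict.\<close>
  define A where "A = ln (4 * K * (\<bar>t\<bar> + 7)\<^sup>2)"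
  have arg: "1 < 4 * K * (\<bar>t\<bar> + 7)\<^sup>2"
  proof -
    have "1 < 4 * K" using K by simp
    also have "\<dots> \<le> 4 * K * (\<bar>t\<bar> + 7)\<^sup>2" using K by (simp add: one_le_power)
    finally show ?thesis .
  qed
  have A0: "A > 0" unfolding A_def using arg by (rule ln_gt_zero)
  have Hc: "cmod (H c) \<ge> 1/2"
  proof -
    have "1 \<le> cmod (c - 1)" using complex_Re_le_cmod[of "c - 1"] by (simp add: c_def)
    hence "1/2 * 1 \<le> cmod (L c) * cmod (c - 1) ^ m"
      using L_lower_bound[of c] by (intro mult_mono one_le_power) (auto simp: c_def)
    thus ?thesis using H_L[of c] by (simp add: c_def norm_mult norm_power)
  qed
  have reg: "Re z > 1/2" if "z \<in> ball c (79/32)" for z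
    using that abs_Re_le_cmod[of "c - z"] by (auto simp: c_def dist_norm)
  have "cmod (deriv H s / H s) \<le> 2 * A * (157/64) / ((79/32 - 157/64) * (157/64 - 39/16))"
    \<comment> \<open>The outer disc about \<open>3 + it\<close> stays in \<open>Re s > 1/2\<close>, the inner one reaches the line \<open>Re s = 9/16\<close>.\<close>
  proof (rule log_deriv_bound[where c = c])
    show "H holomorphic_on ball c (79/32)"
      by (rule holomorphic_on_subset[OF H_holo]) (use reg in force)
    show "H z \<noteq> 0" if "z \<in> ball c (79/32)" for z using reg[OF that] nz by simp
    show "cmod (H z) < exp A * cmod (H c)" if z: "z \<in> ball c (79/32)" for z
    proof -
      have "cmod c \<le> \<bar>t\<bar> + 3" using cmod_le[of c] by (simp add: c_def)
      moreover have "cmod (z - c) \<le> 3" using z by (simp add: dist_norm norm_minus_commute)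
      ultimately have "cmod z + 1 \<le> \<bar>t\<bar> + 7" using norm_triangle_sub[of z c] by linarith
      hence sq: "(cmod z + 1)\<^sup>2 \<le> (\<bar>t\<bar> + 7)\<^sup>2" by (intro power_mono) auto
      have "cmod (H z) \<le> K * (cmod z + 1)\<^sup>2" using reg[OF z] by (intro H_bound) auto
      also have "\<dots> \<le> K * (\<bar>t\<bar> + 7)\<^sup>2" using K sq by (intro mult_left_mono) auto
      also have "\<dots> < 4 * K * (\<bar>t\<bar> + 7)\<^sup>2 * (1/2)" using arg by simp
      also have "\<dots> \<le> exp A * cmod (H c)"
        unfolding A_def using arg mult_left_mono[OF Hc, of "4 * K * (\<bar>t\<bar> + 7)\<^sup>2"] by (subst exp_ln) auto
      finally show ?thesis .
    qed
    show "dist c s \<le> 39/16"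
    proof -
      have "c - s = of_real (3 - Re s)" by (simp add: c_def t_def complex_eq_iff)
      hence "dist c s = \<bar>3 - Re s\<bar>" unfolding dist_norm by (simp only: norm_of_real)
      thus ?thesis using s by simp
    qed
  qed (use A0 in auto)
  \<comment> \<open>Both gaps between consecutive radii are \<open>1/64\<close>, so the constant is
    \<open>2 * 157 * 64\<close>.\<close>
  hence 1: "cmod (deriv H s / H s) \<le> 20096 * A" by simp
  define u where "u = (1 + \<bar>t\<bar>) powr (1/16)"
  have u: "u \<ge> 1" unfolding u_def by (simp add: ge_one_powr_ge_zero)
  have l2: "ln K \<ge> ln 2" using K by simp
  hence "ln K \<ge> 1/2" using ln2_ge_two_thirds by linarith
  note l = this l2
  have "A = ln 4 + ln K + 2 * ln (\<bar>t\<bar> + 7)" unfolding A_def using K by (simp add: ln_mult ln_realpow)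
  also have "ln (4::real) = 2 * ln 2" using ln_realpow[of 2 2] by simp
  also have "2 * ln (2::real) \<le> 2 * ln K" using l by simp
  also have "ln (\<bar>t\<bar> + 7) \<le> 32 * u"
  proof -
    have "ln (\<bar>t\<bar> + 7) \<le> ln (8 * (1 + \<bar>t\<bar>))" by simp
    also have "\<dots> = 3 * ln 2 + ln (1 + \<bar>t\<bar>)"
      using ln_realpow[of 2 3] by (subst ln_mult) auto
    also have "\<dots> \<le> 3 + ln (1 + \<bar>t\<bar>)" using ln_2_less_1 by simp
    also have "ln (1 + \<bar>t\<bar>) \<le> (1 + \<bar>t\<bar>) powr (1/16) / (1/16)" by (intro ln_powr_bound) auto
    also have "\<dots> = 16 * u" by (simp add: u_def)
    finally show ?thesis using u by linarith
  qed
  finally have "A \<le> 3 * ln K + 64 * u" by simp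
  also have "\<dots> \<le> 3 * (ln K * u) + 128 * (ln K * u)"
  proof (intro add_mono)
    have "ln K * 1 \<le> ln K * u" using l u by (intro mult_left_mono) auto
    thus "3 * ln K \<le> 3 * (ln K * u)" by simp
    have "(1/2) * u \<le> ln K * u" using l u by (intro mult_right_mono) auto
    thus "64 * u \<le> 128 * (ln K * u)" by linarith
  qed
  finally have "20096 * A \<le> 20096 * 131 * (ln K * u)" by simp
  also have "\<dots> \<le> 3000000 * (ln K * u)" using l u by (intro mult_right_mono) auto
  finally show ?thesis using 1 by (simp add: u_def t_def)
qed

text \<open>An instance of \<open>partial_sum_bound\<close> with \<open>B\<close> taken from
  \<open>log_deriv_H_bound\<close>; the constant is \<open>120 * 3000000\<close>.\<close>

lemma psi_bound:
  assumes nz: "\<And>s. Re s > 1/2 \<Longrightarrow> H s \<noteq> 0" and x: "x \<ge> 1"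
  shows "cmod ((psum (\<lambda>n. mangoldt n * chi n) x) - of_nat m * x) \<le> 360000000 * ln K * x powr (5/8)"
proof -
  have "ln K \<ge> ln 2" using K by simp
  hence l: "ln K \<ge> 1/2" using ln2_ge_two_thirds by linarith
  interpret tauberian "\<lambda>n. mangoldt n * chi n" "\<lambda>s. - deriv H s / H s" "real m" "3000000 * ln K"
  proof
    fix n :: nat assume "n \<ge> 1"
    hence "mangoldt n * cmod (chi n) \<le> ln (real n) * 1"
      using mangoldt_le[of n] norm_chi_le[of n] mangoldt_nonneg[of n] by (intro mult_mono) auto
    thus "cmod (mangoldt n * chi n) \<le> ln (real n)" by (simp add: norm_mult)
  next
    show "(\<lambda>s. - deriv H s / H s) holomorphic_on {s. 1/2 < Re s}"
      using nz by (intro holomorphic_intros holomorphic_on_subset[OF H_holo] open_halfspace_Re_gt) auto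
    fix s :: complex assume s: "Re s > 1"
    show "(\<lambda>n. mangoldt (Suc n) * chi (Suc n) / of_nat (Suc n) powr s) sums (- deriv H s / H s + complex_of_real (real m) / (s - 1))"
      using F_sums[OF s] F_eq[OF s] by simp
  next
    fix s :: complex assume "9/16 \<le> Re s" "Re s \<le> 3"
    thus "cmod (- deriv H s / H s) \<le> 3000000 * ln K * (1 + \<bar>Im s\<bar>) powr (1/16)"
      using log_deriv_H_bound[OF nz] by (simp add: norm_divide)
  qed (use m l in auto)
  show ?thesis using partial_sum_bound[OF x] by simp
qed

end

section \<open>Sums over primes\<close>

text \<open>Zeta plays all three roles in \<open>three_four_one\<close>, which covers the line
  \<open>Re s = 1\<close> apart from \<open>s = 1\<close>; there \<open>H 1 = 1\<close> is
  used.\<close>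

lemma psi_zeta_bound:
  assumes "GRH"
  obtains C where "C \<ge> 0"
    "\<And>x. x \<ge> 1 \<Longrightarrow> \<bar>(psum mangoldt x) - x\<bar> \<le> C * x powr (5/8)"
proof -
  obtain K H where Z: "L_function 1 (\<lambda>_. 1) 1 K H" and H1: "H 1 = 1"
    by (rule zeta_L_function)
  interpret Z: L_function 1 "\<lambda>_. 1" 1 K H by fact
  have Z2: "L_function 1 (\<lambda>_. 1 ^ 2) 1 K H" using Z by simp
  have nz: "H s \<noteq> 0" if s: "Re s > 1/2" for s
  proof -
    consider "Re s < 1" | "Re s > 1" | "s = 1" | "Re s = 1" "Im s \<noteq> 0"
      by (cases "Re s" "1::real" rule: linorder_cases; cases "Im s = 0") (auto simp: complex_eq_iff)
    thus ?thesis
    proof cases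
      case 1 thus ?thesis using Z.GRH_imp_H_nonzero[OF assms s] by simp
    next
      case 2 thus ?thesis by (rule Z.H_nonzero_gt_1)
    next
      case 3 thus ?thesis using H1 by simp
    next
      case 4
      have "s = Complex 1 (Im s)" using 4 by (simp add: complex_eq_iff)
      thus ?thesis using three_four_one[OF Z Z Z2, of "Im s"] 4 by metis
    qed
  qed
  have lnK: "ln K \<ge> 0" using Z.K by simp
  show ?thesis
  proof (rule that[of "360000000 * ln K"])
    fix x :: real assume x: "x \<ge> 1"
    have eq: "(psum (\<lambda>n. mangoldt n * 1) x) - complex_of_real (of_nat 1 * x)
        = of_real ((psum mangoldt x) - x)"
      by simp
    show "\<bar>(psum mangoldt x) - x\<bar> \<le> 360000000 * ln K * x powr (5/8)"
      using Z.psi_bound[OF nz x] unfolding eq norm_of_real by simp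
  qed (use lnK in simp)
qed

text \<open>
  The condition on \<open>chi a ^ 2\<close> excludes real characters, for which the 3-4-1 argument fails at \<open>s = 1\<close>.
\<close>
lemma psi_char_bound:
  assumes "GRH"
  obtains C where "C \<ge> 0"
    "\<And>q chi a x. dirichlet_character q chi \<Longrightarrow> q \<ge> 2 \<Longrightarrow> (\<And>n. cmod (chi n) \<le> 1) \<Longrightarrow>
       coprime a q \<Longrightarrow> chi a ^ 2 \<noteq> 1 \<Longrightarrow> x \<ge> 1 \<Longrightarrow>
       cmod (psum (\<lambda>n. mangoldt n * chi n) x) \<le> C * ln (real q) * x powr (5/8)"
proof -
  obtain K0 H0 where Z: "L_function 1 (\<lambda>_. 1) 1 K0 H0" by (rule zeta_L_function)
  \<comment> \<open>For \<open>q >= 2\<close> the additive constant \<open>ln (2 * zeta32)\<close>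
    is at most \<open>ln (2 * zeta32) / ln 2\<close> times \<open>ln q\<close>.\<close>
  define C where "C = 360000000 * (ln (2 * zeta32) / ln 2 + 1)"
  have z: "ln (2 * zeta32) \<ge> 0" using zeta32_ge_1 by simp
  hence C0: "C \<ge> 0" by (simp add: C_def)
  show ?thesis
  proof (rule that[OF C0])
    fix q chi a x
    assume ch: "dirichlet_character q chi" and q: "q \<ge> 2" and nrm: "\<And>n. cmod (chi n) \<le> 1"
      and a: "coprime a q" "chi a ^ 2 \<noteq> 1" and x: "(x::real) \<ge> 1"
    have a1: "chi a \<noteq> 1" using a(2) by auto
    obtain H where L: "L_function q chi 0 (2 * zeta32 * real q) H"
      by (rule nonprincipal_L_function[OF ch nrm a(1) a1])
    have ch2: "dirichlet_character q (\<lambda>n. chi n ^ 2)"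
      using ch by (simp add: dirichlet_character_def power_mult_distrib)
    have nrm2: "cmod (chi n ^ 2) \<le> 1" for n using nrm[of n] by (simp add: norm_power power_le_one)
    obtain H2 where L2: "L_function q (\<lambda>n. chi n ^ 2) 0 (2 * zeta32 * real q) H2"
      by (rule nonprincipal_L_function[OF ch2 nrm2 a])
    interpret L: L_function q chi 0 "2 * zeta32 * real q" H by fact
    have nz: "H s \<noteq> 0" if s: "Re s > 1/2" for s
    proof -
      consider "Re s < 1" | "Re s > 1" | "Re s = 1" by linarith
      thus ?thesis
      proof cases
        case 1 thus ?thesis using L.GRH_imp_H_nonzero[OF assms s] by simp
      next
        case 2 thus ?thesis by (rule L.H_nonzero_gt_1)
      next
        case 3
        have "s = Complex 1 (Im s)" using 3 by (simp add: complex_eq_iff)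
        thus ?thesis using three_four_one[OF Z L L2, of "Im s"] by metis
      qed
    qed
    have "ln (2 * zeta32 * real q) = ln (2 * zeta32) + ln (real q)"
      using zeta32_ge_1 q by (subst ln_mult) auto
    also have "ln (2 * zeta32) * 1 \<le> ln (2 * zeta32) * (ln (real q) / ln 2)"
      using z q by (intro mult_left_mono) auto
    hence "ln (2 * zeta32) + ln (real q) \<le> (ln (2 * zeta32) / ln 2 + 1) * ln (real q)"
      by (simp add: algebra_simps)
    finally have "360000000 * ln (2 * zeta32 * real q) \<le> 360000000 * ((ln (2 * zeta32) / ln 2 + 1) * ln (real q))"
      by simp
    hence "360000000 * ln (2 * zeta32 * real q) \<le> C * ln (real q)" by (simp only: C_def mult.assoc)
    hence "360000000 * ln (2 * zeta32 * real q) * x powr (5/8) \<le> C * ln (real q) * x powr (5/8)"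
      by (rule mult_right_mono) auto
    moreover have "cmod (psum (\<lambda>n. mangoldt n * chi n) x) \<le> 360000000 * ln (2 * zeta32 * real q) * x powr (5/8)"
      using L.psi_bound[OF nz x] by simp
    ultimately show "cmod (psum (\<lambda>n. mangoldt n * chi n) x) \<le> C * ln (real q) * x powr (5/8)"
      by linarith
  qed
qed

section \<open>From von Mangoldt weights to primes\<close>

lemma finite_nat_le_real: "finite {n. P n \<and> real n \<le> x}"
  by (rule finite_subset[of _ "{..nat \<lfloor>x\<rfloor>}"]) (auto simp: le_nat_floor)

lemma abel_inequality:
  fixes c :: "nat \<Rightarrow> complex" and w :: "nat \<Rightarrow> real"
  assumes M: "\<And>k. 2 \<le> k \<Longrightarrow> k \<le> N \<Longrightarrow> cmod (\<Sum>n=2..k. c n) \<le> M" and N: "N \<ge> 2"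
    and w: "\<And>k. 2 \<le> k \<Longrightarrow> w (Suc k) \<le> w k" "\<And>k. 2 \<le> k \<Longrightarrow> 0 \<le> w k"
  shows "cmod (\<Sum>n=2..N. c n * w n) \<le> M * w 2"
proof -
  \<comment> \<open>The boundary term is subtracted so that each induction step adds
    \<open>M * (w k - w (Suc k))\<close>, which telescopes.\<close>
  have "cmod ((\<Sum>n=2..N. c n * w n) - (\<Sum>n=2..N. c n) * w N) \<le> M * (w 2 - w N)"
    using N M
  proof (induction N rule: dec_induct)
    case (step k)
    have eq: "(\<Sum>n=2..Suc k. c n * w n) - (\<Sum>n=2..Suc k. c n) * w (Suc k) =
       ((\<Sum>n=2..k. c n * w n) - (\<Sum>n=2..k. c n) * w k) + (\<Sum>n=2..k. c n) * of_real (w k - w (Suc k))"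
    proof -
      have "(\<Sum>n=2..Suc k. g n) = (\<Sum>n=2..k. g n) + g (Suc k)" for g :: "nat \<Rightarrow> complex"
        using step(1) by simp
      thus ?thesis by (simp only: distrib_right right_diff_distrib of_real_diff) simp
    qed
    have "cmod ((\<Sum>n=2..k. c n) * of_real (w k - w (Suc k))) \<le> M * (w k - w (Suc k))"
      unfolding norm_mult norm_of_real using step(1) step.prems[of k] w(1)[of k] by (simp add: mult_right_mono)
    moreover have "cmod ((\<Sum>n=2..k. c n * w n) - (\<Sum>n=2..k. c n) * w k) \<le> M * (w 2 - w k)"
      using step.prems by (intro step.IH) auto
    ultimately show ?case unfolding eq
      by (intro order_trans[OF norm_triangle_ineq]) (simp add: algebra_simps)
  qed simp
  moreover have "cmod ((\<Sum>n=2..N. c n) * w N) \<le> M * w N"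
    unfolding norm_mult norm_of_real using M[of N] w(2)[OF N] N by (simp add: mult_right_mono)
  ultimately show ?thesis
    using norm_triangle_sub[of "\<Sum>n=2..N. c n * w n" "(\<Sum>n=2..N. c n) * w N"]
    by (simp add: algebra_simps)
qed

text \<open>Only powers \<open>p^k\<close> with \<open>k >= 2\<close> contribute, so
  \<open>p <= sqrt x\<close>; each such \<open>p\<close> has at most \<open>ln x / ln p\<close>
  powers up to \<open>x\<close>, which contribute at most \<open>ln x\<close> together.\<close>

lemma sum_mangoldt_nonprime_le:
  assumes x: "x \<ge> 1"
  shows "(\<Sum>n | \<not> prime n \<and> real n \<le> x. mangoldt n) \<le> 8 * x powr (5/8)"
proof -
  define A where "A = {n. (primepow n \<and> \<not> prime n) \<and> real n \<le> x}"
  define P where "P = {p. prime p \<and> real p \<le> sqrt x}"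
  have fin: "finite A" "finite P" unfolding A_def P_def by (rule finite_nat_le_real)+
  have dec: "\<exists>k\<ge>2. n = aprimedivisor n ^ k \<and> prime (aprimedivisor n)" if n: "n \<in> A" for n
  proof -
    obtain p k where pk: "prime p" "k > 0" "n = p ^ k" using n by (auto simp: A_def primepow_def)
    have "k \<noteq> 1" using pk n by (auto simp: A_def)
    moreover have "aprimedivisor n = p" using pk by (simp add: aprimedivisor_prime_power)
    ultimately show ?thesis using pk by (intro exI[of _ k]) auto
  qed
  have "(\<Sum>n | \<not> prime n \<and> real n \<le> x. mangoldt n) = (\<Sum>n\<in>A. ln (real (aprimedivisor n)))"
    unfolding A_def by (rule sum.mono_neutral_cong_right[OF finite_nat_le_real]) (auto simp: mangoldt_def)
  also have "\<dots> = (\<Sum>p\<in>P. \<Sum>n | n \<in> A \<and> aprimedivisor n = p. ln (real (aprimedivisor n)))"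
  proof (rule sum.group[symmetric, OF fin])
    show "aprimedivisor ` A \<subseteq> P"
    proof
      fix p assume "p \<in> aprimedivisor ` A"
      then obtain n where n: "n \<in> A" "p = aprimedivisor n" by blast
      obtain k where k: "k \<ge> 2" "n = p ^ k" "prime p" using dec[OF n(1)] n(2) by auto
      have "p ^ 2 \<le> n" unfolding k(2) using k(1) prime_gt_0_nat[OF k(3)] by (intro power_increasing) auto
      hence "real p ^ 2 \<le> x" using n(1) unfolding A_def by (metis (mono_tags, lifting) mem_Collect_eq of_nat_le_iff of_nat_power order_trans)
      hence "real p \<le> sqrt x" by (rule real_le_rsqrt)
      thus "p \<in> P" using k by (simp add: P_def)
    qed
  qed
  also have "\<dots> \<le> (\<Sum>p\<in>P. ln x)"
  proof (rule sum_mono)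
    fix p assume "p \<in> P"
    hence p: "prime p" by (simp add: P_def)
    have lp: "ln (real p) > 0" using prime_gt_1_nat[OF p] by simp
    define B where "B = {n. n \<in> A \<and> aprimedivisor n = p}"
    have sub: "B \<subseteq> (\<lambda>k. p ^ k) ` {1..nat \<lfloor>ln x / ln (real p)\<rfloor>}"
    proof
      fix n assume n: "n \<in> B"
      then obtain k where k: "k \<ge> 2" "n = p ^ k" using dec[of n] by (auto simp: B_def)
      have "real p ^ k \<le> x" using n k by (auto simp: B_def A_def)
      hence "ln (real p ^ k) \<le> ln x" using prime_gt_0_nat[OF p] by (intro ln_mono) auto
      hence "real k * ln (real p) \<le> ln x" using prime_gt_0_nat[OF p] by (simp add: ln_realpow)
      hence "real k \<le> ln x / ln (real p)" using lp by (simp add: field_simps)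
      thus "n \<in> (\<lambda>k. p ^ k) ` {1..nat \<lfloor>ln x / ln (real p)\<rfloor>}"
        using k by (intro image_eqI[of _ _ k]) (auto simp: le_nat_floor)
    qed
    have "card B \<le> nat \<lfloor>ln x / ln (real p)\<rfloor>"
      using card_mono[OF _ sub] card_image_le[of "{1..nat \<lfloor>ln x / ln (real p)\<rfloor>}" "\<lambda>k. p ^ k"] by simp
    moreover have "ln x / ln (real p) \<ge> 0" using x lp by simp
    ultimately have "real (card B) \<le> ln x / ln (real p)" by linarith
    hence "real (card B) * ln (real p) \<le> ln x" using lp by (simp add: field_simps)
    moreover have "(\<Sum>n\<in>B. ln (real (aprimedivisor n))) = real (card B) * ln (real p)"
      by (simp add: B_def)
    ultimately show "(\<Sum>n | n \<in> A \<and> aprimedivisor n = p. ln (real (aprimedivisor n))) \<le> ln x"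
      by (simp add: B_def)
  qed
  also have "\<dots> = real (card P) * ln x" by simp
  also have "\<dots> \<le> sqrt x * (8 * x powr (1/8))"
  proof (intro mult_mono)
    have "P \<subseteq> {1..nat \<lfloor>sqrt x\<rfloor>}" by (auto simp: P_def le_nat_floor Suc_le_eq prime_gt_0_nat)
    hence "card P \<le> nat \<lfloor>sqrt x\<rfloor>" using card_mono[of "{1..nat \<lfloor>sqrt x\<rfloor>}" P] by simp
    moreover have "sqrt x \<ge> 0" using x by simp
    ultimately show "real (card P) \<le> sqrt x" by linarith
    show "ln x \<le> 8 * x powr (1/8)" using ln_powr_bound[of x "1/8"] x by simp
  qed (use x in auto)
  also have "\<dots> = 8 * x powr (5/8)"
    using x powr_add[of x "1/2" "1/8"] by (simp add: powr_half_sqrt)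
  finally show ?thesis .
qed

text \<open>Serves zeta with \<open>m = 1\<close> and characters with \<open>m = 0\<close>. In
  \<open>B + 9\<close>, 8 pays for the higher prime powers and 1 for the start at
  \<open>n = 2\<close>, which turns \<open>m * k\<close> into \<open>m * (k - 1)\<close>. The
  division by \<open>ln 2\<close> comes from partial summation with the weights
  \<open>1 / ln n\<close>.\<close>

lemma prime_sum_from_psi:
  fixes chi :: "nat \<Rightarrow> complex" and m B :: real
  assumes psi: "\<And>x. x \<ge> 1 \<Longrightarrow> cmod ((psum (\<lambda>n. mangoldt n * chi n) x) - of_real (m * x)) \<le> B * x powr (5/8)"
    and nrm: "\<And>n. cmod (chi n) \<le> 1" and m: "0 \<le> m" "m \<le> 1" and N: "N \<ge> 2"
  shows "cmod (\<Sum>n=2..N. (if prime n then chi n else 0) - of_real (m / ln (real n))) \<le> (B + 9) / ln 2 * real N powr (5/8)"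
proof -
  define c where "c = (\<lambda>n. (if prime n then of_real (ln (real n)) * chi n else 0) - of_real m)"
  have B: "B \<ge> 0" using order_trans[OF norm_ge_zero psi[of 1]] by simp
  have part: "cmod (\<Sum>n=2..k. c n) \<le> (B + 9) * real N powr (5/8)" if k: "2 \<le> k" "k \<le> N" for k
  proof -
    define S where "S = {n. 1 \<le> n \<and> real n \<le> real k}"
    define R where "R = (\<Sum>n | n \<in> S \<and> \<not> prime n. mangoldt n * chi n)"
    have fS: "finite S" unfolding S_def by (rule finite_nat_le_real)
    have S: "S = insert 1 {2..k}" using k by (auto simp: S_def)
    have "(\<Sum>n=2..k. c n) = (\<Sum>n=2..k. if prime n then of_real (ln (real n)) * chi n else 0) - of_real (m * (real k - 1))"
      using k by (simp add: c_def sum_subtractf of_nat_diff algebra_simps)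
    also have "(\<Sum>n=2..k. if prime n then of_real (ln (real n)) * chi n else 0)
        = (\<Sum>n | n \<in> S \<and> prime n. mangoldt n * chi n)"
      by (subst sum.inter_filter[OF fS]) (simp add: S cong: if_cong)
    also have "\<dots> = (\<Sum>n\<in>S. mangoldt n * chi n) - R"
    proof -
      have "(\<Sum>n\<in>S. mangoldt n * chi n) = (\<Sum>n\<in>{n \<in> S. prime n} \<union> {n \<in> S. \<not> prime n}. mangoldt n * chi n)"
        by (rule sum.cong) auto
      also have "\<dots> = (\<Sum>n | n \<in> S \<and> prime n. mangoldt n * chi n) + R"
        unfolding R_def using fS by (intro sum.union_disjoint) auto
      finally show ?thesis by simp
    qed
    finally have eq: "(\<Sum>n=2..k. c n) = ((\<Sum>n\<in>S. mangoldt n * chi n) - of_real (m * real k)) - R + of_real m"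
      by (simp add: algebra_simps)
    have "cmod R \<le> (\<Sum>n | n \<in> S \<and> \<not> prime n. mangoldt n)" unfolding R_def
    proof (rule sum_norm_le)
      fix n show "cmod (mangoldt n * chi n) \<le> mangoldt n"
        using nrm[of n] by (simp add: norm_mult mult_left_le mangoldt_nonneg)
    qed
    also have "\<dots> \<le> (\<Sum>n | \<not> prime n \<and> real n \<le> real k. mangoldt n)"
      by (rule sum_mono2[OF finite_nat_le_real]) (auto simp: S_def mangoldt_nonneg)
    also have "\<dots> \<le> 8 * real k powr (5/8)" using k by (intro sum_mangoldt_nonprime_le) auto
    finally have R: "cmod R \<le> 8 * real k powr (5/8)" .
    have "cmod (\<Sum>n=2..k. c n) \<le> B * real k powr (5/8) + 8 * real k powr (5/8) + 1"
      unfolding eq using psi[of "real k"] k R m by (intro norm_triangle_le3) (auto simp: S_def)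
    also have "1 \<le> real k powr (5/8)" using k by (simp add: ge_one_powr_ge_zero)
    finally have "cmod (\<Sum>n=2..k. c n) \<le> (B + 9) * real k powr (5/8)" by (simp add: algebra_simps)
    also have "\<dots> \<le> (B + 9) * real N powr (5/8)"
      using k B by (intro mult_left_mono powr_mono2) auto
    finally show ?thesis .
  qed
  have "cmod (\<Sum>n=2..N. c n * of_real (1 / ln (real n))) \<le> (B + 9) * real N powr (5/8) * (1 / ln (real 2))"
    by (rule abel_inequality[OF part N]) (auto intro!: divide_left_mono mult_pos_pos)
  also have "(\<Sum>n=2..N. c n * of_real (1 / ln (real n))) = (\<Sum>n=2..N. (if prime n then chi n else 0) - of_real (m / ln (real n)))"
  proof (rule sum.cong)
    fix n assume "n \<in> {2..N}"
    hence "ln (real n) \<noteq> 0" by auto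
    thus "c n * of_real (1 / ln (real n)) = (if prime n then chi n else 0) - of_real (m / ln (real n))"
      by (simp add: c_def field_simps)
  qed simp
  finally show ?thesis by simp
qed

lemma sum_primes_floor:
  fixes f :: "nat \<Rightarrow> 'a::comm_monoid_add"
  shows "(\<Sum>l | prime l \<and> real l \<le> y. f l) = (\<Sum>n=2..nat \<lfloor>y\<rfloor>. if prime n then f n else 0)"
proof -
  have "{l. prime l \<and> real l \<le> y} = {n \<in> {2..nat \<lfloor>y\<rfloor>}. prime n}"
    by (auto simp: prime_ge_2_nat le_nat_floor) (metis le_nat_iff le_floor_iff of_nat_0_le_iff order_trans nat_le_0 not_prime_0 le_0_eq linear of_int_of_nat_eq)
  thus ?thesis by (simp only: sum.inter_filter finite_atLeastAtMost)
qed

text \<open>Packages the uniformity in modulus, character and \<open>y\<close> of a single constant.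
  For \<open>y < 2\<close> the sum is empty and the right side nonnegative, so \<open>y\<close> can
  be left unrestricted. The element \<open>a\<close> witnesses that \<open>chi\<close> is not
  real.\<close>

definition prime_char_sums_le :: "real \<Rightarrow> bool" where
  "prime_char_sums_le C \<longleftrightarrow> C \<ge> 0 \<and>
     (\<forall>q chi a y. dirichlet_character q chi \<longrightarrow> q \<ge> 2 \<longrightarrow> (\<forall>n. cmod (chi n) \<le> 1) \<longrightarrow>
       coprime a q \<longrightarrow> chi a ^ 2 \<noteq> 1 \<longrightarrow>
       cmod (\<Sum>l | prime l \<and> real l \<le> y. chi l) \<le> C * ln (real q) * y powr (5/8))"

lemma prime_char_sums_leD:
  assumes "prime_char_sums_le C" "dirichlet_character q chi" "q \<ge> 2" "\<And>n. cmod (chi n) \<le> 1"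
    "coprime a q" "chi a ^ 2 \<noteq> 1"
  shows "cmod (\<Sum>l | prime l \<and> real l \<le> y. chi l) \<le> C * ln (real q) * y powr (5/8)"
  using assms unfolding prime_char_sums_le_def by blast

lemma prime_char_sum_bound:
  assumes "GRH"
  obtains C where "prime_char_sums_le C"
proof -
  obtain C where C: "C \<ge> 0"
    "\<And>q chi a x. dirichlet_character q chi \<Longrightarrow> q \<ge> 2 \<Longrightarrow> (\<And>n. cmod (chi n) \<le> 1) \<Longrightarrow>
       coprime a q \<Longrightarrow> chi a ^ 2 \<noteq> 1 \<Longrightarrow> x \<ge> 1 \<Longrightarrow>
       cmod (psum (\<lambda>n. mangoldt n * chi n) x) \<le> C * ln (real q) * x powr (5/8)"
    by (fact psi_char_bound[OF assms])
  \<comment> \<open>Since \<open>ln q >= ln 2\<close>, the constant 9 is absorbed as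
    \<open>9 / ln 2 * ln q\<close>.\<close>
  define C' where "C' = (C + 9 / ln 2) / ln 2"
  have C'0: "C' \<ge> 0" using C(1) by (simp add: C'_def)
  show ?thesis
  proof (rule that[of C'], unfold prime_char_sums_le_def, intro conjI C'0 allI impI)
    fix q chi a and y :: real
    assume ch: "dirichlet_character q chi" and q: "q \<ge> 2" and nrm': "\<forall>n. cmod (chi n) \<le> 1"
      and a: "coprime a q" "chi a ^ 2 \<noteq> 1"
    have nrm: "cmod (chi n) \<le> 1" for n using nrm' by blast
    define N where "N = nat \<lfloor>y\<rfloor>"
    have lq: "ln 2 \<le> ln (real q)" using q by simp
    show "cmod (\<Sum>l | prime l \<and> real l \<le> y. chi l) \<le> C' * ln (real q) * y powr (5/8)"
    proof (cases "N \<ge> 2")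
      case True
      have "cmod (\<Sum>n=2..N. (if prime n then chi n else 0) - of_real (0 / ln (real n))) \<le> (C * ln (real q) + 9) / ln 2 * real N powr (5/8)"
        using C(2)[OF ch q nrm a] nrm True by (intro prime_sum_from_psi) auto
      also have "\<dots> \<le> (C * ln (real q) + 9 / ln 2 * ln (real q)) / ln 2 * y powr (5/8)"
      proof (intro mult_mono divide_right_mono add_left_mono powr_mono2)
        show "9 \<le> 9 / ln 2 * ln (real q)" using lq by (simp add: field_simps)
        show "real N \<le> y" using True unfolding N_def by linarith
      qed (use C(1) q in \<open>auto intro!: add_nonneg_nonneg\<close>)
      also have "\<dots> = C' * ln (real q) * y powr (5/8)" by (simp add: C'_def algebra_simps)
      finally show ?thesis unfolding sum_primes_floor N_def[symmetric] by simp
    next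
      case False
      hence "{2..N} = {}" by simp
      thus ?thesis unfolding sum_primes_floor N_def[symmetric] using C'0 q by simp
    qed
  qed
qed

section \<open>Comparison with the logarithmic integral\<close>

lemma inverse_ln_integrable: "2 \<le> a \<Longrightarrow> (\<lambda>t. 1 / ln t) integrable_on {a..b::real}"
  by (rule integrable_continuous_interval) (auto intro!: continuous_intros)

lemma inverse_ln_integral_bounds:
  fixes a b :: real
  assumes ab: "2 \<le> a" "a \<le> b"
  shows "integral {a..b} (\<lambda>t. 1 / ln t) \<le> (b - a) / ln a" "(b - a) / ln b \<le> integral {a..b} (\<lambda>t. 1 / ln t)"
proof -
  have "integral {a..b} (\<lambda>t. 1 / ln t) \<le> integral {a..b} (\<lambda>t. 1 / ln a)"
    using ab by (intro integral_le inverse_ln_integrable) (auto intro!: divide_left_mono mult_pos_pos)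
  thus "integral {a..b} (\<lambda>t. 1 / ln t) \<le> (b - a) / ln a" using ab by simp
  have "integral {a..b} (\<lambda>t. 1 / ln b) \<le> integral {a..b} (\<lambda>t. 1 / ln t)"
    using ab by (intro integral_le inverse_ln_integrable) (auto intro!: divide_left_mono mult_pos_pos)
  thus "(b - a) / ln b \<le> integral {a..b} (\<lambda>t. 1 / ln t)" using ab by simp
qed

lemma sum_inverse_ln_Li:
  assumes y: "y \<ge> 2"
  shows "\<bar>(\<Sum>n=2..nat \<lfloor>y\<rfloor>. 1 / ln (real n)) - Li y\<bar> \<le> 2 / ln 2"
proof -
  define N where "N = nat \<lfloor>y\<rfloor>"
  have N: "N \<ge> 2" "real N \<le> y" "y \<le> real N + 1" using y unfolding N_def by linarith+
  \<comment> \<open>The lower bound retains \<open>1 / ln N\<close> to pay for the next unit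
    integral, which is at most that large. Both bounds are equalities at \<open>N = 2\<close>, where
    \<open>Li\<close> vanishes.\<close>
  have D: "0 \<le> (\<Sum>n=2..N. 1 / ln (real n)) - Li (real N) - 1 / ln (real N)
      \<and> (\<Sum>n=2..N. 1 / ln (real n)) - Li (real N) \<le> 1 / ln 2"
    using N(1)
  proof (induction N rule: dec_induct)
    case (step k)
    have "Li (real (Suc k)) = Li (real k) + integral {real k..real (Suc k)} (\<lambda>t. 1 / ln t)"
      unfolding Li_def using step(1)
      by (intro Henstock_Kurzweil_Integration.integral_combine[symmetric] inverse_ln_integrable) auto
    moreover have "integral {real k..real (Suc k)} (\<lambda>t. 1 / ln t) \<le> 1 / ln (real k)"
       "1 / ln (real (Suc k)) \<le> integral {real k..real (Suc k)} (\<lambda>t. 1 / ln t)"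
      using inverse_ln_integral_bounds[of "real k" "real (Suc k)"] step(1) by auto
    ultimately show ?case using step by simp
  qed (simp add: Li_def)
  have "Li y = Li (real N) + integral {real N..y} (\<lambda>t. 1 / ln t)"
    unfolding Li_def using N
    by (intro Henstock_Kurzweil_Integration.integral_combine[symmetric] inverse_ln_integrable) auto
  moreover have "0 \<le> integral {real N..y} (\<lambda>t. 1 / ln t)"
    using N by (intro integral_nonneg inverse_ln_integrable) auto
  moreover have "integral {real N..y} (\<lambda>t. 1 / ln t) \<le> 1 / ln 2"
  proof -
    have "integral {real N..y} (\<lambda>t. 1 / ln t) \<le> (y - real N) / ln (real N)"
      using N by (intro inverse_ln_integral_bounds) auto
    also have "\<dots> \<le> 1 / ln 2" using N by (intro frac_le) auto
    finally show ?thesis .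
  qed
  moreover have "1 / ln (real N) \<ge> 0" "1 / ln (2::real) \<ge> 0" using N by auto
  ultimately show ?thesis using D unfolding N_def[symmetric] by linarith
qed

lemma prime_count_Li_bound:
  assumes "GRH"
  obtains C where "C \<ge> 0" "\<And>y. \<bar>real (card {l. prime l \<and> real l \<le> y}) - Li y\<bar> \<le> C * y powr (5/8)"
proof -
  obtain B where B: "B \<ge> 0"
    "\<And>x. x \<ge> 1 \<Longrightarrow> \<bar>(psum mangoldt x) - x\<bar> \<le> B * x powr (5/8)"
    by (fact psi_zeta_bound[OF assms])
  define C where "C = (B + 9) / ln 2 + 2 / ln 2"
  have C0: "C \<ge> 0" using B by (simp add: C_def)
  show ?thesis
  proof (rule that[OF C0])
    fix y :: real
    show "\<bar>real (card {l. prime l \<and> real l \<le> y}) - Li y\<bar> \<le> C * y powr (5/8)"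
    proof (cases "y \<ge> 2")
      case True
      define N where "N = nat \<lfloor>y\<rfloor>"
      have N: "N \<ge> 2" "real N \<le> y" using True unfolding N_def by linarith+
      have "cmod (\<Sum>n=2..N. (if prime n then 1 else 0) - of_real (1 / ln (real n))) \<le> (B + 9) / ln 2 * real N powr (5/8)"
      proof (rule prime_sum_from_psi)
        fix x :: real assume x: "x \<ge> 1"
        have "(psum (\<lambda>n. mangoldt n * 1) x) - complex_of_real (1 * x)
            = of_real ((psum mangoldt x) - x)" by simp
        thus "cmod ((psum (\<lambda>n. mangoldt n * 1) x) - complex_of_real (1 * x)) \<le> B * x powr (5/8)"
          using B(2)[OF x] by (simp only: norm_of_real)
      qed (use N in auto)
      also have "(\<Sum>n=2..N. (if prime n then 1 else 0) - of_real (1 / ln (real n))) =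
         complex_of_real (real (card {l. prime l \<and> real l \<le> y}) - (\<Sum>n=2..N. 1 / ln (real n)))"
      proof -
        have "real (card {l. prime l \<and> real l \<le> y}) = (\<Sum>n=2..N. if prime n then 1 else 0)"
          using sum_primes_floor[of "\<lambda>_. 1 :: real" y] by (simp add: N_def)
        hence "real (card {l. prime l \<and> real l \<le> y}) - (\<Sum>n=2..N. 1 / ln (real n))
            = (\<Sum>n=2..N. (if prime n then 1 else 0) - 1 / ln (real n))" by (simp only: sum_subtractf)
        thus ?thesis by (simp only: of_real_sum) (auto intro!: sum.cong)
      qed
      finally have "\<bar>real (card {l. prime l \<and> real l \<le> y}) - (\<Sum>n=2..N. 1 / ln (real n))\<bar> \<le> (B + 9) / ln 2 * real N powr (5/8)"
        unfolding norm_of_real .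
      also have "\<dots> \<le> (B + 9) / ln 2 * y powr (5/8)" using N B by (intro mult_left_mono powr_mono2) auto
      finally have "\<bar>real (card {l. prime l \<and> real l \<le> y}) - (\<Sum>n=2..N. 1 / ln (real n))\<bar> \<le> (B + 9) / ln 2 * y powr (5/8)" .
      moreover have "2 / ln 2 * 1 \<le> 2 / ln 2 * y powr (5/8)"
        using True by (intro mult_left_mono) (auto simp: ge_one_powr_ge_zero)
      ultimately show ?thesis using sum_inverse_ln_Li[OF True] unfolding N_def[symmetric] C_def distrib_right by linarith
    next
      case False
      \<comment> \<open>Below 2 there are no primes, and \<open>Li y\<close> is 0 as an integral
        over an empty interval.\<close>
      have none: "\<not> (prime l \<and> real l \<le> y)" for l
        using False prime_ge_2_nat[of l] by (auto simp: not_le) 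
      have "{l. prime l \<and> real l \<le> y} = {}" using none by simp
      moreover have "{2..y} = {}" using False by simp
      hence "Li y = 0" unfolding Li_def by (simp only: integral_empty)
      ultimately show ?thesis using C0 by (simp only: card.empty) simp
    qed
  qed
qed

section \<open>Characters and primitive roots\<close>

abbreviation unity :: "nat \<Rightarrow> nat \<Rightarrow> complex" where
  "unity a b \<equiv> cis (2 * pi * real a / real b)"

lemma cis_rational_eq_1_iff:
  fixes a b :: nat
  assumes "b > 0"
  shows "unity a b = 1 \<longleftrightarrow> b dvd a"
proof
  assume "unity a b = 1"
  then obtain n :: int where "2 * pi * real a / real b = of_int n * (2 * pi)"
    unfolding cis_conv_exp exp_eq_1 by (auto simp: mult_ac)
  hence "real a = of_int n * real b" using assms by (simp add: field_simps)
  hence "of_int (int a) = (of_int (n * int b) :: real)" by simp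
  hence "int a = n * int b" by (simp only: of_int_eq_iff)
  hence "int b dvd int a" by simp
  thus "b dvd a" by simp
next
  assume "b dvd a"
  then obtain c where "a = b * c" by blast
  hence "2 * pi * real a / real b = 2 * pi * real c" using assms by simp
  thus "unity a b = 1"
    by (metis cis_multiple_2pi Ints_of_nat)
qed

lemma cis_rational_cong:
  fixes a b c :: nat
  assumes b: "b > 0" and ac: "[a = c] (mod b)"
  shows "unity a b = unity c b"
proof -
  have aux: "unity (d + b * k) b = unity d b" for d k
  proof -
    have "2 * pi * real (d + b * k) / real b = 2 * pi * real d / real b + 2 * pi * real (b * k) / real b"
      by (simp add: add_divide_distrib distrib_left)
    hence "unity (d + b * k) b = unity d b * unity (b * k) b"
      by (simp only: cis_mult)
    also have "unity (b * k) b = 1" using b by (subst cis_rational_eq_1_iff) auto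
    finally show ?thesis by simp
  qed
  have "a mod b = c mod b" using ac unfolding unique_euclidean_semiring_class.cong_def .
  hence "unity (a mod b + b * (a div b)) b = unity (c mod b + b * (c div b)) b"
    unfolding aux by simp
  thus ?thesis by simp
qed

lemma sum_roots_of_unity:
  fixes l i :: nat
  assumes l: "l > 0"
  shows "(\<Sum>j=1..<l. unity (j * i) l) = (if l dvd i then of_nat l - 1 else -1)"
proof -
  define z where "z = unity i l"
  have zj: "unity (j * i) l = z ^ j" for j
    unfolding z_def Complex.DeMoivre by (simp add: mult_ac)
  have "(\<Sum>j<l. z ^ j) = (if l dvd i then of_nat l else 0)"
  proof (cases "l dvd i")
    case True
    hence "z = 1" using l by (simp add: z_def cis_rational_eq_1_iff)
    thus ?thesis using True by simp
  next
    case False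
    hence "z \<noteq> 1" using l by (simp add: z_def cis_rational_eq_1_iff)
    moreover have "z ^ l = 1"
      using cis_rational_eq_1_iff[OF l, of "l * i"] unfolding zj[symmetric] by simp
    ultimately show ?thesis using False by (simp add: geometric_sum)
  qed
  moreover have "(\<Sum>j<l. z ^ j) = 1 + (\<Sum>j=1..<l. z ^ j)"
    using l by (simp add: lessThan_atLeast0 sum.atLeast_Suc_lessThan)
  ultimately show ?thesis unfolding zj by (auto simp: algebra_simps add_eq_0_iff)
qed

text \<open>This is the Ramanujan sum of modulus \<open>l\<close> at \<open>i\<close>, divided by
  \<open>- (l - 1)\<close>: it is \<open>-1\<close> if \<open>l\<close> divides \<open>i\<close> and
  \<open>1 / (l - 1)\<close> otherwise. Hence \<open>(1 - 1/l) * (1 + coprime_factor i l)\<close> is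
  the indicator of \<open>l\<close> not dividing \<open>i\<close>.\<close>

definition coprime_factor :: "nat \<Rightarrow> nat \<Rightarrow> complex" where
  "coprime_factor i l = - (1 / (of_nat l - 1)) * (\<Sum>j=1..<l. unity (j * i) l)"

lemma coprime_indicator:
  fixes P i :: nat
  assumes P: "P > 0"
  shows "(if coprime i P then 1 else 0) =
    of_real (real (totient P) / real P) * (\<Sum>X\<in>Pow (prime_factors P). \<Prod>l\<in>X. coprime_factor i l)"
proof -
  define A where "A = prime_factors P"
  have fA: "finite A" by (simp add: A_def)
  have pr: "prime l" if "l \<in> A" for l using that by (auto simp: A_def)
  have fac: "(if l dvd i then 0 else 1) = of_real (1 - 1 / real l) * (1 + coprime_factor i l)" if l: "l \<in> A" for l
  proof -
    have l2: "l \<ge> 2" using pr[OF l] by (rule prime_ge_2_nat)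
    hence nz: "of_nat l - 1 \<noteq> (0 :: complex)" "of_nat l \<noteq> (0 :: complex)"
      using of_nat_eq_1_iff[of l] by auto
    have "coprime_factor i l = - (1 / (of_nat l - 1)) * (if l dvd i then of_nat l - 1 else -1)"
      unfolding coprime_factor_def using l2 by (subst sum_roots_of_unity) auto
    thus ?thesis using nz by (cases "l dvd i") (simp_all add: field_simps)
  qed
  have "coprime i P \<longleftrightarrow> (\<forall>l\<in>A. \<not> l dvd i)"
  proof
    assume "coprime i P"
    show "\<forall>l\<in>A. \<not> l dvd i"
    proof (intro ballI notI)
      fix l assume l: "l \<in> A" "l dvd i"
      have "l dvd P" using l(1) by (simp add: A_def in_prime_factors_iff)
      hence "is_unit l" using coprime_common_divisor[OF \<open>coprime i P\<close> l(2)] by simp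
      thus False using pr[OF l(1)] not_prime_unit by blast
    qed
  next
    assume *: "\<forall>l\<in>A. \<not> l dvd i"
    show "coprime i P"
    proof (rule ccontr)
      assume "\<not> coprime i P"
      hence "gcd i P \<noteq> 1" unfolding coprime_iff_gcd_eq_1 .
      then obtain l where l: "prime l" "l dvd gcd i P" using prime_factor_nat by blast
      hence "l dvd i" "l dvd P" by simp_all
      with l P have "l \<in> A" by (simp add: A_def in_prime_factors_iff)
      thus False using * \<open>l dvd i\<close> by simp
    qed
  qed
  hence "(if coprime i P then 1 else 0) = (\<Prod>l\<in>A. if l dvd i then 0 else (1::complex))"
    using fA by (auto simp: prod_zero_iff)
  also have "\<dots> = (\<Prod>l\<in>A. of_real (1 - 1 / real l) * (1 + coprime_factor i l))"
    by (intro prod.cong refl fac)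
  also have "\<dots> = of_real (\<Prod>l\<in>A. 1 - 1 / real l) * (\<Prod>l\<in>A. coprime_factor i l + 1)"
    by (simp add: prod.distrib add.commute)
  also have "(\<Prod>l\<in>A. 1 - 1 / real l) = real (totient P) / real P"
    using totient_formula2[of P] P unfolding A_def by simp
  also have "(\<Prod>l\<in>A. coprime_factor i l + 1) = (\<Sum>X\<in>Pow A. \<Prod>l\<in>X. coprime_factor i l)"
    by (subst prod_add[OF fA]) simp
  finally show ?thesis unfolding A_def .
qed

section \<open>Discrete logarithms and characters modulo \<open>p\<close>\<close>

locale primitive_root_modulus =
  fixes p g :: nat
  assumes p: "prime p" "odd p" and g: "residue_primroot p g"
begin

definition P :: nat where "P = p - 1"

text \<open>The discrete logarithm to base \<open>g\<close>. It is meaningful only modulo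
  \<open>P\<close>, so its rules are congruences modulo \<open>P\<close>; for \<open>n\<close> not
  coprime to \<open>p\<close> its value is arbitrary and always guarded by a coprimality
  test.\<close>

definition ind :: "nat \<Rightarrow> nat" where "ind n = (SOME i. [g ^ i = n] (mod p))"

lemma p_gt_2: "p > 2"
  using p prime_ge_2_nat[of p] by (cases "p = 2") auto

lemma P_pos: "P > 0" and P_even: "even P"
  using p_gt_2 p by (auto simp: P_def)

lemma g_coprime: "coprime p g" and ord_g: "ord p g = P"
  using g p by (auto simp: residue_primroot_def P_def totient_prime)

lemma ind_cong:
  assumes "coprime n p"
  shows "[g ^ ind n = n] (mod p)"
proof -
  have "n mod p \<in> totatives p"
    using assms p_gt_2 by (auto simp: totatives_def coprime_commute) (metis coprime_mod_left_iff coprime_0_left_iff gr0I not_prime_unit p(1) less_numeral_extra(3) not_less_zero)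
  then obtain i where "n mod p = g ^ i mod p"
    using residue_primroot_is_generator[OF _ g] p_gt_2 unfolding bij_betw_def by force
  hence "[g ^ i = n] (mod p)" by (simp add: unique_euclidean_semiring_class.cong_def)
  thus ?thesis unfolding ind_def by (rule someI)
qed

lemma power_g_cong_iff: "[g ^ i = g ^ j] (mod p) \<longleftrightarrow> [i = j] (mod P)"
  using order_divides_expdiff[OF g_coprime] unfolding ord_g .

lemma ind_mult:
  assumes "coprime m p" "coprime n p"
  shows "[ind (m * n) = ind m + ind n] (mod P)"
proof -
  have "[g ^ ind (m * n) = m * n] (mod p)" using assms by (intro ind_cong) (simp add: coprime_mult_left_iff)
  moreover have "[g ^ ind m * g ^ ind n = m * n] (mod p)" using assms by (intro cong_mult ind_cong)
  ultimately have "[g ^ ind (m * n) = g ^ (ind m + ind n)] (mod p)"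
    by (metis cong_sym cong_trans power_add)
  thus ?thesis by (simp only: power_g_cong_iff)
qed

lemma ind_g: "[ind g = 1] (mod P)"
proof -
  have "[g ^ ind g = g ^ 1] (mod p)" using ind_cong[of g] g_coprime by (simp add: coprime_commute)
  thus ?thesis by (simp only: power_g_cong_iff)
qed

lemma coprime_add_modulus: "coprime (n + p) p \<longleftrightarrow> coprime n p"
  unfolding coprime_iff_gcd_eq_1 by (metis gcd_add1)

lemma ind_periodic:
  assumes "coprime n p"
  shows "[ind (n + p) = ind n] (mod P)"
proof -
  have "[g ^ ind (n + p) = n + p] (mod p)" using assms by (intro ind_cong) (simp only: coprime_add_modulus)
  moreover have "[n + p = n] (mod p)" by (simp add: unique_euclidean_semiring_class.cong_def)
  moreover have "[g ^ ind n = n] (mod p)" using assms by (rule ind_cong)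
  ultimately have "[g ^ ind (n + p) = g ^ ind n] (mod p)" by (metis cong_sym cong_trans)
  thus ?thesis by (simp only: power_g_cong_iff)
qed

text \<open>The order of \<open>g^i\<close> is \<open>P / gcd i P\<close>, which equals
  \<open>P\<close> exactly for \<open>i\<close> coprime to \<open>P\<close>.\<close>

lemma residue_primroot_iff: "residue_primroot p n \<longleftrightarrow> coprime n p \<and> coprime (ind n) P"
proof (cases "coprime n p")
  case True
  have "ord p n = ord p (g ^ ind n)" using ind_cong[OF True] by (intro ord_cong) (rule cong_sym)
  also have "\<dots> = P div gcd (ind n) P" using ord_power[OF g_coprime] by (simp add: ord_g)
  finally have "residue_primroot p n \<longleftrightarrow> P div gcd (ind n) P = P"
    using True p p_gt_2 by (auto simp: residue_primroot_def coprime_commute totient_prime P_def)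
  also have "\<dots> \<longleftrightarrow> gcd (ind n) P = 1"
    using P_pos by (auto simp: div_eq_dividend_iff)
  finally show ?thesis using True unfolding coprime_iff_gcd_eq_1 by simp
next
  case False
  thus ?thesis by (auto simp: residue_primroot_def coprime_commute)
qed

text \<open>\<open>chr 1\<close> generates the group of characters modulo \<open>p\<close>, and
  \<open>chr k\<close> is its \<open>k\<close>-th power.\<close>

definition chr :: "nat \<Rightarrow> nat \<Rightarrow> complex" where
  "chr k n = (if coprime n p then unity (k * ind n) P else 0)"

lemma chr_norm: "cmod (chr k n) \<le> 1"
  by (simp add: chr_def)

lemma chr_mult: "chr k (m * n) = chr k m * chr k n"
proof (cases "coprime m p \<and> coprime n p")
  case True
  have "[k * ind (m * n) = k * (ind m + ind n)] (mod P)"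
    using True by (intro cong_mult ind_mult cong_refl) auto
  hence "unity (k * ind (m * n)) P = unity (k * (ind m + ind n)) P"
    by (rule cis_rational_cong[OF P_pos])
  also have "\<dots> = unity (k * ind m) P * unity (k * ind n) P"
    unfolding cis_mult by (simp add: distrib_left add_divide_distrib)
  finally show ?thesis using True by (simp add: chr_def coprime_mult_left_iff)
next
  case False
  thus ?thesis by (auto simp: chr_def coprime_mult_left_iff)
qed

text \<open>Positivity of \<open>j\<close> matters for \<open>n\<close> not coprime to
  \<open>p\<close>, where a zeroth power is 1 but \<open>chr 0 n = 0\<close>.\<close>

lemma chr_power: "chr k n ^ j = chr (j * k) n" if "j > 0"
  using that by (auto simp: chr_def Complex.DeMoivre mult_ac)

lemma chr_character: "dirichlet_character p (chr k)"
  unfolding dirichlet_character_def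
proof (intro conjI allI)
  show "p > 0" using p_gt_2 by simp
  show "chr k (m * n) = chr k m * chr k n" for m n by (rule chr_mult)
  show "chr k n \<noteq> 0 \<longleftrightarrow> coprime n p" for n by (simp add: chr_def)
  show "chr k (n + p) = chr k n" for n
  proof (cases "coprime n p")
    case True
    have "[k * ind (n + p) = k * ind n] (mod P)"
      using True by (intro cong_mult ind_periodic cong_refl)
    from cis_rational_cong[OF P_pos this] show ?thesis using True by (simp add: chr_def coprime_add_modulus)
  qed (simp add: chr_def coprime_add_modulus)
qed

lemma chr_g_eq_1_iff: "chr k g = 1 \<longleftrightarrow> P dvd k"
proof -
  have "[k * ind g = k * 1] (mod P)" by (intro cong_mult ind_g cong_refl)
  from cis_rational_cong[OF P_pos this] show ?thesis
    using g_coprime cis_rational_eq_1_iff[OF P_pos, of k] by (simp add: chr_def coprime_commute)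
qed

text \<open>\<open>k\<close> is the exponent of the character \<open>n \<mapsto> \<Prod>\<^sub>l e(J\<^sub>l ind(n) / l)\<close>.\<close>
lemma not_dvd_four_mult_exponent:
  assumes X: "finite X" "\<And>l. l \<in> X \<Longrightarrow> prime l \<and> l dvd P" and l0: "l0 \<in> X" "odd l0"
    and J: "\<And>l. l \<in> X \<Longrightarrow> 0 < J l \<and> J l < l"
  shows "\<not> P dvd 4 * (\<Sum>l\<in>X. J l * (P div l))"
proof
  assume dvd: "P dvd 4 * (\<Sum>l\<in>X. J l * (P div l))"
  \<comment> \<open>Multiplication by the other primes of \<open>X\<close> makes every term except
    that of \<open>l0\<close> divisible by \<open>P\<close>. Then \<open>l0\<close> would have to
    divide \<open>4 * m * J l0\<close>, impossible for odd \<open>l0\<close>.\<close>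
  define m where "m = (\<Prod>l\<in>X - {l0}. l)"
  have "P dvd m * (4 * (\<Sum>l\<in>X. J l * (P div l)))" using dvd by simp
  also have "m * (4 * (\<Sum>l\<in>X. J l * (P div l))) = 4 * m * J l0 * (P div l0) + (\<Sum>l\<in>X - {l0}. 4 * m * J l * (P div l))"
    using sum.remove[OF X(1) l0(1), of "\<lambda>l. J l * (P div l)"]
    by (simp add: distrib_left sum_distrib_left mult_ac)
  finally have "P dvd 4 * m * J l0 * (P div l0) + (\<Sum>l\<in>X - {l0}. 4 * m * J l * (P div l))" .
  moreover have "P dvd (\<Sum>l\<in>X - {l0}. 4 * m * J l * (P div l))"
  proof (rule dvd_sum)
    fix l assume l: "l \<in> X - {l0}"
    have "l dvd m" unfolding m_def using X(1) l by (intro dvd_prodI) auto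
    then obtain m' where "m = l * m'" by blast
    moreover have "l * (P div l) = P" using X(2)[of l] l by auto
    ultimately have "4 * m * J l * (P div l) = P * (4 * m' * J l)" by (metis mult.assoc mult.commute)
    thus "P dvd 4 * m * J l * (P div l)" by (rule dvdI)
  qed
  ultimately have "P dvd 4 * m * J l0 * (P div l0)" by (simp add: dvd_add_left_iff)
  moreover have Pl: "P = l0 * (P div l0)" using X(2)[OF l0(1)] by simp
  ultimately have "l0 * (P div l0) dvd (4 * m * J l0) * (P div l0)" by simp
  moreover have "P div l0 > 0" using Pl P_pos by (metis mult_0_right neq0_conv)
  ultimately have "l0 dvd 4 * m * J l0" by (simp add: dvd_times_right_cancel_iff)
  moreover have pr: "prime l0" using X(2)[OF l0(1)] by simp
  ultimately have "l0 dvd 4 \<or> l0 dvd m \<or> l0 dvd J l0" by (simp add: prime_dvd_mult_iff)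
  moreover have "\<not> l0 dvd 4"
  proof
    assume "l0 dvd 4"
    hence "l0 dvd 2 ^ 2" by simp
    hence "l0 dvd 2" using pr prime_dvd_power by blast
    thus False using pr l0(2) primes_dvd_imp_eq two_is_prime_nat by blast
  qed
  moreover have "\<not> l0 dvd m"
  proof
    assume "l0 dvd m"
    then obtain l where "l \<in> X - {l0}" "l0 dvd l"
      unfolding m_def using pr X(1) by (auto simp: prime_dvd_prod_iff)
    thus False using X(2)[of l] pr primes_dvd_imp_eq by auto
  qed
  moreover have "\<not> l0 dvd J l0" using J[OF l0(1)] by (auto dest: dvd_imp_le)
  ultimately show False by blast
qed

text \<open>Squares are the even powers of \<open>g\<close>. Parity of \<open>ind n\<close> is
  meaningful because \<open>P\<close> is even, so congruence modulo \<open>P\<close> preserves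
  it.\<close>

lemma Legendre_eq:
  assumes n: "coprime n p"
  shows "chi2 p n = (if even (ind n) then 1 else -1)"
proof -
  have n0: "\<not> [int n = 0] (mod int p)"
  proof
    assume "[int n = 0] (mod int p)"
    hence "p dvd n" by (simp add: cong_0_iff)
    thus False using n p coprime_common_divisor[of n p p] not_prime_unit by auto
  qed
  have "QuadRes (int p) (int n) \<longleftrightarrow> even (ind n)"
  proof
    assume "even (ind n)"
    then obtain i where i: "ind n = 2 * i" by blast
    have "(g ^ i) ^ 2 = g ^ ind n" by (simp add: i power_mult[symmetric] mult.commute)
    hence "[(g ^ i) ^ 2 = n] (mod p)" using ind_cong[OF n] by simp
    hence "[int ((g ^ i) ^ 2) = int n] (mod int p)" by (simp only: cong_int_iff)
    thus "QuadRes (int p) (int n)" unfolding QuadRes_def by (intro exI[of _ "int (g ^ i)"]) simp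
  next
    assume "QuadRes (int p) (int n)"
    then obtain y where y: "[y ^ 2 = int n] (mod int p)" unfolding QuadRes_def by blast
    \<comment> \<open>\<open>QuadRes\<close> provides an integer root; \<open>ind\<close> needs a
      natural representative.\<close>
    define z where "z = nat (y mod int p)"
    have zy: "int z = y mod int p" using p_gt_2 by (simp add: z_def)
    have "[int z ^ 2 = y ^ 2] (mod int p)" unfolding zy by (intro cong_pow) (simp add: unique_euclidean_semiring_class.cong_def)
    hence "[int (z ^ 2) = int n] (mod int p)" using y by (metis cong_trans of_nat_power)
    hence z2: "[z ^ 2 = n] (mod p)" by (simp only: cong_int_iff)
    hence "coprime (z ^ 2) p" using n cong_imp_coprime cong_sym by blast
    hence cz: "coprime z p" by simp
    have "[g ^ (2 * ind z) = z ^ 2] (mod p)"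
      using cong_pow[OF ind_cong[OF cz], of 2] by (simp add: power_mult mult.commute flip: power_mult)
    hence "[g ^ (2 * ind z) = g ^ ind n] (mod p)" using z2 ind_cong[OF n] by (metis cong_sym cong_trans)
    hence "[2 * ind z = ind n] (mod P)" by (simp only: power_g_cong_iff)
    hence "[2 * ind z = ind n] (mod 2)" using P_even cong_dvd_modulus_nat by blast
    thus "even (ind n)" using cong_dvd_iff by fastforce
  qed
  thus ?thesis using n0 by (simp add: chi2_def Legendre_def)
qed

lemma chi2_not_coprime: "\<not> coprime n p \<Longrightarrow> chi2 p n = 0"
proof -
  assume "\<not> coprime n p"
  hence "p dvd n" using p prime_imp_coprime_nat coprime_commute by blast
  hence "[int n = 0] (mod int p)" by (simp add: cong_0_iff)
  thus ?thesis by (simp add: chi2_def Legendre_def)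
qed

text \<open>The exponent \<open>P / 2\<close> gives \<open>e(ind n / 2)\<close>, a power of
  \<open>-1\<close>. As a \<open>chr\<close>, the Legendre symbol inherits multiplicativity.\<close>

lemma chi2_chr: "of_real (chi2 p n) = chr (P div 2) n"
proof (cases "coprime n p")
  case True
  have "2 * pi * real (P div 2 * ind n) / real P = pi * real (ind n)"
    using P_pos P_even by (auto elim!: evenE)
  hence "chr (P div 2) n = cis (pi * real (ind n))" using True by (simp add: chr_def)
  also have "\<dots> = (-1) ^ ind n" using Complex.DeMoivre[of pi "ind n"] by (simp add: mult.commute)
  finally show ?thesis using Legendre_eq[OF True] by simp
qed (simp add: chr_def chi2_not_coprime)

end

section \<open>Products of a prime square and a prime cube\<close>

text \<open>Bernoulli's inequality \<open>(1 - 1/(16 n))^16 >= 1 - 1/n\<close> bounds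
  \<open>n^(1/16) - (n - 1)^(1/16)\<close> below by \<open>n^(-15/16) / 16\<close>, and these
  differences telescope. The exponent is \<open>- 3/2 * 5/8\<close>.\<close>

lemma sum_powr_le:
  "(\<Sum>n=1..N. real n powr (- 15/16)) \<le> 16 * real N powr (1/16)"
proof (induction N)
  case (Suc N)
  define n where "n = real (Suc N)"
  have n: "n \<ge> 1" by (simp add: n_def)
  have "real N powr (1/16) \<le> n powr (1/16) - n powr (- 15/16) / 16"
  proof -
    have "1 + real 16 * (- 1 / (16 * n)) \<le> (1 + - 1 / (16 * n)) ^ 16"
      using n by (intro Bernoulli_inequality) (simp add: field_simps)
    hence b: "1 - 1 / n \<le> (1 - 1 / (16 * n)) ^ 16" by (simp add: field_simps)
    have u: "0 < 1 - 1 / (16 * n)" using n by (simp add: field_simps)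
    have "real N = n * (1 - 1 / n)" using n by (simp add: n_def field_simps)
    also have "\<dots> \<le> n * (1 - 1 / (16 * n)) ^ 16" using n b by (intro mult_left_mono) auto
    also have "(1 - 1 / (16 * n)) ^ 16 = (1 - 1 / (16 * n)) powr 16" using u by (simp add: powr_numeral)
    finally have "real N powr (1/16) \<le> (n * (1 - 1 / (16 * n)) powr 16) powr (1/16)"
      by (intro powr_mono2) auto
    also have "\<dots> = n powr (1/16) * (1 - 1 / (16 * n))"
    proof -
      have "((1 - 1 / (16 * n)) powr 16) powr (1/16) = 1 - 1 / (16 * n)"
        using u by (simp only: powr_powr) simp
      thus ?thesis by (simp only: powr_mult)
    qed
    also have "\<dots> = n powr (1/16) - n powr (- 15/16) / 16"
    proof -
      have "n powr (1/16) = n * n powr (- 15/16)" using n powr_add[of n 1 "- 15/16"] by simp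
      thus ?thesis using n by (simp add: field_simps)
    qed
    finally show ?thesis .
  qed
  thus ?case using Suc.IH by (simp add: n_def)
qed simp

lemma prod_cis: "finite X \<Longrightarrow> (\<Prod>l\<in>X. cis (f l)) = cis (\<Sum>l\<in>X. f l)"
  by (induction X rule: finite_induct) (simp_all add: cis_mult)

text \<open>For primes \<open>r\<close> and positive \<open>x\<close> the cutoff amounts to
  \<open>y_bound x r >= 1\<close>. Where \<open>y_bound x r < 2\<close>, \<open>q_range x r\<close>
  is empty and \<open>Li\<close> is 0.\<close>

definition r_range :: "real \<Rightarrow> nat set" where
  "r_range x = {r. prime r \<and> real r \<le> x powr (1/3)}"

definition y_bound :: "real \<Rightarrow> nat \<Rightarrow> real" where
  "y_bound x r = x powr (1/2) / real r powr (3/2)"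

definition q_range :: "real \<Rightarrow> nat \<Rightarrow> nat set" where
  "q_range x r = {q. prime q \<and> real q \<le> y_bound x r}"

abbreviation pair_sum :: "real \<Rightarrow> (nat \<Rightarrow> 'a) \<Rightarrow> 'a::comm_monoid_add" where
  "pair_sum x f \<equiv> (\<Sum>r\<in>r_range x. \<Sum>q\<in>q_range x r. f (q ^ 2 * r ^ 3))"

lemma finite_ranges: "finite (r_range x)" "finite (q_range x r)"
  unfolding r_range_def q_range_def by (rule finite_nat_le_real)+

lemma le_y_bound_iff:
  assumes x: "x \<ge> 0" and r: "r > 0"
  shows "real q \<le> y_bound x r \<longleftrightarrow> real (q ^ 2 * r ^ 3) \<le> x"
proof -
  define s where "s = real r powr (3/2)"
  have s: "s > 0" using r by (simp add: s_def)
  have s2: "s ^ 2 = real r ^ 3"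
    using r by (simp add: s_def powr_powr flip: powr_realpow powr_numeral)
  have "real q \<le> y_bound x r \<longleftrightarrow> real q * s \<le> sqrt x"
    using s x by (simp add: y_bound_def s_def powr_half_sqrt pos_le_divide_eq)
  also have "\<dots> \<longleftrightarrow> (real q * s) ^ 2 \<le> x"
    using s by (metis mult_nonneg_nonneg of_nat_0_le_iff less_imp_le real_le_rsqrt real_sqrt_le_iff real_sqrt_unique)
  also have "(real q * s) ^ 2 = real (q ^ 2 * r ^ 3)" by (simp add: power_mult_distrib s2)
  finally show ?thesis .
qed

text \<open>Allows an error of 1 for each \<open>r\<close> to be absorbed into
  \<open>y_bound x r powr (5/8)\<close>.\<close>

lemma y_bound_ge_1:
  assumes "r \<in> r_range x" "x \<ge> 0"
  shows "y_bound x r \<ge> 1"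
proof -
  have r: "r > 0" "real r \<le> x powr (1/3)" using assms by (auto simp: r_range_def prime_gt_0_nat)
  have "real r powr (3/2) \<le> (x powr (1/3)) powr (3/2)" using r by (intro powr_mono2) auto
  also have "\<dots> = x powr (1/2)" by (simp add: powr_powr)
  finally show ?thesis using r by (simp add: y_bound_def)
qed

text \<open>The power \<open>x^(5/16)\<close> comes from \<open>y_bound\<close> and
  \<open>(x^(1/3))^(1/16)\<close> from the sum over \<open>r\<close>;
  \<open>5/16 + 1/48 = 1/3\<close>.\<close>

lemma sum_y_bound_le:
  assumes x: "x \<ge> 1"
  shows "(\<Sum>r\<in>r_range x. y_bound x r powr (5/8)) \<le> 16 * x powr (1/3)"
proof -
  define N where "N = nat \<lfloor>x powr (1/3)\<rfloor>"
  have "y_bound x r powr (5/8) = x powr (5/16) * real r powr (- 15/16)" if "r \<in> r_range x" for r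
  proof -
    have "y_bound x r powr (5/8) = x powr (1/2 * (5/8)) / real r powr (3/2 * (5/8))"
      by (simp only: y_bound_def powr_divide powr_powr)
    also have "\<dots> = x powr (5/16) / real r powr (15/16)" by simp
    also have "\<dots> = x powr (5/16) * real r powr (- (15/16))" by (simp only: powr_minus divide_inverse)
    finally show ?thesis by simp
  qed
  hence "(\<Sum>r\<in>r_range x. y_bound x r powr (5/8)) = x powr (5/16) * (\<Sum>r\<in>r_range x. real r powr (- 15/16))"
    by (simp add: sum_distrib_left)
  also have "\<dots> \<le> x powr (5/16) * (\<Sum>r=1..N. real r powr (- 15/16))"
  proof (intro mult_left_mono sum_mono2)
    show "r_range x \<subseteq> {1..N}"
      by (auto simp: r_range_def N_def le_nat_floor Suc_le_eq prime_gt_0_nat)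
  qed auto
  also have "\<dots> \<le> x powr (5/16) * (16 * (x powr (1/3)) powr (1/16))"
  proof (intro mult_left_mono)
    have "real N \<le> x powr (1/3)" unfolding N_def by (simp add: of_nat_floor)
    hence "16 * real N powr (1/16) \<le> 16 * (x powr (1/3)) powr (1/16)"
      by (intro mult_left_mono powr_mono2) auto
    thus "(\<Sum>r=1..N. real r powr (- 15/16)) \<le> 16 * (x powr (1/3)) powr (1/16)"
      using sum_powr_le[of N] by linarith
  qed auto
  also have "\<dots> = 16 * (x powr (5/16) * x powr (1/48))" by (simp add: powr_powr)
  also have "x powr (5/16) * x powr (1/48) = x powr (1/3)" by (simp flip: powr_add)
  finally show ?thesis .
qed

text \<open>Each of \<open>q\<close>, \<open>r\<close> is one of \<open>q'\<close>,
  \<open>r'\<close>. In the crossed case \<open>q = r'\<close> cancellation leaves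
  \<open>r^3 = q'^2 * q\<close>, and either value of \<open>r\<close> forces \<open>q = q'\<close>.
  The case \<open>q = r\<close>, a fifth power, is included.\<close>

lemma prime_square_cube_inj:
  fixes q r q' r' :: nat
  assumes pr: "prime q" "prime r" "prime q'" "prime r'" and eq: "q ^ 2 * r ^ 3 = q' ^ 2 * r' ^ 3"
  shows "q = q' \<and> r = r'"
proof -
  have pos: "q > 0" "r > 0" "q' > 0" "r' > 0" using pr by (auto simp: prime_gt_0_nat)
  have qd: "q dvd q' ^ 2 * r' ^ 3" using eq by (metis dvd_mult2 dvd_power zero_less_numeral)
  have rd: "r dvd q' ^ 2 * r' ^ 3" using eq by (metis dvd_mult dvd_power zero_less_numeral)
  have or: "q = q' \<or> q = r'" "r = q' \<or> r = r'"
    using qd rd pr by (auto simp: prime_dvd_mult_iff prime_dvd_power_iff primes_dvd_imp_eq)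
  have pw: "a = b" if "a ^ 2 = b ^ 2" for a b :: nat using that by (simp add: power_eq_iff_eq_base)
  have pw3: "a = b" if "a ^ 3 = b ^ 3" for a b :: nat using that by (simp add: power_eq_iff_eq_base)
  show ?thesis
  proof (cases "q = q'")
    case True
    hence "r ^ 3 = r' ^ 3" using eq pos by simp
    thus ?thesis using True pw3 by blast
  next
    case False
    hence qr: "q = r'" using or by blast
    hence "r ^ 3 = q' ^ 2 * q" using eq pos by (simp add: power2_eq_square power3_eq_cube)
    show ?thesis
    proof (cases "r = q'")
      case True
      hence "q' = q" using \<open>r ^ 3 = q' ^ 2 * q\<close> pos by (simp add: power2_eq_square power3_eq_cube)
      thus ?thesis using False by simp
    next
      case rf: False
      hence "r = q" using or qr by blast
      hence "q ^ 2 = q' ^ 2" using \<open>r ^ 3 = q' ^ 2 * q\<close> pos by (simp add: power2_eq_square power3_eq_cube)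
      thus ?thesis using False pw by blast
    qed
  qed
qed

lemma bij_betw_set_S:
  assumes x: "x \<ge> 0"
  shows "bij_betw (\<lambda>(r, q). q ^ 2 * r ^ 3) (Sigma (r_range x) (q_range x)) {n \<in> set_S. real n \<le> x}"
  unfolding bij_betw_def
proof
  show "inj_on (\<lambda>(r, q). q ^ 2 * r ^ 3) (Sigma (r_range x) (q_range x))"
  proof (rule inj_onI)
    fix z w assume zw: "z \<in> Sigma (r_range x) (q_range x)" "w \<in> Sigma (r_range x) (q_range x)"
      "(case z of (r, q) \<Rightarrow> q ^ 2 * r ^ 3) = (case w of (r, q) \<Rightarrow> q ^ 2 * r ^ 3)"
    obtain r q r' q' where z: "z = (r, q)" "w = (r', q')" by (cases z, cases w)
    have "q = q' \<and> r = r'"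
      using zw unfolding z by (intro prime_square_cube_inj) (simp_all add: r_range_def q_range_def)
    thus "z = w" by (simp add: z)
  qed
  show "(\<lambda>(r, q). q ^ 2 * r ^ 3) ` Sigma (r_range x) (q_range x) = {n \<in> set_S. real n \<le> x}"
  proof (intro equalityI subsetI)
    fix n assume "n \<in> (\<lambda>(r, q). q ^ 2 * r ^ 3) ` Sigma (r_range x) (q_range x)"
    then obtain r q where "r \<in> r_range x" "q \<in> q_range x r" and n: "n = q ^ 2 * r ^ 3" by auto
    hence "prime r" "prime q" "real q \<le> y_bound x r" by (auto simp: r_range_def q_range_def)
    thus "n \<in> {n \<in> set_S. real n \<le> x}"
      using le_y_bound_iff[OF x prime_gt_0_nat[of r]] n by (auto simp: set_S_def)
  next
    fix n assume "n \<in> {n \<in> set_S. real n \<le> x}"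
    then obtain q r where qr: "prime q" "prime r" and n: "n = q ^ 2 * r ^ 3" "real n \<le> x" by (auto simp: set_S_def)
    have r0: "r > 0" "q > 0" using qr by (auto simp: prime_gt_0_nat)
    have q: "q \<in> q_range x r" using le_y_bound_iff[OF x r0(1), of q] n qr by (simp add: q_range_def)
    have "1 * r ^ 3 \<le> q ^ 2 * r ^ 3" using r0 by (intro mult_right_mono) auto
    hence "real (r ^ 3) \<le> x" using n by (metis mult_1 of_nat_mono order_trans)
    hence "(real r powr 3) powr (1/3) \<le> x powr (1/3)" using r0 by (intro powr_mono2) (auto simp: powr_numeral)
    hence "real r powr (3 * (1/3)) \<le> x powr (1/3)" by (simp only: powr_powr)
    hence "r \<in> r_range x" using r0 qr by (simp add: r_range_def)
    thus "n \<in> (\<lambda>(r, q). q ^ 2 * r ^ 3) ` Sigma (r_range x) (q_range x)"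
      using q n by (intro image_eqI[of _ _ "(r, q)"]) auto
  qed
qed

lemma N_S_eq_sum:
  assumes x: "x \<ge> 0"
  shows "real (N_S p x) = (\<Sum>r\<in>r_range x. \<Sum>q\<in>q_range x r. if residue_primroot p (q ^ 2 * r ^ 3) then 1 else 0)"
proof -
  define S where "S = {n \<in> set_S. real n \<le> x}"
  have fS: "finite S" unfolding S_def by (rule finite_nat_le_real[of "\<lambda>n. n \<in> set_S"])
  have "{n \<in> set_S. real n \<le> x \<and> residue_primroot p n} = {n \<in> S. residue_primroot p n}" by (auto simp: S_def)
  hence "real (N_S p x) = (\<Sum>n\<in>S. if residue_primroot p n then 1 else 0)"
    unfolding N_S_def using sum.inter_filter[OF fS, of "\<lambda>_. 1 :: real" "residue_primroot p"] by simp
  also have "\<dots> = (\<Sum>(r, q)\<in>Sigma (r_range x) (q_range x). if residue_primroot p (q ^ 2 * r ^ 3) then 1 else 0)"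
    using sum.reindex_bij_betw[OF bij_betw_set_S[OF x], of "\<lambda>n. if residue_primroot p n then 1 else (0::real)"]
    by (simp add: S_def case_prod_beta)
  also have "\<dots> = (\<Sum>r\<in>r_range x. \<Sum>q\<in>q_range x r. if residue_primroot p (q ^ 2 * r ^ 3) then 1 else 0)"
    using finite_ranges by (subst sum.Sigma) auto
  finally show ?thesis .
qed

section \<open>Expansion of the count over sets of primes dividing \<open>p - 1\<close>\<close>

context primitive_root_modulus
begin

text \<open>The term of \<open>X\<close> in the expanded product, set to 0 where \<open>ind\<close>
  has no meaning.\<close>

definition T :: "nat set \<Rightarrow> nat \<Rightarrow> complex" where
  "T X n = (if coprime n p then \<Prod>l\<in>X. coprime_factor (ind n) l else 0)"

lemma primroot_indicator:
  "(if residue_primroot p n then 1 else 0) =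
     of_real (real (totient P) / real P) * (\<Sum>X\<in>Pow (prime_factors P). T X n)"
proof (cases "coprime n p")
  case True
  thus ?thesis using coprime_indicator[OF P_pos, of "ind n"] by (simp add: T_def residue_primroot_iff)
qed (simp add: T_def residue_primroot_iff)

text \<open>Multiplying out means choosing some \<open>J l\<close> in \<open>{1..<l}\<close> for
  each \<open>l\<close> in \<open>X\<close>. Over the common denominator \<open>P\<close>, the
  product of the \<open>e(J l * ind n / l)\<close> becomes a single character.\<close>

lemma T_eq_sum_chr:
  assumes X: "X \<subseteq> prime_factors P"
  shows "T X n = (\<Prod>l\<in>X. - (1 / (of_nat l - 1))) *
     (\<Sum>J\<in>PiE X (\<lambda>l. {1..<l}). chr (\<Sum>l\<in>X. J l * (P div l)) n)"
proof (cases "coprime n p")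
  case True
  have fX: "finite X" using X by (rule finite_subset) simp
  have "(\<Prod>l\<in>X. coprime_factor (ind n) l) = (\<Prod>l\<in>X. - (1 / (of_nat l - 1))) *
      (\<Prod>l\<in>X. \<Sum>j\<in>{1..<l}. unity (j * ind n) l)"
    by (simp only: coprime_factor_def prod.distrib)
  also have "(\<Prod>l\<in>X. \<Sum>j\<in>{1..<l}. unity (j * ind n) l)
      = (\<Sum>J\<in>PiE X (\<lambda>l. {1..<l}). \<Prod>l\<in>X. unity (J l * ind n) l)"
    by (rule prod_sum_PiE) (use fX in auto)
  also have "\<dots> = (\<Sum>J\<in>PiE X (\<lambda>l. {1..<l}). chr (\<Sum>l\<in>X. J l * (P div l)) n)"
  proof (rule sum.cong)
    fix J
    have "2 * pi * real (J l * ind n) / real l = 2 * pi * real (J l * (P div l) * ind n) / real P" if "l \<in> X" for l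
    proof -
      have "l dvd P" "l > 0" using X that by (auto simp: in_prime_factors_iff prime_gt_0_nat)
      hence "real (P div l) = real P / real l" by (simp add: real_of_nat_div)
      thus ?thesis using P_pos \<open>l > 0\<close> by (simp add: field_simps)
    qed
    hence "(\<Prod>l\<in>X. unity (J l * ind n) l) = (\<Prod>l\<in>X. unity (J l * (P div l) * ind n) P)"
      by (intro prod.cong) auto
    also have "\<dots> = cis (\<Sum>l\<in>X. 2 * pi * real (J l * (P div l) * ind n) / real P)" by (rule prod_cis[OF fX])
    also have "(\<Sum>l\<in>X. 2 * pi * real (J l * (P div l) * ind n) / real P) = 2 * pi * real ((\<Sum>l\<in>X. J l * (P div l)) * ind n) / real P"
      by (simp add: sum_distrib_left sum_distrib_right sum_divide_distrib)
    finally show "(\<Prod>l\<in>X. unity (J l * ind n) l) = chr (\<Sum>l\<in>X. J l * (P div l)) n"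
      using True by (simp add: chr_def)
  qed simp
  finally show ?thesis using True by (simp add: T_def)
qed (simp add: T_def chr_def)

lemma T_empty: "T {} n = of_real (chi0 p n)"
  by (simp add: T_def chi0_def)

lemma T_two: "T {2} n = - of_real (chi2 p n)"
proof (cases "coprime n p")
  case True
  have "{1..<2::nat} = {1}" by auto
  hence "coprime_factor (ind n) 2 = - unity (1 * ind n) 2" by (simp add: coprime_factor_def)
  moreover have "2 * pi * real (1 * ind n) / real 2 = 2 * pi * real (P div 2 * ind n) / real P"
    using P_pos P_even by (auto elim!: evenE)
  ultimately show ?thesis using True chi2_chr[of n] by (simp only: T_def chr_def) simp
qed (simp add: T_def chi2_not_coprime)

text \<open>\<open>chr k\<close> at \<open>q^2 r^3\<close> is \<open>chr (2 k) q\<close> times a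
  factor depending on \<open>r\<close> alone. The square of \<open>chr (2 k)\<close> at
  \<open>g\<close> is \<open>chr (4 k) g\<close>, which the hypothesis makes different from 1, so
  \<open>g\<close> is the witness required by \<open>prime_char_sums_le\<close>.\<close>

lemma character_double_sum_bound:
  assumes C: "prime_char_sums_le C"
    and k: "\<not> P dvd 4 * k" and x: "x \<ge> 1"
  shows "cmod (pair_sum x (chr k)) \<le> 16 * C * ln (real p) * x powr (1/3)"
proof -
  have C0: "C \<ge> 0" using C by (simp add: prime_char_sums_le_def)
  have g4: "chr (2 * k) g ^ 2 \<noteq> 1"
    using k chr_g_eq_1_iff[of "4 * k"] by (subst chr_power) auto
  have "cmod (pair_sum x (chr k)) \<le> (\<Sum>r\<in>r_range x. C * ln (real p) * y_bound x r powr (5/8))"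
  proof (rule sum_norm_le)
    fix r
    have "(\<Sum>q\<in>q_range x r. chr k (q ^ 2 * r ^ 3)) = (\<Sum>q\<in>q_range x r. chr (2 * k) q * chr k (r ^ 3))"
      by (intro sum.cong refl) (simp add: chr_mult power2_eq_square flip: chr_power)
    also have "\<dots> = (\<Sum>q\<in>q_range x r. chr (2 * k) q) * chr k (r ^ 3)" by (simp add: sum_distrib_right)
    also have "cmod \<dots> \<le> (C * ln (real p) * y_bound x r powr (5/8)) * 1"
      unfolding norm_mult q_range_def
      using p_gt_2 g_coprime g4 C0
      by (intro mult_mono prime_char_sums_leD[OF C, where a = g] chr_norm chr_character) (auto simp: coprime_commute)
    finally show "cmod (\<Sum>q\<in>q_range x r. chr k (q ^ 2 * r ^ 3)) \<le> C * ln (real p) * y_bound x r powr (5/8)" by simp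
  qed
  also have "\<dots> = C * ln (real p) * (\<Sum>r\<in>r_range x. y_bound x r powr (5/8))" by (simp add: sum_distrib_left)
  also have "\<dots> \<le> C * ln (real p) * (16 * x powr (1/3))"
    using C0 p_gt_2 by (intro mult_left_mono sum_y_bound_le x) auto
  finally show ?thesis by (simp add: mult_ac)
qed

lemma T_double_sum_bound:
  assumes C: "prime_char_sums_le C"
    and X: "X \<subseteq> prime_factors P" "l0 \<in> X" "odd l0" and x: "x \<ge> 1"
  shows "cmod (pair_sum x (T X)) \<le> 16 * C * ln (real p) * x powr (1/3)"
proof -
  define w where "w = (\<Prod>l\<in>X. - (1 / (of_nat l - 1)) :: complex)"
  define JJ where "JJ = PiE X (\<lambda>l. {1..<l})"
  define M where "M = 16 * C * ln (real p) * x powr (1/3)"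
  have fX: "finite X" using X(1) by (rule finite_subset) simp
  have pr: "prime l \<and> l dvd P" if "l \<in> X" for l using X(1) that by (auto simp: in_prime_factors_iff)
  have fJ: "finite JJ" unfolding JJ_def using fX by (intro finite_PiE) auto
  \<comment> \<open>The weights \<open>1 / (l - 1)\<close> exactly cancel the number of choices of
    \<open>J\<close>, so the bound does not grow with \<open>X\<close>.\<close>
  have wJ: "cmod w * real (card JJ) = 1"
  proof -
    have l1: "real (l - 1) = real l - 1" "real l > 1" if "l \<in> X" for l
      using pr[OF that] prime_gt_1_nat[of l] by (auto simp: of_nat_diff)
    have "cmod w = (\<Prod>l\<in>X. 1 / real (l - 1))"
      unfolding w_def prod_norm[symmetric]
    proof (rule prod.cong)
      fix l assume "l \<in> X"
      hence "l \<ge> 1" using l1(2)[of l] by simp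
      hence "of_nat l - 1 = complex_of_real (real (l - 1))" by (simp add: of_nat_diff)
      thus "cmod (- (1 / (of_nat l - 1))) = 1 / real (l - 1)"
        by (simp only: norm_minus_cancel norm_divide norm_of_real norm_one abs_of_nat)
    qed simp
    moreover have "real (card JJ) = (\<Prod>l\<in>X. real (l - 1))"
      unfolding JJ_def using fX by (simp add: card_PiE)
    ultimately have "cmod w * real (card JJ) = (\<Prod>l\<in>X. 1 / real (l - 1) * real (l - 1))"
      by (simp only: prod.distrib)
    also have "\<dots> = 1" using l1 by (intro prod.neutral) auto
    finally show ?thesis .
  qed
  define k where "k = (\<lambda>J. \<Sum>l\<in>X. J l * (P div l))"
  have "pair_sum x (T X)
      = (\<Sum>r\<in>r_range x. \<Sum>q\<in>q_range x r. \<Sum>J\<in>JJ. w * chr (k J) (q ^ 2 * r ^ 3))"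
    unfolding T_eq_sum_chr[OF X(1)] w_def JJ_def k_def by (simp only: sum_distrib_left)
  also have "\<dots> = (\<Sum>r\<in>r_range x. \<Sum>J\<in>JJ. \<Sum>q\<in>q_range x r. w * chr (k J) (q ^ 2 * r ^ 3))"
    by (intro sum.cong refl sum.swap)
  also have "\<dots> = (\<Sum>J\<in>JJ. \<Sum>r\<in>r_range x. \<Sum>q\<in>q_range x r. w * chr (k J) (q ^ 2 * r ^ 3))"
    by (rule sum.swap)
  also have "\<dots> = w * (\<Sum>J\<in>JJ. \<Sum>r\<in>r_range x. \<Sum>q\<in>q_range x r. chr (k J) (q ^ 2 * r ^ 3))"
    by (simp only: sum_distrib_left)
  also have "cmod \<dots> \<le> cmod w * (real (card JJ) * M)"
    unfolding norm_mult
  proof (intro mult_left_mono sum_norm_bound)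
    fix J assume J: "J \<in> JJ"
    have "\<not> P dvd 4 * k J" unfolding k_def
      by (rule not_dvd_four_mult_exponent[OF fX pr X(2,3)]) (use J in \<open>auto simp: JJ_def PiE_def Pi_def Suc_le_eq\<close>)
    thus "cmod (pair_sum x (chr (k J))) \<le> M"
      unfolding M_def by (intro character_double_sum_bound[OF C _ x])
  qed auto
  also have "\<dots> = M" using wJ by (simp flip: mult.assoc)
  finally show ?thesis unfolding M_def .
qed

text \<open>The even exponent turns \<open>chi2 p q\<close> into \<open>chi0 p q\<close>, the odd
  one leaves \<open>chi2 p r\<close>. Thus the inner sum of the main term counts the primes
  \<open>q\<close> other than \<open>p\<close>.\<close>

lemma chi_sums:
  "chi0 p (q ^ 2 * r ^ 3) - chi2 p (q ^ 2 * r ^ 3) = chi0 p q * (chi0 p r - chi2 p r)"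
proof -
  have c2: "chi2 p n = (if coprime n p then (if even (ind n) then 1 else -1) else 0)" for n
    using Legendre_eq chi2_not_coprime by simp
  have mult: "chi2 p (a * b) = chi2 p a * chi2 p b" for a b
  proof -
    have "complex_of_real (chi2 p (a * b)) = of_real (chi2 p a * chi2 p b)"
      by (simp add: chi2_chr chr_mult)
    thus ?thesis by (simp only: of_real_eq_iff)
  qed
  have "chi2 p (q ^ 2 * r ^ 3) = chi2 p q ^ 2 * chi2 p r ^ 3"
    by (simp add: mult power2_eq_square power3_eq_cube)
  also have "chi2 p q ^ 2 = chi0 p q" by (simp add: c2 chi0_def)
  also have "chi2 p r ^ 3 = chi2 p r" by (simp add: c2)
  finally have "chi2 p (q ^ 2 * r ^ 3) = chi0 p q * chi2 p r" .
  moreover have "chi0 p (q ^ 2 * r ^ 3) = chi0 p q * chi0 p r"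
    by (simp add: chi0_def coprime_mult_left_iff)
  ultimately show ?thesis by (simp add: right_diff_distrib)
qed

lemma main_term_bound:
  assumes C: "C \<ge> 0" "\<And>y. \<bar>real (card {l. prime l \<and> real l \<le> y}) - Li y\<bar> \<le> C * y powr (5/8)"
    and x: "x \<ge> 1"
  shows "\<bar>pair_sum x (\<lambda>n. chi0 p n - chi2 p n)
     - (\<Sum>r\<in>r_range x. (chi0 p r - chi2 p r) * Li (y_bound x r))\<bar> \<le> 32 * (C + 1) * x powr (1/3)"
proof -
  have "pair_sum x (\<lambda>n. chi0 p n - chi2 p n)
     - (\<Sum>r\<in>r_range x. (chi0 p r - chi2 p r) * Li (y_bound x r))
     = (\<Sum>r\<in>r_range x. (chi0 p r - chi2 p r) * ((\<Sum>q\<in>q_range x r. chi0 p q) - Li (y_bound x r)))"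
    unfolding chi_sums sum_subtractf[symmetric] sum_distrib_right[symmetric]
    by (intro sum.cong refl) (simp add: right_diff_distrib mult.commute)
  also have "\<bar>\<dots>\<bar> \<le> (\<Sum>r\<in>r_range x. 2 * (C + 1) * y_bound x r powr (5/8))"
  proof (rule order_trans[OF sum_abs], rule sum_mono)
    fix r assume r: "r \<in> r_range x"
    define Q where "Q = q_range x r"
    have fQ: "finite Q" by (simp add: Q_def finite_ranges)
    have c: "chi0 p q = (if q = p then 0 else 1)" if "q \<in> Q" for q
      using that p primes_coprime[of q p] by (auto simp: chi0_def Q_def q_range_def not_prime_unit)
    have "(\<Sum>q\<in>Q. chi0 p q) = (\<Sum>q\<in>Q. 1 - (if q = p then 1 else 0))" using c by (intro sum.cong) auto
    also have "\<dots> = real (card Q) - (if p \<in> Q then 1 else 0)" using fQ by (simp add: sum_subtractf)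
    \<comment> \<open>Only the prime \<open>q = p\<close> can be lost; this is the 1 in
      \<open>C + 1\<close>.\<close>
    finally have "\<bar>(\<Sum>q\<in>Q. chi0 p q) - real (card Q)\<bar> \<le> 1" by auto
    moreover have "\<bar>real (card Q) - Li (y_bound x r)\<bar> \<le> C * y_bound x r powr (5/8)"
      unfolding Q_def q_range_def by (rule C(2))
    moreover have "1 \<le> y_bound x r powr (5/8)" using y_bound_ge_1[OF r] x by (simp add: ge_one_powr_ge_zero)
    ultimately have b: "\<bar>(\<Sum>q\<in>Q. chi0 p q) - Li (y_bound x r)\<bar> \<le> (C + 1) * y_bound x r powr (5/8)"
      by (simp add: distrib_right)
    have "\<bar>chi0 p r - chi2 p r\<bar> \<le> 2" by (auto simp: chi0_def chi2_def Legendre_def)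
    hence "\<bar>chi0 p r - chi2 p r\<bar> * \<bar>(\<Sum>q\<in>Q. chi0 p q) - Li (y_bound x r)\<bar> \<le> 2 * ((C + 1) * y_bound x r powr (5/8))"
      using b by (intro mult_mono) auto
    thus "\<bar>(chi0 p r - chi2 p r) * ((\<Sum>q\<in>q_range x r. chi0 p q) - Li (y_bound x r))\<bar> \<le> 2 * (C + 1) * y_bound x r powr (5/8)"
      by (simp only: abs_mult Q_def mult.assoc)
  qed
  also have "\<dots> = 2 * (C + 1) * (\<Sum>r\<in>r_range x. y_bound x r powr (5/8))" by (simp add: sum_distrib_left)
  also have "\<dots> \<le> 2 * (C + 1) * (16 * x powr (1/3))" using C(1) by (intro mult_left_mono sum_y_bound_le x) auto
  also have "\<dots> = 32 * (C + 1) * x powr (1/3)" by simp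
  finally show ?thesis .
qed

text \<open>\<open>E\<close> is defined by dividing out the density \<open>totient P / P\<close>.
  Its first part compares the contribution of \<open>{}\<close> and \<open>{2}\<close> with
  \<open>Li\<close>; the second allows one character bound for each remaining set.\<close>

lemma N_S_asymptotic:
  assumes C1: "prime_char_sums_le C1"
    and C2: "C2 \<ge> 0" "\<And>y. \<bar>real (card {l. prime l \<and> real l \<le> y}) - Li y\<bar> \<le> C2 * y powr (5/8)"
    and x: "x \<ge> 1"
  obtains E where "\<bar>E\<bar> \<le> 32 * (C2 + 1) * x powr (1/3) + 2 ^ card (prime_factors P) * (16 * C1 * ln (real p) * x powr (1/3))"
    "real (N_S p x) = real (totient P) / real P * ((\<Sum>r\<in>r_range x. (chi0 p r - chi2 p r) * Li (y_bound x r)) + E)"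
proof -
  define M where "M = 16 * C1 * ln (real p) * x powr (1/3)"
  define S where "S = (\<lambda>X. \<Sum>r\<in>r_range x. \<Sum>q\<in>q_range x r. T X (q ^ 2 * r ^ 3))"
  define A where "A = prime_factors P"
  define main where "main = (\<Sum>r\<in>r_range x. (chi0 p r - chi2 p r) * Li (y_bound x r))"
  define E0 where "E0 = pair_sum x (\<lambda>n. chi0 p n - chi2 p n)"
  have fA: "finite A" by (simp add: A_def)
  have M0: "M \<ge> 0" using C1 p_gt_2 by (simp add: M_def prime_char_sums_le_def)
  have two: "2 \<in> A" using P_even P_pos by (simp add: A_def in_prime_factors_iff)
  define c where "c = real (totient P) / real P"
  have c0: "c > 0" using P_pos by (simp add: c_def)
  have "complex_of_real (real (N_S p x)) = (\<Sum>r\<in>r_range x. \<Sum>q\<in>q_range x r. if residue_primroot p (q ^ 2 * r ^ 3) then 1 else 0)"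
    using x by (subst N_S_eq_sum) (auto intro!: sum.cong)
  also have "\<dots> = (\<Sum>r\<in>r_range x. \<Sum>q\<in>q_range x r. \<Sum>X\<in>Pow A. of_real c * T X (q ^ 2 * r ^ 3))"
    unfolding primroot_indicator c_def A_def by (simp only: sum_distrib_left)
  also have "\<dots> = (\<Sum>r\<in>r_range x. \<Sum>X\<in>Pow A. \<Sum>q\<in>q_range x r. of_real c * T X (q ^ 2 * r ^ 3))"
    by (intro sum.cong refl sum.swap)
  also have "\<dots> = (\<Sum>X\<in>Pow A. \<Sum>r\<in>r_range x. \<Sum>q\<in>q_range x r. of_real c * T X (q ^ 2 * r ^ 3))"
    by (rule sum.swap)
  also have "\<dots> = of_real c * (\<Sum>X\<in>Pow A. S X)"
    by (simp only: sum_distrib_left S_def)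
  finally have N: "complex_of_real (real (N_S p x)) = of_real c * (\<Sum>X\<in>Pow A. S X)" .
  \<comment> \<open>Every member contains an odd prime, being a set of primes not contained in
    \<open>{2}\<close>.\<close>
  define B where "B = Pow A - {{}, {2}}"
  have Bfin: "finite B" using fA by (simp add: B_def)
  have "(\<Sum>X\<in>Pow A. S X) = (\<Sum>X\<in>{{}, {2}}. S X) + (\<Sum>X\<in>B. S X)"
    unfolding B_def using fA two by (intro sum.subset_diff[THEN trans, OF _ _ add.commute]) auto
  also have "(\<Sum>X\<in>{{}, {2}}. S X) = of_real E0"
    by (simp add: S_def E0_def T_empty T_two sum_subtractf sum_negf)
  finally have split: "(\<Sum>X\<in>Pow A. S X) = of_real E0 + (\<Sum>X\<in>B. S X)" .
  have SB: "cmod (\<Sum>X\<in>B. S X) \<le> 2 ^ card A * M"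
  proof -
    have "cmod (\<Sum>X\<in>B. S X) \<le> real (card B) * M"
    proof (rule sum_norm_bound)
      fix X assume X: "X \<in> B"
      hence sub: "X \<subseteq> A" and ne: "X \<noteq> {}" "X \<noteq> {2}" by (auto simp: B_def)
      have "\<not> X \<subseteq> {2}" using ne subset_singletonD by metis
      then obtain l where l: "l \<in> X" "l \<noteq> 2" by blast
      hence "prime l" using sub by (auto simp: A_def)
      hence "odd l" using l(2) primes_dvd_imp_eq two_is_prime_nat by blast
      thus "cmod (S X) \<le> M" unfolding S_def M_def
        by (intro T_double_sum_bound[OF C1 sub[unfolded A_def] l(1) _ x])
    qed
    also have "card B \<le> card (Pow A)" using fA by (intro card_mono) (auto simp: B_def)
    hence "real (card B) * M \<le> 2 ^ card A * M" using fA M0 by (intro mult_right_mono) (simp_all add: card_Pow)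
    finally show ?thesis .
  qed
  define E where "E = real (N_S p x) / c - main"
  have "complex_of_real E = of_real (E0 - main) + (\<Sum>X\<in>B. S X)"
    using c0 N unfolding E_def split by simp
  hence "cmod (complex_of_real E) \<le> cmod (complex_of_real (E0 - main)) + 2 ^ card A * M"
    using SB norm_triangle_ineq[of "complex_of_real (E0 - main)" "\<Sum>X\<in>B. S X"] by simp
  hence "\<bar>E\<bar> \<le> \<bar>E0 - main\<bar> + 2 ^ card A * M" unfolding norm_of_real .
  also have "\<bar>E0 - main\<bar> \<le> 32 * (C2 + 1) * x powr (1/3)"
    unfolding E0_def main_def by (rule main_term_bound[OF C2 x])
  finally have 1: "\<bar>E\<bar> \<le> 32 * (C2 + 1) * x powr (1/3) + 2 ^ card A * M" by simp
  have 2: "real (N_S p x) = c * (main + E)" using c0 by (simp add: E_def)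
  show ?thesis
    by (rule that[OF 1[unfolded A_def M_def] 2[unfolded c_def main_def]])
qed

end

theorem theorem2:
  assumes "GRH"
  shows "\<exists>C::real. \<forall>(p::nat) (x::real). prime p \<longrightarrow> odd p \<longrightarrow> x \<ge> 2 \<longrightarrow>
    (\<exists>E::real.
       \<bar>E\<bar> \<le> C * (2 ^ card (prime_factors (p - 1)) * x powr (1 / 3) * (ln (real p * x))\<^sup>2) \<and>
       real (N_S p x) =
         real (totient (p - 1)) / real (p - 1) *
         ((\<Sum>r | prime r \<and> real r \<le> x powr (1 / 3).
             (chi0 p r - chi2 p r) * Li (x powr (1 / 2) / real r powr (3 / 2))) + E))"
proof -
  obtain C1 where C1: "prime_char_sums_le C1"
    by (rule prime_char_sum_bound[OF assms])
  obtain C2 where C2: "C2 \<ge> 0" "\<And>y. \<bar>real (card {l. prime l \<and> real l \<le> y}) - Li y\<bar> \<le> C2 * y powr (5/8)"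
    by (fact prime_count_Li_bound[OF assms])
  show ?thesis
  proof (rule exI[of _ "32 * (C2 + 1) + 16 * C1"], intro allI impI)
    fix p :: nat and x :: real
    assume p: "prime p" "odd p" and x: "x \<ge> 2"
    have "p ^ 1 \<in> {p ^ k |p k. prime p \<and> odd p \<and> k > 0}" using p by blast
    hence "p \<in> cyclic_moduli" by (simp add: cyclic_moduli_def)
    then obtain g where g: "residue_primroot p g" using residue_primroot_iff_in_cyclic_moduli by blast
    interpret primitive_root_modulus p g by unfold_locales fact+
    have x1: "x \<ge> 1" using x by simp
    obtain E where E: "\<bar>E\<bar> \<le> 32 * (C2 + 1) * x powr (1/3) + 2 ^ card (prime_factors P) * (16 * C1 * ln (real p) * x powr (1/3))"
      "real (N_S p x) = real (totient P) / real P * ((\<Sum>r\<in>r_range x. (chi0 p r - chi2 p r) * Li (y_bound x r)) + E)"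
      by (rule N_S_asymptotic[OF C1 C2 x1])
    define L where "L = ln (real p * x)"
    define w where "w = (2::real) ^ card (prime_factors P)"
    have w: "w \<ge> 1" by (simp add: w_def)
    \<comment> \<open>As \<open>p >= 3\<close>, the product \<open>p * x\<close> is at least
      \<open>3 >= exp 1\<close>, so \<open>L >= 1\<close>. Both 1 and \<open>ln p\<close>, the sizes
      of the two error parts relative to \<open>x^(1/3)\<close>, are then at most
      \<open>L^2\<close>.\<close>
    have "exp 1 \<le> (3::real)" using exp_le by simp
    also have "3 * 1 \<le> real p * x" using p_gt_2 x by (intro mult_mono) auto
    finally have L1: "L \<ge> 1" unfolding L_def using p_gt_2 x by (subst ln_ge_iff) auto
    have "real p * 1 \<le> real p * x" using x by (intro mult_left_mono) auto
    hence "ln (real p) \<le> L" unfolding L_def using p_gt_2 x by simp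
    also have "L \<le> L\<^sup>2" using L1 by (simp add: power2_eq_square)
    finally have lp: "ln (real p) \<le> L\<^sup>2" .
    have L2: "1 \<le> L\<^sup>2" using L1 by (simp add: one_le_power)
    have "1 * 1 \<le> w * L\<^sup>2" using w L2 by (intro mult_mono) auto
    hence "32 * (C2 + 1) * x powr (1/3) * 1 \<le> 32 * (C2 + 1) * x powr (1/3) * (w * L\<^sup>2)"
      using C2(1) by (intro mult_left_mono) auto
    moreover have "w * (16 * C1 * ln (real p) * x powr (1/3)) \<le> w * (16 * C1 * L\<^sup>2 * x powr (1/3))"
      using lp w C1[unfolded prime_char_sums_le_def] by (intro mult_left_mono mult_right_mono) auto
    ultimately have "\<bar>E\<bar> \<le> 32 * (C2 + 1) * x powr (1/3) * (w * L\<^sup>2) + w * (16 * C1 * L\<^sup>2 * x powr (1/3))"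
      using E(1) unfolding w_def by linarith
    hence "\<bar>E\<bar> \<le> (32 * (C2 + 1) + 16 * C1) * (w * x powr (1/3) * L\<^sup>2)"
      by (simp add: algebra_simps)
    thus "\<exists>E::real.
       \<bar>E\<bar> \<le> (32 * (C2 + 1) + 16 * C1) * (2 ^ card (prime_factors (p - 1)) * x powr (1 / 3) * (ln (real p * x))\<^sup>2) \<and>
       real (N_S p x) =
         real (totient (p - 1)) / real (p - 1) *
         ((\<Sum>r | prime r \<and> real r \<le> x powr (1 / 3).
             (chi0 p r - chi2 p r) * Li (x powr (1 / 2) / real r powr (3 / 2))) + E)"
      using E(2) unfolding w_def L_def P_def r_range_def y_bound_def by (intro exI[of _ E] conjI)
  qed
qed

end
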